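(* Let $B$ be a Blaschke product. Then $B'\in H^{1}_{w}$ if and only if there exists a constant $C=C(B)>0$ such that for any $f\in(BH^{2})^{\perp}$ and any $0<r<1$, one has $$|\{e^{i\theta}: |f'(re^{i\theta})|>\lambda\|f\|_{2}\}|\le C\lambda^{-2/3}$$ for any $\lambda>0$.
   Context: Let $\mathbb{D}$ be the open unit disc of the complex plane and $\partial\mathbb{D}$ the unit circle; $|E|$ denotes the length of a measurable set $E\subset\partial\mathbb{D}$. A Blaschke product is a (finite or infinite) product $B(z)=\prod_{n}\frac{\overline{z}_{n}}{|z_{n}|}\frac{z_{n}-z}{1-\overline{z}_{n}z}$, $z\in\mathbb{D}$, with zeros $z_n\in\mathbb{D}$ (repeated according to multiplicity) satisfying $\sum_n(1-|z_n|)<\infty$, with the convention $\overline{z}/|z|=1$ if $z=0$. For $0<p<\infty$, $H^p$ is the Hardy space of analytic functions $f$ in $\mathbb{D}$ with $\|f\|_p^p=\sup_{r<1}\int_0^{2\pi}|f(re^{i\theta})|^p\,d\theta<\infty$. The space $(BH^{2})^{\perp}$ is the orthogonal complement of the subspace $BH^{2}=\{Bg: g\in H^2\}$ in the Hilbert space $H^{2}$. For $0<p<\infty$, the weak Hardy space $H^{p}_{w}$ consists of those analytic functions $f$ in $\mathbb{D}$ for which there exists a constant $C=C(f)>0$ such that $|\{e^{i\theta}: |f(re^{i\theta})|>\lambda\}|\le C\lambda^{-p}$ for any $0<r<1$ and any $\lambda>0$. *)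

theory Defs
  imports "HOL-Complex_Analysis.Complex_Analysis"
begin

text \<open>
  Functions on the open unit disc are modelled as functions on all of \<open>complex\<close>; nothing below
  depends on their values outside \<open>ball 0 1\<close>.
\<close>

definition circle_length :: "complex set \<Rightarrow> real" where
  "circle_length E = measure lebesgue {\<theta> \<in> {0..<2 * pi}. cis \<theta> \<in> E}"

definition blaschke_factor :: "complex \<Rightarrow> complex \<Rightarrow> complex" where
  "blaschke_factor a z =
     (if a = 0 then 1 else cnj a / of_real (norm a)) * ((a - z) / (1 - cnj a * z))"

text \<open>
  The zeros, repeated according to multiplicity, are \<open>a n\<close> for \<open>n \<in> I\<close>; the index set \<open>I\<close> may be
  finite (even empty) or infinite. Each point of the disc equals \<open>a n\<close> for only finitely many
  \<open>n \<in> I\<close>, so \<open>prodinf\<close> is the value of a convergent product also at the zeros.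
\<close>
definition is_blaschke_product :: "(complex \<Rightarrow> complex) \<Rightarrow> bool" where
  "is_blaschke_product B \<longleftrightarrow>
     (\<exists>(a :: nat \<Rightarrow> complex) (I :: nat set).
        (\<forall>n\<in>I. norm (a n) < 1) \<and>
        (\<lambda>n. 1 - norm (a n)) summable_on I \<and>
        (\<forall>z\<in>ball 0 1. B z = (\<Prod>n. if n \<in> I then blaschke_factor (a n) z else 1)))"

definition hardy_mean :: "real \<Rightarrow> (complex \<Rightarrow> complex) \<Rightarrow> real \<Rightarrow> real" where
  "hardy_mean p f r = integral {0..2 * pi} (\<lambda>\<theta>. norm (f (of_real r * cis \<theta>)) powr p)"

definition hardy_space :: "real \<Rightarrow> (complex \<Rightarrow> complex) set" where
  "hardy_space p = {f. f holomorphic_on ball 0 1 \<and> bdd_above (hardy_mean p f ` {0..<1})}"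

definition hardy_norm :: "real \<Rightarrow> (complex \<Rightarrow> complex) \<Rightarrow> real" where
  "hardy_norm p f = (SUP r\<in>{0..<1}. hardy_mean p f r) powr (1 / p)"

text \<open>
  The inner product of the Hilbert space \<open>hardy_space 2\<close>: the one inducing \<open>hardy_norm 2\<close>, because
  the means \<open>hardy_mean 2 f r\<close> increase with \<open>r\<close>, so that their supremum is their limit as \<open>r\<close>
  tends to 1. The limit below exists for all \<open>f\<close> and \<open>g\<close> in \<open>hardy_space 2\<close> and equals the integral of
  the product of the boundary values of \<open>f\<close> and \<open>cnj \<circ> g\<close>.
\<close>
definition hardy_inner :: "(complex \<Rightarrow> complex) \<Rightarrow> (complex \<Rightarrow> complex) \<Rightarrow> complex" where
  "hardy_inner f g =
     Lim (at_left (1::real))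
       (\<lambda>r. integral {0..2 * pi} (\<lambda>\<theta>. f (of_real r * cis \<theta>) * cnj (g (of_real r * cis \<theta>))))"

definition hardy_orthogonal_complement :: "(complex \<Rightarrow> complex) set \<Rightarrow> (complex \<Rightarrow> complex) set" where
  "hardy_orthogonal_complement S = {f \<in> hardy_space 2. \<forall>h\<in>S. hardy_inner f h = 0}"

definition model_space :: "(complex \<Rightarrow> complex) \<Rightarrow> (complex \<Rightarrow> complex) set" where
  "model_space B = hardy_orthogonal_complement ((\<lambda>g z. B z * g z) ` hardy_space 2)"

definition weak_hardy_space :: "real \<Rightarrow> (complex \<Rightarrow> complex) set" where
  "weak_hardy_space p =
     {f. f holomorphic_on ball 0 1 \<and>
         (\<exists>C>0. \<forall>r\<in>{0<..<1}. \<forall>t>0.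
            circle_length {\<zeta> \<in> sphere 0 1. norm (f (of_real r * \<zeta>)) > t} \<le> C * t powr (- p))}"

end

theory Submission
  imports Defs
begin

text \<open>
  Both sides are equivalent to the zeros being ``exponential'': the number of zeros with
  \<open>\<delta> \<le> 1 - \<bar>a\<^sub>n\<bar> < 2\<delta>\<close> is bounded independently of \<open>\<delta>\<close>.

  If the zeros are exponential, put \<open>d\<^sub>n = 1 - \<bar>a\<^sub>n\<bar>\<close> and
  \<open>Z\<^sub>\<beta> = \<Sum> \<surd>d\<^sub>n / \<bar>1 - cnj a\<^sub>n z\<bar>\<^sup>\<beta>\<close>. Then \<open>\<bar>B'\<bar> \<le> 2 Z\<^sub>1\<^sup>2\<close>, and the kernel that reproduces \<open>f'(z)\<close> on the
  model space is \<open>\<Sum> cnj (e\<^sub>n'(z)) e\<^sub>n\<close> with the Malmquist--Takenaka functions \<open>e\<^sub>n\<close>, whence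
  \<open>\<bar>f'(z)\<bar> \<le> C \<parallel>f\<parallel> (Z\<^sub>1\<^sup>3 + Z\<^sub>2)\<close>. For exponential zeros the sums behave like geometric series: \<open>Z\<^sub>1\<close> is
  of weak type 2 and \<open>Z\<^sub>2\<close> of weak type 2/3, so that no orthogonality is needed.

  Conversely let \<open>M\<close> zeros lie on the scale \<open>\<delta>\<close>, attach to each an arc of length \<open>\<delta>\<close>, and let \<open>A\<^sub>k\<close> be
  the set covered by at least \<open>k\<close> of the arcs, so that \<open>\<Sum>\<^sub>k \<bar>A\<^sub>k\<bar> = M\<delta>\<close>. It suffices that
  \<open>\<bar>A\<^sub>k\<bar> \<le> C \<delta> M\<^sup>1\<^sup>/\<^sup>3 k\<^sup>-\<^sup>2\<^sup>/\<^sup>3\<close>, for then \<open>M \<le> 3 C M\<^sup>2\<^sup>/\<^sup>3\<close>. If \<open>B'\<close> is in the weak Hardy space, compare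
  \<open>\<bar>B\<bar>\<close>, which is at most a constant less than 1 over \<open>A\<^sub>k\<close> at radius \<open>1 - \<delta>/k\<close>, with its boundary modulus
  1. If the estimate on the model space holds, apply it to the sums \<open>\<Sum> \<plusminus>e\<^sub>n\<close>, of norm \<open>\<surd>(2\<pi>M)\<close>: over
  \<open>A\<^sub>k\<close> some \<open>\<bar>e\<^sub>n'\<bar>\<close> is at least \<open>c k \<delta>\<^sup>-\<^sup>3\<^sup>/\<^sup>2\<close>, and at each point half of the sign patterns inherit this bound.
\<close>

section \<open>Blaschke factors and Malmquist--Takenaka functions\<close>

text \<open>Pairings are taken on circles of radius \<open>r < 1\<close>, where the formulas of
  Cauchy and Parseval are exact, and \<open>r\<close> then tends to 1; only finite products and the
  functions built from them, continuous on the closed disc, are evaluated on the unit circle itself.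
  The exponents 1/3 and 2/3 in the bound for \<open>A\<^sub>k\<close> come from the model space: the
  level \<open>k / \<delta> powr (3/2)\<close>, divided by the norm of order \<open>sqrt M\<close>
  and raised to the power -2/3, is \<open>\<delta> * M powr (1/3) * k powr - (2/3)\<close>. The weak
  Hardy space yields the bound \<open>\<delta> / k\<close>, which is smaller because
  \<open>k \<le> M\<close>, so one counting argument serves both cases. The signs are there because
  the zero with the large derivative depends on the point of \<open>A\<^sub>k\<close>; averaging
  over all patterns treats every point at once and costs only a factor 2. In the other direction the
  cube of a sum of weak type 2 is of weak type 2/3, the type of \<open>Z\<^sub>2\<close>; this is
  how both parts of the kernel estimate lead to the exponent in the theorem.\<close>

abbreviation circ :: "real \<Rightarrow> real \<Rightarrow> complex" where
  "circ r \<theta> \<equiv> of_real r * cis \<theta>"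

abbreviation circle_integral :: "real \<Rightarrow> (complex \<Rightarrow> 'a) \<Rightarrow> 'a::real_normed_vector" where
  "circle_integral r f \<equiv> integral {0..2 * pi} (\<lambda>\<theta>. f (circ r \<theta>))"

abbreviation angles :: "real \<Rightarrow> (complex \<Rightarrow> bool) \<Rightarrow> real set" where
  "angles r P \<equiv> {\<theta> \<in> {0..<2 * pi}. P (circ r \<theta>)}"

lemma dist_circ_cis: "dist (circ r \<theta>) (cis \<theta>) = \<bar>r - 1\<bar>"
proof -
  have "dist (circ r \<theta>) (cis \<theta>) = norm (of_real (r - 1) * cis \<theta>)" by (simp add: dist_norm algebra_simps)
  thus ?thesis by (simp only: norm_mult norm_cis norm_of_real mult_1_right)
qed

text \<open>The Szego kernel normalised for the measure \<open>d\<theta> / (2 pi)\<close>. Since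
  \<open>hardy_norm\<close> uses \<open>d\<theta>\<close>, its norm there is
  \<open>sqrt (2 * pi)\<close>, which explains this factor in the estimates below.\<close>

definition szego :: "complex \<Rightarrow> complex \<Rightarrow> complex" where
  "szego a z = of_real (sqrt (1 - (norm a)\<^sup>2)) / (1 - cnj a * z)"

definition bprod :: "(nat \<Rightarrow> complex) \<Rightarrow> nat set \<Rightarrow> complex \<Rightarrow> complex" where
  "bprod a F z = (\<Prod>n\<in>F. blaschke_factor (a n) z)"

text \<open>For distinct zeros these arise, up to unimodular constants, from Szego kernels by
  Gram-Schmidt in the order of the indices. Only indices below \<open>n\<close> enter the product,
  so it is finite even for infinite \<open>F\<close>, and cutting \<open>F\<close> down to an
  initial segment that contains \<open>n\<close> changes nothing.\<close>

definition malmquist :: "(nat \<Rightarrow> complex) \<Rightarrow> nat set \<Rightarrow> nat \<Rightarrow> complex \<Rightarrow> complex" where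
  "malmquist a F n z = bprod a {j \<in> F. j < n} z * szego (a n) z"

definition sgn_cnj :: "complex \<Rightarrow> complex" where
  "sgn_cnj a = (if a = 0 then 1 else cnj a / of_real (norm a))"

lemma blaschke_factor_alt: "blaschke_factor a z = sgn_cnj a * ((a - z) / (1 - cnj a * z))"
  by (simp add: blaschke_factor_def sgn_cnj_def)

lemma norm_sgn_cnj [simp]: "norm (sgn_cnj a) = 1"
  by (simp add: sgn_cnj_def norm_divide)

lemma sgn_cnj_mult_cnj: "sgn_cnj a * cnj (sgn_cnj a) = 1"
  by (simp add: complex_norm_square[symmetric])

lemma one_minus_cnj_mult_nz:
  assumes "norm a < 1" "norm z \<le> 1"
  shows "1 - cnj a * z \<noteq> 0"
proof
  assume "1 - cnj a * z = 0"
  hence "norm (cnj a * z) = 1" by simp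
  moreover have "norm (cnj a * z) \<le> norm a"
    using assms by (simp add: norm_mult mult_left_le)
  ultimately show False using assms by simp
qed

lemma norm_one_minus_cnj_mult_ge:
  assumes "norm z \<le> 1"
  shows "1 - norm a \<le> norm (1 - cnj a * z)"
proof -
  have "norm (cnj a * z) \<le> norm a"
    using assms by (simp add: norm_mult mult_left_le)
  thus ?thesis using norm_triangle_ineq2[of 1 "cnj a * z"] by simp
qed

text \<open>The Schwarz-Pick identity in polarised form. With two independent points it telescopes
  over the factors of a product; with \<open>w = z\<close> it measures how far a factor is from
  modulus 1.\<close>

lemma blaschke_factor_kernel:
  assumes "norm a < 1" "norm z \<le> 1" "norm w \<le> 1"
  shows "1 - blaschke_factor a z * cnj (blaschke_factor a w) =
    (1 - z * cnj w) * (szego a z * cnj (szego a w))"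
proof -
  define p where "p = 1 - cnj a * z"
  define q where "q = 1 - a * cnj w"
  have nz: "p \<noteq> 0" "q \<noteq> 0"
    using one_minus_cnj_mult_nz[OF assms(1,2)] one_minus_cnj_mult_nz[OF assms(1,3)]
    unfolding p_def q_def by (auto simp: complex_eq_iff)
  have s: "complex_of_real (sqrt (1 - (norm a)\<^sup>2)) * of_real (sqrt (1 - (norm a)\<^sup>2)) = 1 - a * cnj a"
  proof -
    have "(norm a)\<^sup>2 \<le> 1" using assms by (simp add: power_le_one)
    hence "sqrt (1 - (norm a)\<^sup>2) * sqrt (1 - (norm a)\<^sup>2) = 1 - (norm a)\<^sup>2" by simp
    thus ?thesis by (metis complex_norm_square of_real_1 of_real_diff of_real_mult)
  qed
  have "blaschke_factor a z * cnj (blaschke_factor a w)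
    = sgn_cnj a * cnj (sgn_cnj a) * ((a - z) * (cnj a - cnj w) / (p * q))"
    by (simp add: blaschke_factor_alt p_def q_def field_simps)
  hence 1: "1 - blaschke_factor a z * cnj (blaschke_factor a w) = (p * q - (a - z) * (cnj a - cnj w)) / (p * q)"
    using nz by (simp add: sgn_cnj_mult_cnj diff_divide_distrib)
  have "szego a z * cnj (szego a w) = (1 - a * cnj a) / (p * q)"
    using s by (simp add: szego_def p_def q_def)
  moreover have "p * q - (a - z) * (cnj a - cnj w) = (1 - z * cnj w) * (1 - a * cnj a)"
    by (simp add: p_def q_def algebra_simps)
  ultimately show ?thesis using 1 by simp
qed

lemma norm_szego_sq:
  assumes "norm a < 1"
  shows "(norm (szego a z))\<^sup>2 = (1 - (norm a)\<^sup>2) / (norm (1 - cnj a * z))\<^sup>2"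
proof -
  have "(norm a)\<^sup>2 \<le> 1" using assms by (simp add: power_le_one)
  thus ?thesis by (simp add: szego_def norm_divide power_divide)
qed

lemma one_minus_norm_blaschke_factor_sq:
  assumes "norm a < 1" "norm z \<le> 1"
  shows "1 - (norm (blaschke_factor a z))\<^sup>2 =
    (1 - (norm z)\<^sup>2) * ((1 - (norm a)\<^sup>2) / (norm (1 - cnj a * z))\<^sup>2)"
proof -
  have "complex_of_real (1 - (norm (blaschke_factor a z))\<^sup>2) =
    of_real ((1 - (norm z)\<^sup>2) * (norm (szego a z))\<^sup>2)"
    unfolding of_real_diff of_real_mult complex_norm_square of_real_1
    by (rule blaschke_factor_kernel[OF assms assms(2)])
  thus ?thesis using norm_szego_sq[OF assms(1)] of_real_eq_iff by metis
qed

lemma norm_blaschke_factor_le_1: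
  assumes "norm a < 1" "norm z \<le> 1"
  shows "norm (blaschke_factor a z) \<le> 1"
proof -
  have "(norm z)\<^sup>2 \<le> 1" "(norm a)\<^sup>2 \<le> 1" using assms by (simp_all add: power_le_one)
  hence "0 \<le> 1 - (norm (blaschke_factor a z))\<^sup>2"
    unfolding one_minus_norm_blaschke_factor_sq[OF assms] by simp
  thus ?thesis by (simp add: power2_le_imp_le abs_square_le_1)
qed

lemma norm_blaschke_factor_eq_1:
  assumes "norm a < 1" "norm z = 1"
  shows "norm (blaschke_factor a z) = 1"
  using one_minus_norm_blaschke_factor_sq[of a z] assms
  by (simp add: power2_eq_1_iff) (metis norm_ge_zero zero_le_one abs_of_nonneg abs_1 power2_eq_1_iff abs_minus_cancel)

lemma norm_blaschke_factor_0 [simp]: "norm (blaschke_factor a 0) = norm a"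
  by (simp add: blaschke_factor_alt norm_mult)

text \<open>The rotation by \<open>cnj a / norm a\<close> makes the numerator of
  \<open>1 - blaschke_factor a z\<close> divisible by \<open>1 - norm a\<close>. The bound is the
  summable majorant behind the convergence of infinite products.\<close>

lemma norm_one_minus_blaschke_factor_le:
  assumes "norm a < 1" "norm z < 1"
  shows "norm (1 - blaschke_factor a z) \<le> 2 / (1 - norm z) * (1 - norm a)"
proof (cases "a = 0")
  case True
  have "norm (1 + z) \<le> 2" using norm_triangle_ineq[of 1 z] assms by simp
  also have "2 \<le> 2 / (1 - norm z)" using assms by (simp add: field_simps)
  finally show ?thesis using True by (simp add: blaschke_factor_def)
next
  case False
  define p where "p = 1 - cnj a * z"
  have p: "p \<noteq> 0" unfolding p_def using one_minus_cnj_mult_nz assms by simp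
  have aa: "a * cnj a = of_real (norm a) * of_real (norm a)"
    using complex_norm_square[of a] by (simp add: power2_eq_square)
  have "1 - blaschke_factor a z = (of_real (norm a) * p - cnj a * (a - z)) / (of_real (norm a) * p)"
  proof -
    have *: "1 - X / Y = (Y - X) / Y" if "Y \<noteq> 0" for X Y :: complex
      using that by (simp add: diff_divide_distrib)
    have "blaschke_factor a z = cnj a * (a - z) / (of_real (norm a) * p)"
      using False by (simp add: blaschke_factor_def p_def)
    thus ?thesis using False p by (simp add: *)
  qed
  also have "of_real (norm a) * p - cnj a * (a - z) = (1 - of_real (norm a)) * (of_real (norm a) + cnj a * z)"
    using aa by (simp add: p_def algebra_simps)
  finally have "norm (1 - blaschke_factor a z) = (1 - norm a) * norm (of_real (norm a) + cnj a * z) / (norm a * norm p)"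
    using assms False by (simp add: norm_mult norm_divide) (metis abs_of_nonneg diff_ge_0_iff_ge less_imp_le norm_of_real of_real_1 of_real_diff)
  also have "\<dots> \<le> (1 - norm a) * (2 * norm a) / (norm a * (1 - norm z))"
  proof -
    have "norm (of_real (norm a) + cnj a * z) \<le> norm a + norm a * norm z"
      using norm_triangle_ineq[of "of_real (norm a)" "cnj a * z"] by (simp add: norm_mult)
    also have "\<dots> \<le> norm a + norm a * 1" using assms by (intro add_left_mono mult_left_mono) auto
    finally have 1: "norm (of_real (norm a) + cnj a * z) \<le> 2 * norm a" by simp
    have "norm (cnj a * z) \<le> 1 * norm z" unfolding norm_mult using assms by (intro mult_right_mono) auto
    hence 2: "1 - norm z \<le> norm p" unfolding p_def using norm_triangle_ineq2[of 1 "cnj a * z"] by simp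
    show ?thesis
      using assms False 1 2 by (intro frac_le mult_left_mono mult_nonneg_nonneg mult_pos_pos) auto
  qed
  also have "\<dots> = 2 / (1 - norm z) * (1 - norm a)" using False by simp
  finally show ?thesis .
qed

lemma has_field_derivative_blaschke_factor:
  assumes "norm a < 1" "norm z \<le> 1"
  shows "(blaschke_factor a has_field_derivative
           - sgn_cnj a * of_real (1 - (norm a)\<^sup>2) / (1 - cnj a * z)\<^sup>2) (at z)"
proof -
  note nz = one_minus_cnj_mult_nz[OF assms]
  have "((\<lambda>z. sgn_cnj a * ((a - z) / (1 - cnj a * z))) has_field_derivative
       sgn_cnj a * (((0 - 1) * (1 - cnj a * z) - (a - z) * (0 - cnj a * 1)) / ((1 - cnj a * z) * (1 - cnj a * z)))) (at z)"
    by (intro derivative_intros DERIV_cmult DERIV_divide nz)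
  moreover have "sgn_cnj a * (((0 - 1) * (1 - cnj a * z) - (a - z) * (0 - cnj a * 1)) / ((1 - cnj a * z) * (1 - cnj a * z)))
     = - sgn_cnj a * of_real (1 - (norm a)\<^sup>2) / (1 - cnj a * z)\<^sup>2"
  proof -
    have "(0 - 1) * (1 - cnj a * z) - (a - z) * (0 - cnj a * 1) = - of_real (1 - (norm a)\<^sup>2)"
      unfolding of_real_diff complex_norm_square by (simp add: algebra_simps)
    thus ?thesis by (simp only: power2_eq_square mult_minus_left mult_minus_right minus_divide_left times_divide_eq_right)
  qed
  ultimately show ?thesis unfolding blaschke_factor_alt[abs_def] by simp
qed

lemma blaschke_factor_field_differentiable:
  "norm a < 1 \<Longrightarrow> norm z \<le> 1 \<Longrightarrow> blaschke_factor a field_differentiable at z"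
  using has_field_derivative_blaschke_factor unfolding field_differentiable_def by blast

lemma has_field_derivative_szego:
  assumes "norm a < 1" "norm z \<le> 1"
  shows "(szego a has_field_derivative szego a z * (cnj a / (1 - cnj a * z))) (at z)"
  unfolding szego_def[abs_def] using one_minus_cnj_mult_nz[OF assms]
  by (auto intro!: derivative_eq_intros simp: field_simps)

lemma szego_holomorphic: "norm a < 1 \<Longrightarrow> S \<subseteq> cball 0 1 \<Longrightarrow> szego a holomorphic_on S"
  unfolding holomorphic_on_def field_differentiable_def subset_iff
  by (metis has_field_derivative_at_within has_field_derivative_szego mem_cball_0)

lemma blaschke_factor_holomorphic: "norm a < 1 \<Longrightarrow> S \<subseteq> cball 0 1 \<Longrightarrow> blaschke_factor a holomorphic_on S"
  unfolding holomorphic_on_def field_differentiable_def subset_iff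
  by (metis has_field_derivative_at_within has_field_derivative_blaschke_factor mem_cball_0)

lemma norm_szego_le:
  assumes "norm a < 1" "norm z \<le> 1"
  shows "norm (szego a z) \<le> sqrt 2 * (sqrt (1 - norm a) / norm (1 - cnj a * z))"
proof -
  have "1 - (norm a)\<^sup>2 = (1 - norm a) * (1 + norm a)" by (simp add: power2_eq_square algebra_simps)
  also have "\<dots> \<le> (1 - norm a) * 2" using assms by (intro mult_left_mono) auto
  finally have "sqrt (1 - (norm a)\<^sup>2) \<le> sqrt (2 * (1 - norm a))" by simp
  hence "sqrt (1 - (norm a)\<^sup>2) \<le> sqrt 2 * sqrt (1 - norm a)" by (simp only: real_sqrt_mult)
  moreover have "(norm a)\<^sup>2 \<le> 1" using assms by (simp add: power_le_one)
  ultimately show ?thesis unfolding szego_def norm_divide by (auto simp: divide_right_mono)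
qed

context
  fixes a :: "nat \<Rightarrow> complex" and F :: "nat set"
  assumes fin: "finite F" and lt: "\<And>n. n \<in> F \<Longrightarrow> norm (a n) < 1"
begin

lemma norm_bprod_le_1: "norm z \<le> 1 \<Longrightarrow> norm (bprod a F z) \<le> 1"
  unfolding bprod_def prod_norm[symmetric]
  by (intro prod_le_1 conjI norm_blaschke_factor_le_1 lt) auto

lemma norm_bprod_eq_1: "norm z = 1 \<Longrightarrow> norm (bprod a F z) = 1"
  unfolding bprod_def prod_norm[symmetric]
  by (intro prod.neutral ballI norm_blaschke_factor_eq_1 lt) auto

lemma bprod_holomorphic: "S \<subseteq> cball 0 1 \<Longrightarrow> bprod a F holomorphic_on S"
  unfolding bprod_def[abs_def] by (intro holomorphic_intros blaschke_factor_holomorphic lt) auto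

lemma bprod_field_differentiable: "norm z \<le> 1 \<Longrightarrow> bprod a F field_differentiable at z"
  unfolding bprod_def[abs_def]
  using fin lt
  by (induction F rule: finite_induct)
     (auto intro!: field_differentiable_mult
           intro: blaschke_factor_field_differentiable)

end

lemma bprod_insert: "finite F \<Longrightarrow> n \<notin> F \<Longrightarrow> bprod a (insert n F) z = blaschke_factor (a n) z * bprod a F z"
  by (simp add: bprod_def)

lemma bprod_empty [simp]: "bprod a {} z = 1"
  by (simp add: bprod_def)

text \<open>Telescopes \<open>blaschke_factor_kernel\<close>. The induction adds the largest index,
  which leaves the functions of the smaller indices unchanged and contributes one new summand.
  Divided by \<open>1 - z * cnj w\<close>, this is the reproducing kernel of the model space of the
  finite product.\<close>

lemma bprod_kernel:
  assumes "finite F" "\<And>n. n \<in> F \<Longrightarrow> norm (a n) < 1" "norm z \<le> 1" "norm w \<le> 1"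
  shows "1 - bprod a F z * cnj (bprod a F w) =
    (1 - z * cnj w) * (\<Sum>n\<in>F. malmquist a F n z * cnj (malmquist a F n w))"
  using assms(1,2)
proof (induction F rule: finite_linorder_max_induct)
  case empty
  then show ?case by simp
next
  case (insert b F)
  have b: "b \<notin> F" using insert by auto
  have 1: "{j \<in> insert b F. j < n} = {j \<in> F. j < n}" if "n \<in> F" for n
    using insert that by auto
  have 2: "{j \<in> insert b F. j < b} = F"
    using insert by auto
  have 3: "malmquist a (insert b F) n = malmquist a F n" if "n \<in> F" for n
    by (simp only: malmquist_def[abs_def] 1[OF that])
  have 4: "malmquist a (insert b F) b u = bprod a F u * szego (a b) u" for u
    by (simp only: malmquist_def 2)
  have "(\<Sum>n\<in>insert b F. malmquist a (insert b F) n z * cnj (malmquist a (insert b F) n w))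
    = bprod a F z * szego (a b) z * cnj (bprod a F w * szego (a b) w) +
      (\<Sum>n\<in>F. malmquist a F n z * cnj (malmquist a F n w))"
    using insert(1) b by (simp add: 3 4)
  hence "(1 - z * cnj w) * (\<Sum>n\<in>insert b F. malmquist a (insert b F) n z * cnj (malmquist a (insert b F) n w))
    = bprod a F z * cnj (bprod a F w) * ((1 - z * cnj w) * (szego (a b) z * cnj (szego (a b) w)))
     + (1 - bprod a F z * cnj (bprod a F w))"
    using insert by (simp add: algebra_simps)
  also have "(1 - z * cnj w) * (szego (a b) z * cnj (szego (a b) w)) =
      1 - blaschke_factor (a b) z * cnj (blaschke_factor (a b) w)"
    using insert.prems assms by (simp add: blaschke_factor_kernel)
  also have "bprod a F z * cnj (bprod a F w) * (1 - blaschke_factor (a b) z * cnj (blaschke_factor (a b) w))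
     + (1 - bprod a F z * cnj (bprod a F w)) = 1 - bprod a (insert b F) z * cnj (bprod a (insert b F) w)"
    using b insert(1) by (simp add: bprod_insert algebra_simps)
  finally show ?case by simp
qed

section \<open>Means over circles and the Hardy space\<close>

definition circle_prod :: "(complex \<Rightarrow> complex) \<Rightarrow> (complex \<Rightarrow> complex) \<Rightarrow> real \<Rightarrow> complex" where
  "circle_prod f g r = circle_integral r (\<lambda>w. f w * cnj (g w))"

definition taylor_coeff :: "(complex \<Rightarrow> complex) \<Rightarrow> nat \<Rightarrow> complex" where
  "taylor_coeff f n = (deriv ^^ n) f 0 / fact n"

section \<open>Formulas of Cauchy and Parseval on circles inside the disc\<close>

lemma continuous_on_circle:
  assumes "continuous_on (ball 0 1) f" "0 \<le> r" "r < 1"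
  shows "continuous_on S (\<lambda>\<theta>. f (circ r \<theta>))"
  by (rule continuous_on_compose2[OF assms(1)])
     (use assms in \<open>auto intro!: continuous_intros simp: norm_mult\<close>)

lemma integral_circle:
  assumes "0 < r" "(g has_contour_integral \<i> * I) (circlepath 0 r)"
  shows "circle_integral r (\<lambda>w. g w * w) = I"
proof -
  have "\<i> * I = contour_integral (part_circlepath 0 r 0 (2*pi)) g"
    using contour_integral_unique[OF assms(2)] by (simp add: circlepath_def)
  also have "\<dots> = integral {0..2*pi} (\<lambda>t. g (0 + r * cis t) * r * \<i> * cis t)"
    by (rule contour_integral_part_circlepath_eq) simp
  also have "\<dots> = integral {0..2*pi} (\<lambda>t. \<i> * (g (r * cis t) * (r * cis t)))"
    by (simp add: mult_ac)
  also have "\<dots> = \<i> * integral {0..2*pi} (\<lambda>t. g (r * cis t) * (r * cis t))"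
    by (rule integral_mult_right)
  finally show ?thesis by simp
qed

lemma integral_circle_coeff:
  fixes f :: "complex \<Rightarrow> complex"
  assumes hol: "f holomorphic_on ball 0 1" and r: "0 < r" "r < 1"
  shows "integral {0..2*pi} (\<lambda>\<theta>. f (circ r \<theta>) * cnj (cis \<theta> ^ n)) = 2 * pi * taylor_coeff f n * of_real r ^ n"
proof -
  have sub: "cball 0 r \<subseteq> ball (0::complex) 1" using r by auto
  have hc: "((\<lambda>u. f u / (u - 0) ^ (Suc n)) has_contour_integral ((2 * pi * \<i>) / (fact n) * (deriv ^^ n) f 0)) (circlepath 0 r)"
    using r sub by (intro Cauchy_has_contour_integral_higher_derivative_circlepath)
      (auto intro: holomorphic_on_subset[OF hol] holomorphic_on_imp_continuous_on)
  moreover have "(2 * pi * \<i>) / (fact n) * (deriv ^^ n) f 0 = \<i> * (2 * pi * taylor_coeff f n)"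
    by (simp add: taylor_coeff_def)
  ultimately have hc: "((\<lambda>u. f u / u ^ Suc n) has_contour_integral \<i> * (2 * pi * taylor_coeff f n)) (circlepath 0 r)"
    by (simp only: diff_0_right)
  have "circle_integral r (\<lambda>w. f w / w ^ Suc n * w) =
     2 * pi * taylor_coeff f n" by (rule integral_circle[OF r(1) hc])
  also have "(\<lambda>\<theta>. f (circ r \<theta>) / (circ r \<theta>) ^ Suc n * (circ r \<theta>)) =
     (\<lambda>\<theta>. inverse (of_real r ^ n) * (f (circ r \<theta>) * cnj (cis \<theta> ^ n)))"
  proof
    fix \<theta>
    have "cnj (cis \<theta> ^ n) = inverse (cis \<theta> ^ n)"
      by (simp add: cis_cnj cis_inverse[symmetric] power_inverse del: cis_inverse)
    thus "f (circ r \<theta>) / (circ r \<theta>) ^ Suc n * (circ r \<theta>) =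
     inverse (of_real r ^ n) * (f (circ r \<theta>) * cnj (cis \<theta> ^ n))"
      using r by (simp add: field_simps power_mult_distrib)
  qed
  also have "integral {0..2*pi} \<dots> = inverse (of_real r ^ n) * integral {0..2*pi} (\<lambda>\<theta>. f (circ r \<theta>) * cnj (cis \<theta> ^ n))"
    by (rule integral_mult_right)
  finally show ?thesis using r by (simp add: field_simps)
qed

lemma integral_circle_mean_value:
  fixes f :: "complex \<Rightarrow> complex"
  assumes "f holomorphic_on ball 0 1" "0 < r" "r < 1"
  shows "circle_integral r (\<lambda>w. f w) = 2 * pi * f 0"
  using integral_circle_coeff[OF assms, of 0] by (simp add: taylor_coeff_def)

lemma integral_cnj_interval:
  fixes f :: "real \<Rightarrow> complex"
  assumes "continuous_on {a..b} f"
  shows "integral {a..b} (\<lambda>x. cnj (f x)) = cnj (integral {a..b} f)"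
  using has_integral_linear[OF integrable_integral[OF integrable_continuous_real[OF assms]] bounded_linear_cnj]
  by (simp add: o_def has_integral_iff)

text \<open>Parseval's identity on the circle of radius \<open>r\<close>. The Taylor series of
  \<open>f\<close> converges absolutely there, which dominates the partial sums and allows
  integration term by term.\<close>

lemma circle_prod_sums:
  assumes f: "f holomorphic_on ball 0 1" and g: "g holomorphic_on ball 0 1" and r: "0 < r" "r < 1"
  shows "(\<lambda>n. 2 * pi * (taylor_coeff f n * cnj (taylor_coeff g n) * of_real (r\<^sup>2) ^ n)) sums circle_prod f g r"
proof -
  define c where "c = taylor_coeff f"
  have sums: "(\<lambda>n. c n * w ^ n) sums f w" if "norm w < 1" for w
    using holomorphic_power_series[OF f, of w] that by (simp add: c_def taylor_coeff_def)
  obtain s where s: "r < s" "s < 1" using r dense by blast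
  have "summable (\<lambda>n. c n * of_real s ^ n)" using sums[of "of_real s"] s r by (simp add: sums_iff)
  hence "summable (\<lambda>n. norm (c n * of_real r ^ n))"
    by (rule powser_insidea) (use s r in auto)
  hence sm: "summable (\<lambda>n. norm (c n) * r ^ n)" using r by (simp add: norm_mult norm_power)
  have contg: "continuous_on S (\<lambda>\<theta>. g (circ r \<theta>))" for S
    using g r by (intro continuous_on_circle holomorphic_on_imp_continuous_on) auto
  have "(\<lambda>N. circle_integral r (\<lambda>w. (\<Sum>n<N. c n * w ^ n) * cnj (g w)))
     \<longlonglongrightarrow> circle_integral r (\<lambda>w. f w * cnj (g w))"
  proof (rule dominated_convergence(2))
    show "(\<lambda>\<theta>. (\<Sum>n<N. c n * (circ r \<theta>) ^ n) * cnj (g (circ r \<theta>))) integrable_on {0..2*pi}" for N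
      by (intro integrable_continuous_real continuous_intros contg)
    show "(\<lambda>\<theta>. (\<Sum>n. norm (c n) * r ^ n) * norm (g (circ r \<theta>))) integrable_on {0..2*pi}"
      by (intro integrable_continuous_real continuous_intros contg)
    show "norm ((\<Sum>n<N. c n * (circ r \<theta>) ^ n) * cnj (g (circ r \<theta>)))
        \<le> (\<Sum>n. norm (c n) * r ^ n) * norm (g (circ r \<theta>))" for N \<theta>
    proof -
      have "norm (\<Sum>n<N. c n * (circ r \<theta>) ^ n) \<le> (\<Sum>n<N. norm (c n) * r ^ n)"
        by (rule sum_norm_le) (use r in \<open>simp add: norm_mult norm_power\<close>)
      also have "\<dots> \<le> (\<Sum>n. norm (c n) * r ^ n)"
        by (rule sum_le_suminf[OF sm]) (use r in auto)
      finally show ?thesis by (simp add: norm_mult mult_right_mono)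
    qed
    show "(\<lambda>N. (\<Sum>n<N. c n * (circ r \<theta>) ^ n) * cnj (g (circ r \<theta>)))
      \<longlonglongrightarrow> f (circ r \<theta>) * cnj (g (circ r \<theta>))" for \<theta>
      using sums[of "circ r \<theta>"] r
      by (intro tendsto_intros) (simp add: sums_def norm_mult)
  qed
  also have "(\<lambda>N. circle_integral r (\<lambda>w. (\<Sum>n<N. c n * w ^ n) * cnj (g w)))
     = (\<lambda>N. \<Sum>n<N. 2 * pi * (c n * cnj (taylor_coeff g n) * of_real (r\<^sup>2) ^ n))"
  proof
    fix N
    have "circle_integral r (\<lambda>w. (\<Sum>n<N. c n * w ^ n) * cnj (g w))
      = integral {0..2*pi} (\<lambda>\<theta>. \<Sum>n<N. c n * of_real r ^ n * cnj (g (circ r \<theta>) * cnj (cis \<theta> ^ n)))"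
      by (simp add: sum_distrib_right sum_distrib_left power_mult_distrib mult_ac)
    also have "\<dots> = (\<Sum>n<N. integral {0..2*pi} (\<lambda>\<theta>. c n * of_real r ^ n * cnj (g (circ r \<theta>) * cnj (cis \<theta> ^ n))))"
      by (intro integral_sum finite_lessThan integrable_continuous_real continuous_intros contg)
    also have "\<dots> = (\<Sum>n<N. c n * of_real r ^ n * cnj (2 * pi * taylor_coeff g n * of_real r ^ n))"
    proof (rule sum.cong[OF refl])
      fix n
      have "integral {0..2*pi} (\<lambda>\<theta>. c n * of_real r ^ n * cnj (g (circ r \<theta>) * cnj (cis \<theta> ^ n))) =
        c n * of_real r ^ n * integral {0..2*pi} (\<lambda>\<theta>. cnj (g (circ r \<theta>) * cnj (cis \<theta> ^ n)))"
        by (rule integral_mult_right)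
      also have "integral {0..2*pi} (\<lambda>\<theta>. cnj (g (circ r \<theta>) * cnj (cis \<theta> ^ n))) =
        cnj (integral {0..2*pi} (\<lambda>\<theta>. g (circ r \<theta>) * cnj (cis \<theta> ^ n)))"
        by (intro integral_cnj_interval continuous_intros contg)
      also have "\<dots> = cnj (2 * pi * taylor_coeff g n * of_real r ^ n)"
        using integral_circle_coeff[OF g r] by simp
      finally show "integral {0..2*pi} (\<lambda>\<theta>. c n * of_real r ^ n * cnj (g (circ r \<theta>) * cnj (cis \<theta> ^ n))) =
        c n * of_real r ^ n * cnj (2 * pi * taylor_coeff g n * of_real r ^ n)" .
    qed
    also have "\<dots> = (\<Sum>n<N. 2 * pi * (c n * cnj (taylor_coeff g n) * of_real (r\<^sup>2) ^ n))"
      by (simp add: power2_eq_square power_mult_distrib mult_ac)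
    finally show "circle_integral r (\<lambda>w. (\<Sum>n<N. c n * w ^ n) * cnj (g w))
      = (\<Sum>n<N. 2 * pi * (c n * cnj (taylor_coeff g n) * of_real (r\<^sup>2) ^ n))" .
  qed
  finally show ?thesis by (simp add: sums_def circle_prod_def c_def)
qed

lemma sum_le_sums:
  fixes f :: "nat \<Rightarrow> real"
  assumes "\<And>n. 0 \<le> f n" "f sums s" "finite N"
  shows "sum f N \<le> s"
  using sum_le_suminf[OF sums_summable[OF assms(2)] assms(3)] assms by (simp add: sums_iff)

section \<open>Quadratic means and the Hardy norm\<close>

lemma hardy_mean_2: "hardy_mean 2 f r = circle_integral r (\<lambda>w. (norm (f w))\<^sup>2)"
  unfolding hardy_mean_def by (simp add: powr_numeral)

lemma hardy_mean_nonneg: "0 \<le> hardy_mean p f r"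
  unfolding hardy_mean_def
  by (cases "(\<lambda>\<theta>. norm (f (circ r \<theta>)) powr p) integrable_on {0..2 * pi}")
     (auto intro: integral_nonneg simp: not_integrable_integral)

lemma circle_prod_self:
  assumes "f holomorphic_on ball 0 1" "0 \<le> r" "r < 1"
  shows "circle_prod f f r = of_real (hardy_mean 2 f r)"
proof -
  have "continuous_on {0..2*pi} (\<lambda>\<theta>. (norm (f (circ r \<theta>)))\<^sup>2)"
    using assms by (intro continuous_intros continuous_on_circle holomorphic_on_imp_continuous_on) auto
  from has_integral_linear[OF integrable_integral[OF integrable_continuous_real[OF this]] bounded_linear_of_real[where 'a = complex]]
  have "circle_integral r (\<lambda>w. complex_of_real ((norm (f w))\<^sup>2)) = of_real (hardy_mean 2 f r)"
    by (simp only: o_def has_integral_iff hardy_mean_2)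
  thus ?thesis unfolding circle_prod_def complex_norm_square .
qed

lemma hardy_mean_sums:
  assumes f: "f holomorphic_on ball 0 1" and r: "0 < r" "r < 1"
  shows "(\<lambda>n. 2 * pi * ((norm (taylor_coeff f n))\<^sup>2 * (r\<^sup>2) ^ n)) sums hardy_mean 2 f r"
proof -
  have "(\<lambda>n. 2 * pi * (taylor_coeff f n * cnj (taylor_coeff f n) * of_real (r\<^sup>2) ^ n)) sums of_real (hardy_mean 2 f r)"
    using circle_prod_sums[OF f f r] circle_prod_self[OF f] r by simp
  also have "(\<lambda>n. 2 * pi * (taylor_coeff f n * cnj (taylor_coeff f n) * of_real (r\<^sup>2) ^ n)) =
    (\<lambda>n. complex_of_real (2 * pi * ((norm (taylor_coeff f n))\<^sup>2 * (r\<^sup>2) ^ n)))"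
    by (simp only: complex_norm_square[symmetric] of_real_mult of_real_power of_real_numeral)
  finally show ?thesis unfolding sums_of_real_iff .
qed

lemma hardy_mean_mono:
  assumes f: "f holomorphic_on ball 0 1" and r: "0 < r" "r \<le> s" "s < 1"
  shows "hardy_mean 2 f r \<le> hardy_mean 2 f s"
  by (rule sums_le[OF _ hardy_mean_sums[OF f, of r] hardy_mean_sums[OF f, of s]])
     (use r in \<open>auto intro!: mult_left_mono power_mono\<close>)

lemma hardy_mean_le_norm:
  assumes "f \<in> hardy_space 2" "0 \<le> r" "r < 1"
  shows "hardy_mean 2 f r \<le> (hardy_norm 2 f)\<^sup>2"
proof -
  have bd: "bdd_above (hardy_mean 2 f ` {0..<1})" using assms by (simp add: hardy_space_def)
  have "hardy_mean 2 f r \<le> (SUP r\<in>{0..<1}. hardy_mean 2 f r)"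
    by (rule cSUP_upper[OF _ bd]) (use assms in auto)
  moreover from this have "0 \<le> (SUP r\<in>{0..<1}. hardy_mean 2 f r)" using hardy_mean_nonneg order_trans by blast
  ultimately show ?thesis by (simp add: hardy_norm_def powr_half_sqrt)
qed

lemma hardy_norm_nonneg: "0 \<le> hardy_norm p f"
  by (simp add: hardy_norm_def)

lemma hardy_space_2I:
  assumes f: "f holomorphic_on ball 0 1" and b: "\<And>r. 0 < r \<Longrightarrow> r < 1 \<Longrightarrow> hardy_mean 2 f r \<le> K\<^sup>2" and K: "0 \<le> K"
  shows "f \<in> hardy_space 2" "hardy_norm 2 f \<le> K"
proof -
  have contf: "continuous_on (ball 0 1) f" using f by (rule holomorphic_on_imp_continuous_on)
  \<comment> \<open>Radius 0 belongs to the supremum in \<open>hardy_norm\<close> but not to the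
    hypothesis \<open>b\<close>. The mean there is the first term of the Parseval series at any
    positive radius, here 1/2.\<close>
  have "(\<lambda>n. 2 * pi * ((norm (taylor_coeff f n))\<^sup>2 * ((1/2)\<^sup>2) ^ n)) sums hardy_mean 2 f (1/2)"
    by (rule hardy_mean_sums[OF f]) auto
  hence "(\<Sum>n\<in>{0}. 2 * pi * ((norm (taylor_coeff f n))\<^sup>2 * ((1/2)\<^sup>2) ^ n)) \<le> hardy_mean 2 f (1/2)"
    by (intro sum_le_sums) auto
  hence 0: "hardy_mean 2 f 0 \<le> K\<^sup>2"
    using b[of "1/2"] by (simp add: hardy_mean_2 taylor_coeff_def)
  have bd: "hardy_mean 2 f r \<le> K\<^sup>2" if "r \<in> {0..<1}" for r
    using b[of r] 0 that by (cases "r = 0") auto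
  hence bdd: "bdd_above (hardy_mean 2 f ` {0..<1})" by (rule bdd_aboveI2)
  thus "f \<in> hardy_space 2" using f by (simp add: hardy_space_def)
  have "(SUP r\<in>{0..<1}. hardy_mean 2 f r) \<le> K\<^sup>2" by (rule cSUP_least) (use bd in auto)
  moreover have "0 \<le> (SUP r\<in>{0..<1}. hardy_mean 2 f r)"
    by (rule order_trans[OF hardy_mean_nonneg cSUP_upper[OF _ bdd, of 0]]) auto
  ultimately show "hardy_norm 2 f \<le> K" using K
    by (simp add: hardy_norm_def powr_half_sqrt real_le_lsqrt)
qed

lemma summable_taylor_coeff_sq:
  assumes "f \<in> hardy_space 2"
  shows "summable (\<lambda>n. (norm (taylor_coeff f n))\<^sup>2)"
proof (rule bounded_imp_summable)
  define K where "K = (hardy_norm 2 f)\<^sup>2"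
  have hol: "f holomorphic_on ball 0 1" using assms by (simp add: hardy_space_def)
  show "0 \<le> (norm (taylor_coeff f n))\<^sup>2" for n by simp
  show "(\<Sum>k\<le>n. (norm (taylor_coeff f k))\<^sup>2) \<le> K / (2 * pi)" for n
  proof -
    have "2 * pi * (\<Sum>k\<le>n. (norm (taylor_coeff f k))\<^sup>2 * (r\<^sup>2) ^ k) \<le> K" if "r \<in> {0<..<1}" for r
    proof -
      have "(\<Sum>k\<le>n. 2 * pi * ((norm (taylor_coeff f k))\<^sup>2 * (r\<^sup>2) ^ k)) \<le> hardy_mean 2 f r"
        using that by (intro sum_le_sums[OF _ hardy_mean_sums[OF hol]]) auto
      also have "\<dots> \<le> K" unfolding K_def by (rule hardy_mean_le_norm[OF assms]) (use that in auto)
      finally show ?thesis by (simp add: sum_distrib_left)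
    qed
    hence ev: "\<forall>\<^sub>F r in at_left 1. 2 * pi * (\<Sum>k\<le>n. (norm (taylor_coeff f k))\<^sup>2 * (r\<^sup>2) ^ k) \<le> K"
      unfolding eventually_at_left_field by (intro exI[of _ 0]) auto
    have "((\<lambda>r. 2 * pi * (\<Sum>k\<le>n. (norm (taylor_coeff f k))\<^sup>2 * (r\<^sup>2) ^ k)) \<longlongrightarrow>
       2 * pi * (\<Sum>k\<le>n. (norm (taylor_coeff f k))\<^sup>2 * (1\<^sup>2) ^ k)) (at_left (1::real))"
      by (intro tendsto_intros)
    from tendsto_upperbound[OF this ev] show ?thesis by (simp add: field_simps)
  qed
qed

text \<open>
  \<^const>\<open>hardy_inner\<close> is a \<^const>\<open>Lim\<close>, whose value says nothing unless the limit is known to exist.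
\<close>
lemma circle_prod_tendsto:
  assumes f: "f \<in> hardy_space 2" and g: "g \<in> hardy_space 2"
  shows "(circle_prod f g \<longlongrightarrow> hardy_inner f g) (at_left 1)"
proof -
  have hol: "f holomorphic_on ball 0 1" "g holomorphic_on ball 0 1" using assms by (auto simp: hardy_space_def)
  define c where "c n = 2 * pi * (taylor_coeff f n * cnj (taylor_coeff g n))" for n
  have "summable (\<lambda>n. pi * ((norm (taylor_coeff f n))\<^sup>2 + (norm (taylor_coeff g n))\<^sup>2))"
    by (intro summable_mult summable_add summable_taylor_coeff_sq assms)
  hence sm: "summable (\<lambda>n. norm (c n))"
  proof (rule summable_comparison_test'[where N = 0])
    fix n
    have "2 * (norm (taylor_coeff f n) * norm (taylor_coeff g n)) \<le> (norm (taylor_coeff f n))\<^sup>2 + (norm (taylor_coeff g n))\<^sup>2"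
      using sum_squares_bound[of "norm (taylor_coeff f n)" "norm (taylor_coeff g n)"] by simp
    from mult_left_mono[OF this, of pi]
    show "norm (norm (c n)) \<le> pi * ((norm (taylor_coeff f n))\<^sup>2 + (norm (taylor_coeff g n))\<^sup>2)"
      by (simp add: c_def norm_mult mult_ac)
  qed
  \<comment> \<open>Absolute summability of the \<open>c n\<close> makes the series uniformly
    convergent up to and including radius 1, so the limit is its value there.\<close>
  have ul: "uniform_limit {0..1} (\<lambda>N x. \<Sum>n<N. c n * of_real (x\<^sup>2) ^ n) (\<lambda>x. \<Sum>n. c n * of_real (x\<^sup>2) ^ n) sequentially"
  proof (rule Weierstrass_m_test[OF _ sm])
    fix n and x :: real assume "x \<in> {0..1}"
    hence "(x\<^sup>2) ^ n \<le> 1" "0 \<le> x" by (auto intro!: power_le_one)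
    thus "norm (c n * of_real (x\<^sup>2) ^ n) \<le> norm (c n)"
      unfolding norm_mult norm_power by (intro mult_left_le) (auto simp: norm_power)
  qed
  have "continuous_on {0..1} (\<lambda>x::real. \<Sum>n. c n * of_real (x\<^sup>2) ^ n)"
    by (rule uniform_limit_theorem[OF _ ul]) (auto intro!: always_eventually continuous_intros)
  hence "((\<lambda>x::real. \<Sum>n. c n * of_real (x\<^sup>2) ^ n) \<longlongrightarrow> (\<Sum>n. c n * of_real (1\<^sup>2) ^ n)) (at 1 within {0..1})"
    unfolding continuous_on_def by (rule bspec) simp
  hence lim: "((\<lambda>x::real. \<Sum>n. c n * of_real (x\<^sup>2) ^ n) \<longlongrightarrow> (\<Sum>n. c n * of_real (1\<^sup>2) ^ n)) (at_left 1)"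
    by (simp add: at_within_Icc_at_left)
  have "(circle_prod f g \<longlongrightarrow> (\<Sum>n. c n * of_real (1\<^sup>2) ^ n)) (at_left 1)"
  proof (rule Lim_transform_eventually[OF lim])
    have "(\<Sum>n. c n * of_real (x\<^sup>2) ^ n) = circle_prod f g x" if "0 < x" "x < 1" for x
      using circle_prod_sums[OF hol that] by (simp add: c_def sums_iff mult_ac)
    thus "\<forall>\<^sub>F x in at_left 1. (\<Sum>n. c n * of_real (x\<^sup>2) ^ n) = circle_prod f g x"
      unfolding eventually_at_left_field by (intro exI[of _ 0]) auto
  qed
  moreover have "hardy_inner f g = Lim (at_left 1) (circle_prod f g)"
    unfolding hardy_inner_def circle_prod_def[abs_def] ..
  ultimately show ?thesis using tendsto_Lim[OF trivial_limit_at_left_real] by metis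
qed

text \<open>Cauchy-Schwarz, from \<open>2 * u * v \<le> s * u^2 + v^2 / s\<close> under the
  integral. The best weight would be \<open>s = Y / X\<close>; replacing \<open>X\<close> by
  \<open>X + e\<close> allows \<open>X = 0\<close>, and \<open>e\<close> is removed at the
  end.\<close>

lemma norm_circle_prod_le:
  assumes f: "f holomorphic_on ball 0 1" and g: "g holomorphic_on ball 0 1" and r: "0 < r" "r < 1"
    and X: "hardy_mean 2 f r \<le> X\<^sup>2" "0 \<le> X" and Y: "hardy_mean 2 g r \<le> Y\<^sup>2" "0 < Y"
  shows "norm (circle_prod f g r) \<le> X * Y"
proof -
  have cf: "continuous_on S (\<lambda>\<theta>. f (circ r \<theta>))" and cg: "continuous_on S (\<lambda>\<theta>. g (circ r \<theta>))" for S
    using assms by (auto intro!: continuous_on_circle holomorphic_on_imp_continuous_on)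
  have *: "norm (circle_prod f g r) \<le> (X + e) * Y" if "e > 0" for e
  proof -
    define s where "s = Y / (X + e)"
    have s: "s > 0" using that X Y by (simp add: s_def)
    have "norm (circle_prod f g r) \<le> circle_integral r (\<lambda>w. 1/2 * (s * (norm (f w))\<^sup>2 + 1 / s * (norm (g w))\<^sup>2))"
      unfolding circle_prod_def
    proof (rule integral_norm_bound_integral)
      fix \<theta>
      define u v where "u = norm (f (circ r \<theta>))" and "v = norm (g (circ r \<theta>))"
      have "0 \<le> (s * u - v)\<^sup>2 / s" using s by simp
      also have "\<dots> = s * u\<^sup>2 + 1 / s * v\<^sup>2 - 2 * (u * v)" using s by (simp add: power2_eq_square field_simps)
      finally show "norm (f (circ r \<theta>) * cnj (g (circ r \<theta>))) \<le> 1/2 * (s * (norm (f (circ r \<theta>)))\<^sup>2 + 1 / s * (norm (g (circ r \<theta>)))\<^sup>2)"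
        by (simp add: norm_mult u_def v_def)
    qed (intro integrable_continuous_real continuous_intros cf cg)+
    also have "\<dots> = 1/2 * (s * hardy_mean 2 f r + 1 / s * hardy_mean 2 g r)"
      unfolding hardy_mean_2 integral_mult_right
      by (subst integral_add) (use s in \<open>auto intro!: integrable_continuous_real continuous_intros cf cg\<close>)
    also have "\<dots> \<le> 1/2 * (s * (X + e)\<^sup>2 + 1 / s * Y\<^sup>2)"
    proof -
      have "X\<^sup>2 \<le> (X + e)\<^sup>2" using X that by (intro power_mono) auto
      thus ?thesis using s X Y by (intro mult_left_mono add_mono) auto
    qed
    also have "\<dots> = (X + e) * Y"
    proof -
      have "1/2 * (Y / Q * Q\<^sup>2 + 1 / (Y / Q) * Y\<^sup>2) = Q * Y" if "Q > 0" for Q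
        using that Y by (simp add: power2_eq_square field_simps)
      thus ?thesis using that X unfolding s_def by simp
    qed
    finally show ?thesis .
  qed
  show ?thesis
  proof (rule field_le_epsilon)
    fix e :: real assume "e > 0"
    from *[of "e / Y"] this Y show "norm (circle_prod f g r) \<le> X * Y + e" by (simp add: distrib_right)
  qed
qed

text \<open>On the circle \<open>cnj w = r^2 / w\<close>, which turns the kernel into the one of
  Cauchy's formula for the derivative, with its pole at \<open>r^2 * z\<close> inside the
  circle.\<close>

lemma circle_integral_deriv:
  fixes f :: "complex \<Rightarrow> complex" and z :: complex
  assumes f: "f holomorphic_on ball 0 1" and r: "0 < r" "r < 1" and z: "norm z < 1"
  shows "circle_integral r (\<lambda>w. f w *
     (cnj w / (1 - z * cnj w)\<^sup>2)) = 2 * pi * of_real (r\<^sup>2) * deriv f (of_real (r\<^sup>2) * z)"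
proof -
  define p where "p = of_real (r\<^sup>2) * z"
  have sub: "cball 0 r \<subseteq> ball (0::complex) 1" using r by auto
  have "r * (r * norm z) \<le> r * (1 * norm z)" using r by (intro mult_left_mono mult_right_mono) auto
  also have "\<dots> < r * 1" using r z by (intro mult_strict_left_mono) auto
  finally have "norm p < r" using r by (simp add: p_def norm_mult power2_eq_square norm_power mult_ac)
  hence "((\<lambda>u. f u / (u - p) ^ (Suc 1)) has_contour_integral ((2 * pi * \<i>) / (fact 1) * (deriv ^^ 1) f p)) (circlepath 0 r)"
    using r sub by (intro Cauchy_has_contour_integral_higher_derivative_circlepath)
      (auto intro: holomorphic_on_subset[OF f] holomorphic_on_imp_continuous_on)
  moreover have "(2 * pi * \<i>) / (fact 1) * (deriv ^^ 1) f p = \<i> * (2 * pi * deriv f p)" by simp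
  moreover have "Suc 1 = 2" by simp
  ultimately have hc: "((\<lambda>u. f u / (u - p)\<^sup>2) has_contour_integral \<i> * (2 * pi * deriv f p)) (circlepath 0 r)"
    by (simp only:)
  have "integral {0..2*pi} (\<lambda>\<theta>. f (circ r \<theta>) / (circ r \<theta> - p)\<^sup>2 * (circ r \<theta>)) = 2 * pi * deriv f p"
    by (rule integral_circle[OF r(1) hc])
  hence 1: "2 * pi * of_real (r\<^sup>2) * deriv f p = integral {0..2*pi} (\<lambda>\<theta>. of_real (r\<^sup>2) * (f (circ r \<theta>) / (circ r \<theta> - p)\<^sup>2 * (circ r \<theta>)))"
    by (subst integral_mult_right) simp
  have 2: "of_real (r\<^sup>2) * (f w / (w - p)\<^sup>2 * w) = f w * (cnj w / (1 - z * cnj w)\<^sup>2)" if "w = circ r \<theta>" for w \<theta>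
  proof -
    have w: "w * cnj w = of_real (r\<^sup>2)" "w \<noteq> 0"
      using that r complex_norm_square[of w] by (simp_all add: norm_mult)
    hence cw: "cnj w \<noteq> 0" by simp
    have "w - p = w * (1 - z * cnj w)" using w by (simp add: p_def algebra_simps)
    hence "of_real (r\<^sup>2) * (f w / (w - p)\<^sup>2 * w) = w * cnj w * (f w / (w * (1 - z * cnj w))\<^sup>2 * w)" using w by simp
    also have "\<dots> = f w * (cnj w / (1 - z * cnj w)\<^sup>2)"
    proof -
      have "w * C * (u / (w * q)\<^sup>2 * w) = u * (C / q\<^sup>2)" for C u q
        using w(2) by (simp add: power2_eq_square)
      thus ?thesis .
    qed
    finally show ?thesis .
  qed
  show ?thesis using 1 2 by (simp add: p_def)
qed

lemma circle_integral_eval: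
  fixes f :: "complex \<Rightarrow> complex"
  assumes f: "f holomorphic_on ball 0 1" and r: "0 < r" "r < 1" and a: "norm a < 1"
  shows "circle_integral r (\<lambda>w. f w * cnj (1 / (1 - cnj a * w))) = 2 * pi * f (of_real (r\<^sup>2) * a)"
proof -
  define p where "p = of_real (r\<^sup>2) * a"
  have sub: "cball 0 r \<subseteq> ball (0::complex) 1" using r by auto
  have "r * (r * norm a) \<le> r * (1 * norm a)" using r by (intro mult_left_mono mult_right_mono) auto
  also have "\<dots> < r * 1" using r a by (intro mult_strict_left_mono) auto
  finally have "norm p < r" using r by (simp add: p_def norm_mult power2_eq_square norm_power mult_ac)
  hence "((\<lambda>u. f u / (u - p) ^ (Suc 0)) has_contour_integral ((2 * pi * \<i>) / (fact 0) * (deriv ^^ 0) f p)) (circlepath 0 r)"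
    using r sub by (intro Cauchy_has_contour_integral_higher_derivative_circlepath)
      (auto intro: holomorphic_on_subset[OF f] holomorphic_on_imp_continuous_on)
  moreover have "(2 * pi * \<i>) / (fact 0) * (deriv ^^ 0) f p = \<i> * (2 * pi * f p)" by simp
  ultimately have hc: "((\<lambda>u. f u / (u - p)) has_contour_integral \<i> * (2 * pi * f p)) (circlepath 0 r)"
    by (simp only: power_Suc0_right)
  have 1: "integral {0..2*pi} (\<lambda>\<theta>. f (circ r \<theta>) / (circ r \<theta> - p) * (circ r \<theta>)) = 2 * pi * f p"
    by (rule integral_circle[OF r(1) hc])
  have 2: "f w / (w - p) * w = f w * cnj (1 / (1 - cnj a * w))" if "w = circ r \<theta>" for w \<theta>
  proof -
    have w: "w * cnj w = of_real (r\<^sup>2)" "w \<noteq> 0"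
      using that r complex_norm_square[of w] by (simp_all add: norm_mult)
    have "w - p = w * (1 - a * cnj w)" using w by (simp add: p_def algebra_simps)
    thus ?thesis using w(2) by simp
  qed
  show ?thesis using 1 2[OF refl] by (simp add: p_def)
qed

text \<open>The unnormalised kernel reproduces itself: its mean square is
  \<open>2 * pi / (1 - r^2 * (norm a)^2)\<close>, and the factor \<open>1 - (norm a)^2\<close> from
  the normalisation compensates for this uniformly in \<open>a\<close> and \<open>r\<close>.\<close>

lemma hardy_mean_szego_le:
  assumes a: "norm a < 1" and r: "0 < r" "r < 1"
  shows "hardy_mean 2 (szego a) r \<le> 2 * pi"
proof -
  define k where "k w = 1 / (1 - cnj a * w)" for w
  define s where "s = sqrt (1 - (norm a)\<^sup>2)"
  have na: "(norm a)\<^sup>2 \<le> 1" "(norm a)\<^sup>2 < 1" using a by (simp_all add: power_le_one power_less_one_iff)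
  have s: "s\<^sup>2 = 1 - (norm a)\<^sup>2" using na by (simp add: s_def)
  have k: "k holomorphic_on ball 0 1"
    unfolding k_def[abs_def] using one_minus_cnj_mult_nz[OF a] by (intro holomorphic_intros) auto
  have "circle_integral r (\<lambda>w. k w * cnj (k w)) = 2 * pi * k (of_real (r\<^sup>2) * a)"
    unfolding k_def by (rule circle_integral_eval[OF k[unfolded k_def[abs_def]] r a])
  hence "circle_prod k k r = 2 * pi * k (of_real (r\<^sup>2) * a)" by (simp add: circle_prod_def)
  also have "k (of_real (r\<^sup>2) * a) = of_real (1 / (1 - r\<^sup>2 * (norm a)\<^sup>2))"
    using complex_norm_square[of a] by (simp add: k_def mult_ac)
  finally have "complex_of_real (hardy_mean 2 k r) = of_real (2 * pi * (1 / (1 - r\<^sup>2 * (norm a)\<^sup>2)))"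
    using circle_prod_self[OF k] r by simp
  hence "hardy_mean 2 k r = 2 * pi * (1 / (1 - r\<^sup>2 * (norm a)\<^sup>2))" unfolding of_real_eq_iff .
  moreover have "hardy_mean 2 (szego a) r = s\<^sup>2 * hardy_mean 2 k r"
    unfolding hardy_mean_2 integral_mult_right[symmetric]
    by (simp add: szego_def k_def s_def norm_divide power_divide)
  moreover have le: "s\<^sup>2 * (1 / (1 - r\<^sup>2 * (norm a)\<^sup>2)) \<le> 1"
  proof -
    have "r\<^sup>2 * (norm a)\<^sup>2 \<le> 1 * (norm a)\<^sup>2" using r by (intro mult_right_mono) (auto simp: power_le_one)
    thus ?thesis using na s by simp
  qed
  ultimately have "hardy_mean 2 (szego a) r = 2 * pi * (s\<^sup>2 * (1 / (1 - r\<^sup>2 * (norm a)\<^sup>2)))"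
    by simp
  also have "\<dots> \<le> 2 * pi * 1" by (rule mult_left_mono[OF le]) simp
  finally show ?thesis by simp
qed

lemma hardy_mean_2_le:
  assumes "continuous_on (ball 0 1) f" "continuous_on (ball 0 1) g" "0 \<le> r" "r < 1"
    and "\<And>z. norm z < 1 \<Longrightarrow> norm (f z) \<le> norm (g z)"
  shows "hardy_mean 2 f r \<le> hardy_mean 2 g r"
  unfolding hardy_mean_2
proof (rule integral_le)
  show "(\<lambda>\<theta>. (norm (f (circ r \<theta>)))\<^sup>2) integrable_on {0..2*pi}"
    by (intro integrable_continuous_real continuous_on_power continuous_on_norm continuous_on_circle assms)
  show "(\<lambda>\<theta>. (norm (g (circ r \<theta>)))\<^sup>2) integrable_on {0..2*pi}"
    by (intro integrable_continuous_real continuous_on_power continuous_on_norm continuous_on_circle assms)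
  fix \<theta> :: real
  have "norm (circ r \<theta>) < 1" using assms(3,4) by (simp add: norm_mult)
  from assms(5)[OF this] show "(norm (f (circ r \<theta>)))\<^sup>2 \<le> (norm (g (circ r \<theta>)))\<^sup>2"
    by (rule power_mono) simp
qed

lemma bounded_in_hardy_space_2:
  assumes "f holomorphic_on ball 0 1" "\<And>z. norm z < 1 \<Longrightarrow> norm (f z) \<le> K"
  shows "f \<in> hardy_space 2"
proof (rule hardy_space_2I(1)[OF assms(1)])
  have K: "0 \<le> K" using order_trans[OF norm_ge_zero assms(2)[of 0]] by simp
  show "0 \<le> sqrt (2 * pi) * K" using K by simp
  fix r :: real assume r: "0 < r" "r < 1"
  have "hardy_mean 2 f r \<le> hardy_mean 2 (\<lambda>_. of_real K) r"
    using assms(2) r K by (intro hardy_mean_2_le holomorphic_on_imp_continuous_on[OF assms(1)]) auto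
  also have "\<dots> = (sqrt (2 * pi) * K)\<^sup>2" by (simp add: hardy_mean_2 power_mult_distrib)
  finally show "hardy_mean 2 f r \<le> (sqrt (2 * pi) * K)\<^sup>2" .
qed

lemma malmquist_holomorphic:
  assumes "\<And>j. j \<in> F \<Longrightarrow> norm (a j) < 1" "n \<in> F" "S \<subseteq> cball 0 1"
  shows "malmquist a F n holomorphic_on S"
  unfolding malmquist_def[abs_def]
  by (intro holomorphic_on_mult bprod_holomorphic szego_holomorphic) (use assms in auto)

lemma hardy_mean_malmquist_le:
  assumes lt: "\<And>j. j \<in> F \<Longrightarrow> norm (a j) < 1" and n: "n \<in> F" and r: "0 < r" "r < 1"
  shows "hardy_mean 2 (malmquist a F n) r \<le> 2 * pi"
proof -
  have "hardy_mean 2 (malmquist a F n) r \<le> hardy_mean 2 (szego (a n)) r"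
  proof (rule hardy_mean_2_le)
    fix w :: complex assume w: "norm w < 1"
    have "norm (bprod a {j \<in> F. j < n} w) \<le> 1" by (rule norm_bprod_le_1) (use lt w in auto)
    thus "norm (malmquist a F n w) \<le> norm (szego (a n) w)"
      by (simp add: malmquist_def norm_mult mult_left_le_one_le)
  qed (use r n lt in \<open>auto intro!: holomorphic_on_imp_continuous_on malmquist_holomorphic szego_holomorphic\<close>)
  also have "\<dots> \<le> 2 * pi" by (rule hardy_mean_szego_le[OF lt[OF n] r])
  finally show ?thesis .
qed

text \<open>Obtained by differentiating \<open>bprod_kernel\<close> in \<open>z\<close> with
  \<open>w\<close> fixed. On the right everything except \<open>cnj w / (1 - z * cnj w)^2\<close>
  carries the factor \<open>cnj (bprod a F w)\<close>; these are the terms that orthogonality to the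
  multiples of the product removes.\<close>

lemma malmquist_kernel_deriv:
  assumes F: "finite F" "\<And>n. n \<in> F \<Longrightarrow> norm (a n) < 1" and z: "norm z < 1" and w: "norm w \<le> 1"
  shows "(\<Sum>n\<in>F. deriv (malmquist a F n) z * cnj (malmquist a F n w)) =
     cnj w * (1 - bprod a F z * cnj (bprod a F w)) / (1 - z * cnj w)\<^sup>2
     - deriv (bprod a F) z * cnj (bprod a F w) / (1 - z * cnj w)"
proof -
  define c where "c = cnj (bprod a F w)"
  define E where "E = (\<lambda>u. \<Sum>n\<in>F. malmquist a F n u * cnj (malmquist a F n w))"
  define E' where "E' = (\<Sum>n\<in>F. deriv (malmquist a F n) z * cnj (malmquist a F n w))"
  have nz: "1 - z * cnj w \<noteq> 0"
    using one_minus_cnj_mult_nz[of z w] z w by (auto simp: complex_eq_iff)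
  have eq: "1 - bprod a F u * c = (1 - u * cnj w) * E u" if "norm u < 1" for u
    unfolding c_def E_def using bprod_kernel[OF F, where z = u and w = w] that w by simp
  have dP: "(bprod a F has_field_derivative deriv (bprod a F) z) (at z)"
    unfolding DERIV_deriv_iff_field_differentiable
    by (intro bprod_field_differentiable F) (use z in auto)
  have dm: "(malmquist a F n has_field_derivative deriv (malmquist a F n) z) (at z)" if "n \<in> F" for n
    unfolding DERIV_deriv_iff_field_differentiable unfolding malmquist_def[abs_def]
    using that F z has_field_derivative_szego[of "a n" z]
    by (intro field_differentiable_mult bprod_field_differentiable) (auto simp: field_differentiable_def)
  have dE: "(E has_field_derivative E') (at z)"
    unfolding E_def E'_def by (intro DERIV_sum DERIV_cmult_right dm)
  have "((\<lambda>u. 1 - bprod a F u * c) has_field_derivative - (deriv (bprod a F) z * c)) (at z)"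
    by (auto intro!: derivative_eq_intros dP)
  moreover have "((\<lambda>u. 1 - bprod a F u * c) has_field_derivative (- cnj w * E z + (1 - z * cnj w) * E')) (at z)"
  proof (rule has_field_derivative_transform_within_open)
    show "((\<lambda>u. (1 - u * cnj w) * E u) has_field_derivative (- cnj w * E z + (1 - z * cnj w) * E')) (at z)"
      by (auto intro!: derivative_eq_intros dE)
  qed (use eq z in \<open>auto intro!: open_ball[of 0 1]\<close>)
  ultimately have "- (deriv (bprod a F) z * c) = - cnj w * E z + (1 - z * cnj w) * E'" by (rule DERIV_unique)
  hence "(1 - z * cnj w) * E' = cnj w * E z - deriv (bprod a F) z * c" by (simp add: algebra_simps)
  hence "E' = (cnj w * E z - deriv (bprod a F) z * c) / (1 - z * cnj w)" using nz by (simp add: eq_divide_eq mult_ac)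
  also have "E z = (1 - bprod a F z * c) / (1 - z * cnj w)" using eq[OF z] nz by simp
  also have "(cnj w * ((1 - bprod a F z * c) / (1 - z * cnj w)) - deriv (bprod a F) z * c) / (1 - z * cnj w) =
      cnj w * (1 - bprod a F z * c) / (1 - z * cnj w)\<^sup>2 - deriv (bprod a F) z * c / (1 - z * cnj w)"
  proof -
    have "(u * (X / D) - Y) / D = u * X / D\<^sup>2 - Y / D" for u X Y D :: complex
      by (simp add: power2_eq_square diff_divide_distrib)
    thus ?thesis .
  qed
  finally show ?thesis unfolding E'_def c_def .
qed

section \<open>Infinite Blaschke products and derivatives in the model space\<close>

definition blaschke_prod :: "(nat \<Rightarrow> complex) \<Rightarrow> nat set \<Rightarrow> complex \<Rightarrow> complex" where
  "blaschke_prod a I z = (\<Prod>n. if n \<in> I then blaschke_factor (a n) z else 1)"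

locale blaschke_sequence =
  fixes a :: "nat \<Rightarrow> complex" and I :: "nat set"
  assumes norm_zero_lt_1: "n \<in> I \<Longrightarrow> norm (a n) < 1"
    and summable_on_zeros: "(\<lambda>n. 1 - norm (a n)) summable_on I"
begin

lemma blaschke_sequence_subset: "J \<subseteq> I \<Longrightarrow> blaschke_sequence a J"
  using norm_zero_lt_1 summable_on_zeros summable_on_subset_banach unfolding blaschke_sequence_def by blast

lemma summable_zeros: "summable (\<lambda>n. if n \<in> I then 1 - norm (a n) else 0)"
proof -
  have "(\<lambda>n. if n \<in> I then 1 - norm (a n) else 0) summable_on UNIV"
  proof -
    have "(\<lambda>n. 1 - norm (a n)) summable_on I \<longleftrightarrow> (\<lambda>n. if n \<in> I then 1 - norm (a n) else 0) summable_on UNIV"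
      by (rule summable_on_cong_neutral) auto
    thus ?thesis using summable_on_zeros by simp
  qed
  thus ?thesis using norm_zero_lt_1 by (subst (asm) summable_on_UNIV_nonneg_real_iff) (auto simp: less_imp_le)
qed

lemma bprod_lessThan: "bprod a (I \<inter> {..<N}) z = (\<Prod>n<N. if n \<in> I then blaschke_factor (a n) z else 1)"
  unfolding bprod_def by (subst prod.inter_restrict[symmetric]) (auto simp: Int_commute)

lemma initial_zeros: "finite (I \<inter> {..<N})" "n \<in> I \<inter> {..<N} \<Longrightarrow> norm (a n) < 1"
  using norm_zero_lt_1 by auto

lemma uniform_limit_blaschke_prod:
  assumes "s < 1"
  shows "uniform_limit (cball 0 s) (\<lambda>N. bprod a (I \<inter> {..<N})) (blaschke_prod a I) sequentially"
proof -
  define f where "f n z = (if n \<in> I then blaschke_factor (a n) z else 1)" for n z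
  define d where "d n = 2 / (1 - s) * (if n \<in> I then 1 - norm (a n) else 0)" for n
  have bd: "norm (f n z - 1) \<le> d n" if "z \<in> cball 0 s" for n z
  proof (cases "n \<in> I")
    case True
    have z: "norm z \<le> s" using that by simp
    have "norm (f n z - 1) \<le> 2 / (1 - norm z) * (1 - norm (a n))"
      using norm_one_minus_blaschke_factor_le[of "a n" z] norm_zero_lt_1[OF True] z assms True
      by (simp add: f_def norm_minus_commute)
    also have "\<dots> \<le> 2 / (1 - s) * (1 - norm (a n))"
      using norm_zero_lt_1[OF True] z assms by (intro mult_right_mono divide_left_mono mult_pos_pos) auto
    finally show ?thesis using True by (simp add: d_def)
  qed (simp add: f_def d_def)
  have sm: "summable d" unfolding d_def by (intro summable_mult summable_zeros)
  have "uniformly_convergent_on (cball 0 s) (\<lambda>N z. \<Prod>n<N. f n z)"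
  proof (rule uniformly_convergent_on_prod')
    show "continuous_on (cball 0 s) (f n)" for n
      using norm_zero_lt_1[of n] assms unfolding f_def
      by (cases "n \<in> I") (auto intro!: holomorphic_on_imp_continuous_on blaschke_factor_holomorphic)
    show "uniformly_convergent_on (cball 0 s) (\<lambda>N z. \<Sum>n<N. norm (f n z - 1))"
      by (rule Weierstrass_m_test'[OF _ sm]) (use bd in auto)
  qed auto
  then obtain l where l: "uniform_limit (cball 0 s) (\<lambda>N z. \<Prod>n<N. f n z) l sequentially"
    unfolding uniformly_convergent_on_def by blast
  have "l z = blaschke_prod a I z" if "z \<in> cball 0 s" for z
  proof -
    have "summable (\<lambda>n. norm (f n z - 1))"
      by (rule summable_comparison_test'[OF sm, where N = 0]) (use bd[OF that] in auto)
    hence "convergent_prod (\<lambda>n. f n z)"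
      by (intro abs_convergent_prod_imp_convergent_prod) (simp add: abs_convergent_prod_conv_summable)
    hence "(\<lambda>N. \<Prod>n\<le>N. f n z) \<longlonglongrightarrow> (\<Prod>n. f n z)" by (rule convergent_prod_LIMSEQ)
    hence "(\<lambda>N. \<Prod>n<Suc N. f n z) \<longlonglongrightarrow> (\<Prod>n. f n z)" by (simp add: lessThan_Suc_atMost)
    hence "(\<lambda>N. \<Prod>n<N. f n z) \<longlonglongrightarrow> (\<Prod>n. f n z)" by (rule LIMSEQ_imp_Suc)
    moreover have "(\<lambda>N. \<Prod>n<N. f n z) \<longlonglongrightarrow> l z" by (rule tendsto_uniform_limitI[OF l that])
    ultimately show ?thesis using LIMSEQ_unique by (simp add: blaschke_prod_def f_def) blast
  qed
  hence "uniform_limit (cball 0 s) (\<lambda>N z. \<Prod>n<N. f n z) l sequentially \<longleftrightarrow>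
      uniform_limit (cball 0 s) (\<lambda>N z. \<Prod>n<N. f n z) (blaschke_prod a I) sequentially"
    by (intro uniform_limit_cong') auto
  hence "uniform_limit (cball 0 s) (\<lambda>N z. \<Prod>n<N. f n z) (blaschke_prod a I) sequentially"
    using l by simp
  thus ?thesis unfolding f_def bprod_lessThan[abs_def] .
qed

lemma bprod_tendsto: "norm z < 1 \<Longrightarrow> (\<lambda>N. bprod a (I \<inter> {..<N}) z) \<longlonglongrightarrow> blaschke_prod a I z"
  using tendsto_uniform_limitI[OF uniform_limit_blaschke_prod[of "norm z"]] by auto

lemma norm_blaschke_prod_le_1:
  assumes "norm z < 1" shows "norm (blaschke_prod a I z) \<le> 1"
  by (rule Lim_norm_ubound[OF _ bprod_tendsto[OF assms]])
     (use assms in \<open>auto intro!: always_eventually norm_bprod_le_1 norm_zero_lt_1\<close>)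

lemma blaschke_prod_holomorphic: "blaschke_prod a I holomorphic_on ball 0 1"
proof (rule holomorphic_uniform_sequence)
  show "bprod a (I \<inter> {..<N}) holomorphic_on ball 0 1" for N
    by (intro bprod_holomorphic initial_zeros) auto
  fix x :: complex assume x: "x \<in> ball 0 1"
  define d where "d = (1 - norm x) / 2"
  have d: "0 < d" "norm x + d < 1" using x by (simp_all add: d_def field_simps)
  have "cball x d \<subseteq> cball 0 (norm x + d)"
    by (auto simp: dist_norm) (metis add.commute add_le_cancel_left dist_norm norm_triangle_sub order_trans norm_minus_commute)
  with d show "\<exists>d>0. cball x d \<subseteq> ball 0 1 \<and> uniform_limit (cball x d) (\<lambda>N. bprod a (I \<inter> {..<N})) (blaschke_prod a I) sequentially"
    by (intro exI[of _ d] conjI uniform_limit_on_subset[OF uniform_limit_blaschke_prod]) auto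
qed auto

lemma deriv_bprod_tendsto:
  assumes "norm z < 1"
  shows "(\<lambda>N. deriv (bprod a (I \<inter> {..<N})) z) \<longlonglongrightarrow> deriv (blaschke_prod a I) z"
proof -
  obtain s where s: "norm z < s" "s < 1" using dense assms by blast
  show ?thesis
  proof (rule deriv_complex_uniform_limit)
    show "uniform_limit (ball 0 s) (\<lambda>N. bprod a (I \<inter> {..<N})) (blaschke_prod a I) sequentially"
      by (rule uniform_limit_on_subset[OF uniform_limit_blaschke_prod[OF s(2)]]) auto
    show "\<forall>\<^sub>F n in sequentially. bprod a (I \<inter> {..<n}) holomorphic_on ball 0 s"
      using s by (intro always_eventually allI bprod_holomorphic initial_zeros) auto
  qed (use s in auto)
qed

lemma blaschke_prod_split:
  assumes F: "finite F" "F \<subseteq> I" and z: "norm z < 1"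
  shows "blaschke_prod a I z = bprod a F z * blaschke_prod a (I - F) z"
proof -
  interpret J: blaschke_sequence a "I - F" by (rule blaschke_sequence_subset) auto
  obtain M where M: "F \<subseteq> {..<M}" using F(1) finite_nat_bounded by blast
  have "bprod a (I \<inter> {..<N}) z = bprod a F z * bprod a ((I - F) \<inter> {..<N}) z" if "N \<ge> M" for N
  proof -
    have "I \<inter> {..<N} = F \<union> ((I - F) \<inter> {..<N})" using M that F by auto
    thus ?thesis unfolding bprod_def using F by (metis Diff_disjoint Int_assoc Int_empty_left finite_Int finite_lessThan prod.union_disjoint)
  qed
  hence ev: "\<forall>\<^sub>F N in sequentially. bprod a F z * bprod a ((I - F) \<inter> {..<N}) z = bprod a (I \<inter> {..<N}) z"
    unfolding eventually_sequentially by (intro exI[of _ M]) simp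
  have "(\<lambda>N. bprod a (I \<inter> {..<N}) z) \<longlonglongrightarrow> bprod a F z * blaschke_prod a (I - F) z"
    by (rule Lim_transform_eventually[OF tendsto_mult_left[OF J.bprod_tendsto[OF z]] ev])
  thus ?thesis using bprod_tendsto[OF z] LIMSEQ_unique by blast
qed

text \<open>
  On the circle of radius \<open>r\<close>, \<open>h1\<close> reproduces the derivative at \<open>r\<^sup>2 z\<close>; subtracting an element of
  \<open>B H\<^sup>2\<close>, which does not matter in the limit \<open>r \<rightarrow> 1\<close>, turns it into the derivative of the kernel of
  the model space. For the finite partial products this is a sum over the functions \<^const>\<open>malmquist\<close>.
\<close>
lemma norm_deriv_model_space_le:
  assumes f: "f \<in> model_space (blaschke_prod a I)" and z: "norm z < 1"
    and T: "\<And>N. (\<Sum>n\<in>I \<inter> {..<N}. norm (deriv (malmquist a I n) z)) \<le> T"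
  shows "sqrt (2 * pi) * norm (deriv f z) \<le> hardy_norm 2 f * T"
proof -
  define B where "B = blaschke_prod a I"
  define P where "P N = bprod a (I \<inter> {..<N})" for N
  define h1 where "h1 w = cnj w / (1 - z * cnj w)\<^sup>2" for w
  define h2 where "h2 w = 1 / (1 - z * cnj w)" for w
  \<comment> \<open>Chosen so that \<open>cnj (B w * g w)\<close> collects the two terms of the
    differentiated kernel that contain \<open>cnj (B w)\<close>. Pairing \<open>f\<close> with
    \<open>B * g\<close> therefore gives 0 in the limit.\<close>
  define g where "g w = cnj (B z) * (w / (1 - cnj z * w)\<^sup>2) + cnj (deriv B z) * (1 / (1 - cnj z * w))" for w
  have fH: "f \<in> hardy_space 2" and orth: "\<And>g. g \<in> hardy_space 2 \<Longrightarrow> hardy_inner f (\<lambda>w. B w * g w) = 0"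
    using f by (auto simp: model_space_def hardy_orthogonal_complement_def B_def)
  have fhol: "f holomorphic_on ball 0 1" using fH by (simp add: hardy_space_def)
  have fcont: "continuous_on (ball 0 1) f" by (rule holomorphic_on_imp_continuous_on[OF fhol])
  have Bhol: "B holomorphic_on ball 0 1" unfolding B_def by (rule blaschke_prod_holomorphic)
  have nz: "1 - z * cnj w \<noteq> 0" if "norm w \<le> 1" for w
    using one_minus_cnj_mult_nz[of z w] z that by (auto simp: complex_eq_iff)
  have T0: "0 \<le> T" by (rule order_trans[OF _ T[of 0]]) simp
  have gcont: "continuous_on (cball 0 1) g" unfolding g_def
    using one_minus_cnj_mult_nz[OF z] by (intro continuous_intros) auto
  have ghol: "g holomorphic_on ball 0 1" unfolding g_def
    using one_minus_cnj_mult_nz[OF z] by (intro holomorphic_intros) auto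
  have "bounded (g ` cball 0 1)" by (intro compact_imp_bounded compact_continuous_image gcont) auto
  then obtain K where K: "\<And>w. norm w \<le> 1 \<Longrightarrow> norm (g w) \<le> K" by (fastforce simp: bounded_iff)
  have gH: "g \<in> hardy_space 2" by (rule bounded_in_hardy_space_2[OF ghol, of K]) (use K in auto)
  have BgH: "(\<lambda>w. B w * g w) \<in> hardy_space 2"
  proof (rule bounded_in_hardy_space_2)
    show "(\<lambda>w. B w * g w) holomorphic_on ball 0 1" by (intro holomorphic_intros Bhol ghol)
    fix w :: complex assume "norm w < 1"
    thus "norm (B w * g w) \<le> 1 * K" unfolding norm_mult B_def
      using K norm_blaschke_prod_le_1 by (intro mult_mono) auto
  qed
  \<comment> \<open>The radius is fixed first. For the partial products the difference is an exact
    finite sum with a bound that does not depend on \<open>N\<close>, so \<open>N\<close> may tend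
    to infinity here and \<open>r\<close> to 1 afterwards.\<close>
  have step: "norm (2 * pi * of_real (r\<^sup>2) * deriv f (of_real (r\<^sup>2) * z) - circle_prod f (\<lambda>w. B w * g w) r)
      \<le> hardy_norm 2 f * sqrt (2 * pi) * T" if r: "0 < r" "r < 1" for r
  proof -
    have [simp]: "norm (circ r \<theta>) = r" for \<theta> using r by (simp add: norm_mult)
    have nzr: "1 - z * cnj (circ r \<theta>) \<noteq> 0" for \<theta> by (rule nz) (use r in auto)
    have conts: "continuous_on S (\<lambda>\<theta>. f (circ r \<theta>))" "continuous_on S (\<lambda>\<theta>. h1 (circ r \<theta>))"
       "continuous_on S (\<lambda>\<theta>. h2 (circ r \<theta>))" "continuous_on S (\<lambda>\<theta>. P N (circ r \<theta>))"
       "continuous_on S (\<lambda>\<theta>. B (circ r \<theta>))" for S N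
    proof -
      show "continuous_on S (\<lambda>\<theta>. f (circ r \<theta>))" using r fcont by (intro continuous_on_circle) auto
      show "continuous_on S (\<lambda>\<theta>. h1 (circ r \<theta>))" unfolding h1_def using nzr by (intro continuous_intros) auto
      show "continuous_on S (\<lambda>\<theta>. h2 (circ r \<theta>))" unfolding h2_def using nzr by (intro continuous_intros) auto
      show "continuous_on S (\<lambda>\<theta>. P N (circ r \<theta>))" unfolding P_def
        by (intro continuous_on_circle holomorphic_on_imp_continuous_on bprod_holomorphic initial_zeros) (use r in auto)
      show "continuous_on S (\<lambda>\<theta>. B (circ r \<theta>))"
        by (intro continuous_on_circle holomorphic_on_imp_continuous_on Bhol) (use r in auto)
    qed
    define X where "X = circle_integral r (\<lambda>w. f w * h1 w)"
    define Y1 where "Y1 N = circle_integral r (\<lambda>w. f w * cnj (P N w) * h1 w)" for N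
    define Y2 where "Y2 N = circle_integral r (\<lambda>w. f w * cnj (P N w) * h2 w)" for N
    have X: "X = 2 * pi * of_real (r\<^sup>2) * deriv f (of_real (r\<^sup>2) * z)"
      unfolding X_def h1_def by (rule circle_integral_deriv[OF fhol r z])
    have bound: "norm (X - (P N z * Y1 N + deriv (P N) z * Y2 N)) \<le> hardy_norm 2 f * sqrt (2 * pi) * T" for N
    proof -
      define F where "F = I \<inter> {..<N}"
      have F: "finite F" "\<And>n. n \<in> F \<Longrightarrow> norm (a n) < 1" using initial_zeros by (auto simp: F_def)
      have mF: "malmquist a F n = malmquist a I n" if "n \<in> F" for n
      proof -
        have "{j \<in> F. j < n} = {j \<in> I. j < n}" using that by (auto simp: F_def)
        thus ?thesis by (simp add: malmquist_def[abs_def])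
      qed
      have mhol: "malmquist a I n holomorphic_on ball 0 1" if "n \<in> F" for n
        by (rule malmquist_holomorphic[where F = I]) (use norm_zero_lt_1 that in \<open>auto simp: F_def\<close>)
      have "X - (P N z * Y1 N + deriv (P N) z * Y2 N) = integral {0..2*pi} (\<lambda>\<theta>.
         f (circ r \<theta>) * h1 (circ r \<theta>)
         - (P N z * (f (circ r \<theta>) * cnj (P N (circ r \<theta>)) * h1 (circ r \<theta>))
           + deriv (P N) z * (f (circ r \<theta>) * cnj (P N (circ r \<theta>)) * h2 (circ r \<theta>))))"
        unfolding X_def Y1_def Y2_def
        by (subst integral_diff integral_add, (intro integrable_continuous_real continuous_intros conts)+)+
           (simp only: integral_mult_right)
      also have "\<dots> = circle_integral r (\<lambda>w. \<Sum>n\<in>F. deriv (malmquist a F n) z * (f w * cnj (malmquist a F n w)))"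
      proof (rule arg_cong[of _ _ "integral _"], rule ext)
        fix \<theta>
        define w where "w = circ r \<theta>"
        have w: "norm w \<le> 1" using r by (simp add: w_def)
        have "f w * h1 w - (P N z * (f w * cnj (P N w) * h1 w) + deriv (P N) z * (f w * cnj (P N w) * h2 w)) =
            f w * (cnj w * (1 - P N z * cnj (P N w)) / (1 - z * cnj w)\<^sup>2 - deriv (P N) z * cnj (P N w) / (1 - z * cnj w))"
          by (simp add: h1_def h2_def algebra_simps diff_divide_distrib)
        also have "\<dots> = f w * (\<Sum>n\<in>F. deriv (malmquist a F n) z * cnj (malmquist a F n w))"
        proof -
          have "(\<Sum>n\<in>F. deriv (malmquist a F n) z * cnj (malmquist a F n w)) =
             cnj w * (1 - bprod a F z * cnj (bprod a F w)) / (1 - z * cnj w)\<^sup>2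
             - deriv (bprod a F) z * cnj (bprod a F w) / (1 - z * cnj w)"
            by (rule malmquist_kernel_deriv) (use F z w in auto)
          thus ?thesis by (simp only: P_def F_def)
        qed
        also have "\<dots> = (\<Sum>n\<in>F. deriv (malmquist a F n) z * (f w * cnj (malmquist a F n w)))"
          by (simp add: sum_distrib_left mult_ac)
        finally show "f (circ r \<theta>) * h1 (circ r \<theta>)
         - (P N z * (f (circ r \<theta>) * cnj (P N (circ r \<theta>)) * h1 (circ r \<theta>))
           + deriv (P N) z * (f (circ r \<theta>) * cnj (P N (circ r \<theta>)) * h2 (circ r \<theta>))) =
          (\<Sum>n\<in>F. deriv (malmquist a F n) z * (f (circ r \<theta>) * cnj (malmquist a F n (circ r \<theta>))))"
          unfolding w_def .
      qed
      also have "\<dots> = (\<Sum>n\<in>F. deriv (malmquist a I n) z * circle_prod f (malmquist a I n) r)"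
        unfolding circle_prod_def
        by (subst integral_sum)
           (auto intro!: F sum.cong integrable_continuous_real continuous_intros conts continuous_on_circle
              holomorphic_on_imp_continuous_on mhol simp: mF r less_imp_le)
      also have "norm \<dots> \<le> (\<Sum>n\<in>F. norm (deriv (malmquist a I n) z) * (hardy_norm 2 f * sqrt (2 * pi)))"
      proof (rule sum_norm_le)
        fix n assume n: "n \<in> F"
        have "norm (circle_prod f (malmquist a I n) r) \<le> hardy_norm 2 f * sqrt (2 * pi)"
        proof (rule norm_circle_prod_le[OF fhol mhol[OF n] r hardy_mean_le_norm[OF fH] hardy_norm_nonneg])
          have "hardy_mean 2 (malmquist a I n) r \<le> 2 * pi"
            by (rule hardy_mean_malmquist_le) (use norm_zero_lt_1 n r in \<open>auto simp: F_def\<close>)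
          thus "hardy_mean 2 (malmquist a I n) r \<le> (sqrt (2 * pi))\<^sup>2" by simp
        qed (use r in auto)
        thus "norm (deriv (malmquist a I n) z * circle_prod f (malmquist a I n) r) \<le> norm (deriv (malmquist a I n) z) * (hardy_norm 2 f * sqrt (2 * pi))"
          unfolding norm_mult by (rule mult_left_mono) simp
      qed
      also have "\<dots> = (\<Sum>n\<in>F. norm (deriv (malmquist a I n) z)) * (hardy_norm 2 f * sqrt (2 * pi))"
        by (simp add: sum_distrib_right)
      also have "\<dots> \<le> T * (hardy_norm 2 f * sqrt (2 * pi))"
        using T[of N] hardy_norm_nonneg by (intro mult_right_mono) (auto simp: F_def)
      finally show ?thesis by (simp add: mult_ac)
    qed
    have lim: "(\<lambda>N. circle_integral r (\<lambda>w. f w * cnj (P N w) * h w))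
        \<longlonglongrightarrow> circle_integral r (\<lambda>w. f w * cnj (B w) * h w)"
      if h: "continuous_on {0..2*pi} (\<lambda>\<theta>. h (circ r \<theta>))" for h
    proof (rule dominated_convergence(2))
      show "(\<lambda>\<theta>. f (circ r \<theta>) * cnj (P N (circ r \<theta>)) * h (circ r \<theta>)) integrable_on {0..2*pi}" for N
        by (intro integrable_continuous_real continuous_intros conts h)
      show "(\<lambda>\<theta>. norm (f (circ r \<theta>)) * norm (h (circ r \<theta>))) integrable_on {0..2*pi}"
        by (intro integrable_continuous_real continuous_intros conts h)
      show "norm (f (circ r \<theta>) * cnj (P N (circ r \<theta>)) * h (circ r \<theta>)) \<le>
         norm (f (circ r \<theta>)) * norm (h (circ r \<theta>))" for N \<theta>
      proof -
        have "norm (P N (circ r \<theta>)) \<le> 1" unfolding P_def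
          by (intro norm_bprod_le_1 initial_zeros) (use r in auto)
        thus ?thesis unfolding norm_mult by (intro mult_right_mono) (auto intro: mult_left_le)
      qed
      show "(\<lambda>N. f (circ r \<theta>) * cnj (P N (circ r \<theta>)) * h (circ r \<theta>)) \<longlonglongrightarrow>
         f (circ r \<theta>) * cnj (B (circ r \<theta>)) * h (circ r \<theta>)" for \<theta>
        unfolding P_def B_def by (intro tendsto_intros bprod_tendsto) (use r in auto)
    qed
    have "(\<lambda>N. X - (P N z * Y1 N + deriv (P N) z * Y2 N)) \<longlonglongrightarrow> X - (B z * circle_integral r (\<lambda>w. f w * cnj (B w) * h1 w)
       + deriv B z * circle_integral r (\<lambda>w. f w * cnj (B w) * h2 w))"
      (is "_ \<longlonglongrightarrow> X - ?Y")
      unfolding Y1_def Y2_def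
      by (intro tendsto_intros lim conts) (auto simp: P_def B_def intro!: bprod_tendsto deriv_bprod_tendsto z)
    hence "norm (X - ?Y) \<le> hardy_norm 2 f * sqrt (2 * pi) * T"
      by (rule Lim_norm_ubound[rotated]) (auto intro!: always_eventually bound)
    moreover have "?Y = circle_prod f (\<lambda>w. B w * g w) r"
    proof -
      have "?Y = circle_integral r (\<lambda>w. B z * (f w * cnj (B w) * h1 w)
         + deriv B z * (f w * cnj (B w) * h2 w))"
        by (subst integral_add, (intro integrable_continuous_real continuous_intros conts)+) (simp only: integral_mult_right)
      also have "\<dots> = circle_prod f (\<lambda>w. B w * g w) r"
        unfolding circle_prod_def g_def h1_def h2_def by (simp add: algebra_simps)
      finally show ?thesis .
    qed
    ultimately show ?thesis using X by simp
  qed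
  have "((\<lambda>r. 2 * pi * of_real (r\<^sup>2) * deriv f (of_real (r\<^sup>2) * z) - circle_prod f (\<lambda>w. B w * g w) r) \<longlongrightarrow>
      2 * pi * of_real (1\<^sup>2) * deriv f (of_real (1\<^sup>2) * z) - hardy_inner f (\<lambda>w. B w * g w)) (at_left (1::real))"
  proof (intro tendsto_intros circle_prod_tendsto fH BgH)
    have "continuous_on (ball 0 1) (deriv f)"
      by (intro holomorphic_on_imp_continuous_on holomorphic_deriv fhol) auto
    hence c: "isCont (deriv f) (of_real (1\<^sup>2) * z)" using z by (simp add: continuous_on_eq_continuous_at)
    show "((\<lambda>r. deriv f (of_real (r\<^sup>2) * z)) \<longlongrightarrow> deriv f (of_real (1\<^sup>2) * z)) (at_left (1::real))"
      by (rule isCont_tendsto_compose[OF c]) (intro tendsto_intros)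
  qed
  moreover have "\<forall>\<^sub>F r in at_left (1::real). norm (2 * pi * of_real (r\<^sup>2) * deriv f (of_real (r\<^sup>2) * z) - circle_prod f (\<lambda>w. B w * g w) r) \<le> hardy_norm 2 f * sqrt (2 * pi) * T"
    unfolding eventually_at_left_field using step by (intro exI[of _ 0]) auto
  ultimately have "norm (2 * pi * of_real (1\<^sup>2) * deriv f (of_real (1\<^sup>2) * z) - hardy_inner f (\<lambda>w. B w * g w)) \<le> hardy_norm 2 f * sqrt (2 * pi) * T"
    by (intro Lim_norm_ubound[where net = "at_left (1::real)"]) auto
  hence "2 * pi * norm (deriv f z) \<le> hardy_norm 2 f * sqrt (2 * pi) * T"
    using orth[OF gH] by (simp add: norm_mult)
  also have "2 * pi * norm (deriv f z) = sqrt (2 * pi) * (sqrt (2 * pi) * norm (deriv f z))" by simp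
  finally have "sqrt (2 * pi) * (sqrt (2 * pi) * norm (deriv f z)) \<le> sqrt (2 * pi) * (hardy_norm 2 f * T)"
    by (simp only: mult_ac)
  thus ?thesis by (rule mult_left_le_imp_le) simp
qed

end

section \<open>Weak-type estimates for exponential zeros\<close>

text \<open>The finite sets \<open>F\<close> avoid the junk value 0 of \<^const>\<open>card\<close> on infinite sets.\<close>
definition exponential_zeros :: "(nat \<Rightarrow> complex) \<Rightarrow> nat set \<Rightarrow> nat \<Rightarrow> bool" where
  "exponential_zeros a I M \<longleftrightarrow>
     (\<forall>F \<delta>. finite F \<longrightarrow> F \<subseteq> I \<longrightarrow> 0 < \<delta> \<longrightarrow> (\<forall>n\<in>F. \<delta> \<le> 1 - norm (a n) \<and> 1 - norm (a n) < 2 * \<delta>) \<longrightarrow> card F \<le> M)"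

text \<open>Here \<open>v n\<close> is a dyadic class; with at most \<open>M\<close> members per
  class the sum is dominated by \<open>M\<close> copies of one geometric series.\<close>

lemma sum_geometric_classes:
  fixes x :: "'a \<Rightarrow> real" and v :: "'a \<Rightarrow> nat"
  assumes F: "finite F" and card: "\<And>i. card {n \<in> F. v n = i} \<le> M"
    and x: "\<And>n. n \<in> F \<Longrightarrow> x n \<le> c * q ^ v n" and c: "0 \<le> c" and q: "0 < q" "q < 1"
  shows "(\<Sum>n\<in>F. x n) \<le> M * c / (1 - q)"
proof -
  have "(\<Sum>n\<in>F. x n) \<le> (\<Sum>n\<in>F. c * q ^ v n)" by (intro sum_mono x)
  also have "\<dots> = (\<Sum>i\<in>v ` F. \<Sum>n\<in>{n \<in> F. v n = i}. c * q ^ v n)" by (rule sum.image_gen[OF F])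
  also have "\<dots> = (\<Sum>i\<in>v ` F. card {n \<in> F. v n = i} * (c * q ^ i))" by (intro sum.cong refl) simp
  also have "\<dots> \<le> (\<Sum>i\<in>v ` F. M * (c * q ^ i))"
    using card c q by (intro sum_mono mult_right_mono) auto
  also have "\<dots> = M * c * (\<Sum>i\<in>v ` F. q ^ i)" by (simp add: sum_distrib_left mult_ac)
  also have "\<dots> \<le> M * c * (1 / (1 - q))"
  proof (intro mult_left_mono)
    have "(\<Sum>i\<in>v ` F. q ^ i) \<le> (\<Sum>i. q ^ i)"
      using F q by (intro sum_le_suminf summable_geometric) auto
    thus "(\<Sum>i\<in>v ` F. q ^ i) \<le> 1 / (1 - q)" using q by (simp add: suminf_geometric)
  qed (use c in auto)
  finally show ?thesis by simp
qed

lemma dyadic_scale_ge: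
  fixes x :: real assumes "1 \<le> x" shows "\<exists>n. 2 ^ n \<le> x \<and> x < 2 * 2 ^ n"
proof -
  obtain N where "x < 2 ^ N" using real_arch_pow[of 2 x] by auto
  from ex_least_nat_less[of "\<lambda>n. x < 2 ^ n", OF this] assms
  obtain k where "\<forall>i\<le>k. \<not> x < 2 ^ i" "x < 2 ^ Suc k" by auto
  thus ?thesis by (intro exI[of _ k]) (auto simp: not_less)
qed

text \<open>Strictness is on the other side than in \<open>dyadic_scale_ge\<close> because it is
  applied to \<open>\<sigma> / (1 - norm (a n))\<close>: inversion then produces the half-open
  classes that \<open>exponential_zeros\<close> counts.\<close>

lemma dyadic_scale_gt:
  fixes x :: real assumes "1 < x" shows "\<exists>n. 2 ^ n < x \<and> x \<le> 2 * 2 ^ n"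
proof -
  obtain N where "x < 2 ^ N" using real_arch_pow[of 2 x] by auto
  hence "x \<le> 2 ^ N" by simp
  from ex_least_nat_less[of "\<lambda>n. x \<le> 2 ^ n", OF this] assms
  obtain k where "\<forall>i\<le>k. \<not> x \<le> 2 ^ i" "x \<le> 2 ^ Suc k" by auto
  thus ?thesis by (intro exI[of _ k]) (auto simp: not_le)
qed

lemma exponential_zeros_card:
  assumes "exponential_zeros a I M" "finite F" "F \<subseteq> I" "0 < \<delta>" "\<And>n. n \<in> F \<Longrightarrow> \<delta> \<le> 1 - norm (a n) \<and> 1 - norm (a n) < 2 * \<delta>"
  shows "card F \<le> M"
  using assms unfolding exponential_zeros_def by blast

text \<open>The classes below \<open>\<sigma>\<close> contribute a geometric series led by its term
  at the scale \<open>\<sigma>\<close>. The sum over the large zeros, with negative exponent,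
  behaves in the same way from the other side.\<close>

lemma sum_small_zeros:
  assumes ez: "exponential_zeros a I M" and F: "finite F" "F \<subseteq> I" and \<sigma>: "0 < \<sigma>"
    and d: "\<And>n. n \<in> F \<Longrightarrow> norm (a n) < 1 \<and> 1 - norm (a n) < \<sigma>" and \<gamma>: "0 < \<gamma>"
  shows "(\<Sum>n\<in>F. (1 - norm (a n)) powr \<gamma>) \<le> M * \<sigma> powr \<gamma> / (1 - 2 powr - \<gamma>)"
proof -
  define v where "v n = (SOME i. 2 ^ i < \<sigma> / (1 - norm (a n)) \<and> \<sigma> / (1 - norm (a n)) \<le> 2 * 2 ^ i)" for n
  have v: "1 - norm (a n) < \<sigma> / 2 ^ v n" "\<sigma> / 2 ^ v n / 2 \<le> 1 - norm (a n)" if "n \<in> F" for n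
  proof -
    have "1 < \<sigma> / (1 - norm (a n))" using d[OF that] by simp
    from someI_ex[OF dyadic_scale_gt[OF this]]
    have "2 ^ v n < \<sigma> / (1 - norm (a n))" "\<sigma> / (1 - norm (a n)) \<le> 2 * 2 ^ v n" unfolding v_def by auto
    thus "1 - norm (a n) < \<sigma> / 2 ^ v n" "\<sigma> / 2 ^ v n / 2 \<le> 1 - norm (a n)"
      using d[OF that] by (simp_all add: field_simps)
  qed
  show ?thesis
  proof (rule sum_geometric_classes[OF F(1)])
    show "card {n \<in> F. v n = i} \<le> M" for i
      by (rule exponential_zeros_card[OF ez, of _ "\<sigma> / 2 ^ i / 2"]) (use F \<sigma> v in force)+
    fix n assume n: "n \<in> F"
    have "(1 - norm (a n)) powr \<gamma> \<le> (\<sigma> / 2 ^ v n) powr \<gamma>"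
      using v[OF n] d[OF n] \<gamma> by (intro powr_mono2) auto
    also have "\<dots> = \<sigma> powr \<gamma> * (2 powr - \<gamma>) ^ v n"
    proof -
      have "\<sigma> / 2 ^ v n = \<sigma> * 2 powr - real (v n)" by (simp add: powr_minus_divide powr_realpow)
      thus ?thesis using \<sigma> by (simp add: powr_mult powr_realpow[symmetric] powr_powr mult.commute)
    qed
    finally show "(1 - norm (a n)) powr \<gamma> \<le> \<sigma> powr \<gamma> * (2 powr - \<gamma>) ^ v n" .
  qed (use \<gamma> in \<open>auto intro: powr_less_one\<close>)
qed

lemma sum_large_zeros:
  assumes ez: "exponential_zeros a I M" and F: "finite F" "F \<subseteq> I" and \<sigma>: "0 < \<sigma>"
    and d: "\<And>n. n \<in> F \<Longrightarrow> \<sigma> \<le> 1 - norm (a n)" and \<gamma>: "0 < \<gamma>"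
  shows "(\<Sum>n\<in>F. (1 - norm (a n)) powr - \<gamma>) \<le> M * \<sigma> powr - \<gamma> / (1 - 2 powr - \<gamma>)"
proof -
  define v where "v n = (SOME i. 2 ^ i \<le> (1 - norm (a n)) / \<sigma> \<and> (1 - norm (a n)) / \<sigma> < 2 * 2 ^ i)" for n
  have v: "\<sigma> * 2 ^ v n \<le> 1 - norm (a n)" "1 - norm (a n) < 2 * (\<sigma> * 2 ^ v n)" if "n \<in> F" for n
  proof -
    have "1 \<le> (1 - norm (a n)) / \<sigma>" using d[OF that] \<sigma> by simp
    from someI_ex[OF dyadic_scale_ge[OF this]]
    have "2 ^ v n \<le> (1 - norm (a n)) / \<sigma>" "(1 - norm (a n)) / \<sigma> < 2 * 2 ^ v n" unfolding v_def by auto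
    thus "\<sigma> * 2 ^ v n \<le> 1 - norm (a n)" "1 - norm (a n) < 2 * (\<sigma> * 2 ^ v n)"
      using \<sigma> by (simp_all add: field_simps)
  qed
  show ?thesis
  proof (rule sum_geometric_classes[OF F(1)])
    show "card {n \<in> F. v n = i} \<le> M" for i
      by (rule exponential_zeros_card[OF ez, of _ "\<sigma> * 2 ^ i"]) (use F \<sigma> v in force)+
    fix n assume n: "n \<in> F"
    have "(1 - norm (a n)) powr - \<gamma> \<le> (\<sigma> * 2 ^ v n) powr - \<gamma>"
      using v[OF n] \<gamma> \<sigma> by (intro powr_mono2') auto
    also have "\<dots> = \<sigma> powr - \<gamma> * (2 powr - \<gamma>) ^ v n"
      using \<sigma> by (simp add: powr_mult powr_realpow[symmetric] powr_powr mult.commute)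
    finally show "(1 - norm (a n)) powr - \<gamma> \<le> \<sigma> powr - \<gamma> * (2 powr - \<gamma>) ^ v n" .
  qed (use \<gamma> in \<open>auto intro: powr_less_one\<close>)
qed

text \<open>In this range, which contains \<open>pi / 2\<close>, the Taylor remainder
  \<open>\<bar>x\<bar>^3 / 6\<close> is at most two thirds of \<open>\<bar>x\<bar>\<close>.\<close>

lemma abs_sin_ge:
  fixes x :: real assumes "\<bar>x\<bar> \<le> 2" shows "\<bar>x\<bar> / 3 \<le> \<bar>sin x\<bar>"
proof -
  have "\<bar>sin x - x\<bar> \<le> inverse (fact 3) * \<bar>x\<bar> ^ 3"
    using Maclaurin_sin_bound[of x 3] by (simp add: sin_coeff_def numeral_3_eq_3)
  hence "\<bar>sin x - x\<bar> \<le> \<bar>x\<bar> ^ 3 / 6" by (simp add: fact_numeral)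
  also have "\<bar>x\<bar> ^ 3 = \<bar>x\<bar> * \<bar>x\<bar>\<^sup>2" by (simp add: power3_eq_cube power2_eq_square)
  also have "\<dots> \<le> \<bar>x\<bar> * 2\<^sup>2" using assms by (intro mult_left_mono power_mono) auto
  finally have "\<bar>sin x - x\<bar> \<le> 2 / 3 * \<bar>x\<bar>" by simp
  moreover have "\<bar>x\<bar> \<le> \<bar>sin x\<bar> + \<bar>sin x - x\<bar>" by linarith
  ultimately show ?thesis by linarith
qed

lemma norm_cis_diff: "norm (cis s - cis t) = 2 * \<bar>sin ((s - t) / 2)\<bar>"
proof -
  have "(norm (cis s - cis t))\<^sup>2 = (cos s - cos t)\<^sup>2 + (sin s - sin t)\<^sup>2"
    by (simp add: cmod_power2)
  also have "\<dots> = 2 - 2 * cos (s - t)"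
    using sin_cos_squared_add[of s] sin_cos_squared_add[of t] by (simp add: cos_diff power2_eq_square algebra_simps)
  also have "cos (s - t) = 1 - 2 * (sin ((s - t) / 2))\<^sup>2"
  proof -
    have "2 * ((s - t) / 2) = s - t" by simp
    thus ?thesis using cos_double_sin[of "(s - t) / 2"] by metis
  qed
  finally have "(norm (cis s - cis t))\<^sup>2 = (2 * \<bar>sin ((s - t) / 2)\<bar>)\<^sup>2" by (simp add: power_mult_distrib)
  thus ?thesis by (rule power2_eq_imp_eq) auto
qed

lemma measurable_continuous_superlevel:
  fixes g :: "real \<Rightarrow> real"
  assumes "continuous_on UNIV g"
  shows "{\<theta> \<in> {0..<2*pi}. t < g \<theta>} \<in> sets borel" "{\<theta> \<in> {0..<2*pi}. g \<theta> < t} \<in> sets borel"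
    "{\<theta> \<in> {0..<2*pi}. t < g \<theta>} \<in> fmeasurable lebesgue" "{\<theta> \<in> {0..<2*pi}. g \<theta> < t} \<in> fmeasurable lebesgue"
proof -
  have g[measurable]: "g \<in> borel_measurable borel" using assms by (rule borel_measurable_continuous_onI)
  show b: "{\<theta> \<in> {0..<2*pi}. t < g \<theta>} \<in> sets borel" "{\<theta> \<in> {0..<2*pi}. g \<theta> < t} \<in> sets borel"
    by measurable
  have I: "{0..<2*pi} \<in> fmeasurable lebesgue" by (intro fmeasurableI) auto
  show "{\<theta> \<in> {0..<2*pi}. t < g \<theta>} \<in> fmeasurable lebesgue" "{\<theta> \<in> {0..<2*pi}. g \<theta> < t} \<in> fmeasurable lebesgue"
    using b by (auto intro!: fmeasurableI2[OF I])
qed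

text \<open>Modulo \<open>2 * pi\<close> such an angle is within \<open>6 * \<rho>\<close> of
  \<open>Arg2pi a\<close>. Three translates, by \<open>-2 * pi\<close>, 0 and \<open>2 * pi\<close>,
  cover all cases, each an interval of length \<open>12 * \<rho>\<close>.\<close>

lemma measure_near_zero_le:
  assumes "norm a \<le> 1" "0 \<le> r" "r \<le> 1" "0 < \<rho>"
  shows "measure lebesgue (angles r (\<lambda>w. norm (1 - cnj a * w) < \<rho>)) \<le> 36 * \<rho>"
proof -
  define \<alpha> where "\<alpha> = Arg2pi a"
  define W where "W k = {\<alpha> + 2 * pi * k - 6 * \<rho>..\<alpha> + 2 * pi * k + 6 * \<rho>}" for k :: real
  have \<alpha>: "0 \<le> \<alpha>" "\<alpha> < 2 * pi" unfolding \<alpha>_def using Arg2pi by auto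
  have a: "a = of_real (norm a) * cis \<alpha>" unfolding \<alpha>_def using Arg2pi_eq[of a] by (simp add: cis_conv_exp)
  have sub: "angles r (\<lambda>w. norm (1 - cnj a * w) < \<rho>) \<subseteq> W 0 \<union> W 1 \<union> W (-1)"
  proof
    fix \<theta> assume "\<theta> \<in> angles r (\<lambda>w. norm (1 - cnj a * w) < \<rho>)"
    hence \<theta>: "\<theta> \<in> {0..<2*pi}" "norm (1 - cnj a * (circ r \<theta>)) < \<rho>" by auto
    define s where "s = norm a * r"
    have s: "0 \<le> s" "s \<le> 1" using assms mult_mono[of "norm a" 1 r 1] by (auto simp: s_def)
    have "cnj a * (circ r \<theta>) = of_real s * cis (\<theta> - \<alpha>)"
      by (subst a) (simp add: s_def cis_cnj cis_mult mult_ac)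
    hence w: "norm (1 - of_real s * cis (\<theta> - \<alpha>)) < \<rho>" using \<theta> by simp
    have "1 - norm (of_real s * cis (\<theta> - \<alpha>)) \<le> norm (1 - of_real s * cis (\<theta> - \<alpha>))"
      using norm_triangle_ineq2[of 1 "of_real s * cis (\<theta> - \<alpha>)"] by simp
    hence s1: "1 - s < \<rho>" using w s by (simp add: norm_mult)
    \<comment> \<open>Moving the point radially to the unit circle costs
      \<open>1 - s < \<rho>\<close>, so the chord is shorter than \<open>2 * \<rho>\<close>,
      whatever \<open>norm a\<close> and \<open>r\<close> are.\<close>
    have "cis (\<theta> - \<alpha>) - cis 0 = (of_real (1 - s)) * cis (\<theta> - \<alpha>) - (1 - of_real s * cis (\<theta> - \<alpha>))"
      by (simp add: algebra_simps)
    also have "norm \<dots> \<le> (1 - s) + norm (1 - of_real s * cis (\<theta> - \<alpha>))"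
      using norm_triangle_ineq4[of "(of_real (1 - s)) * cis (\<theta> - \<alpha>)" "1 - of_real s * cis (\<theta> - \<alpha>)"] s
      by (simp add: norm_mult del: of_real_diff)
    finally have "2 * \<bar>sin ((\<theta> - \<alpha>) / 2)\<bar> < 2 * \<rho>" using w s1 unfolding norm_cis_diff by simp
    hence sn: "\<bar>sin ((\<theta> - \<alpha>) / 2)\<bar> < \<rho>" by simp
    have near: "\<bar>\<theta> - \<alpha> - 2 * pi * k\<bar> \<le> 6 * \<rho>" if "\<bar>(\<theta> - \<alpha>) / 2 - pi * k\<bar> \<le> pi / 2" "\<bar>sin ((\<theta> - \<alpha>) / 2 - pi * k)\<bar> = \<bar>sin ((\<theta> - \<alpha>) / 2)\<bar>" for k
    proof -
      have "\<bar>(\<theta> - \<alpha>) / 2 - pi * k\<bar> / 3 \<le> \<bar>sin ((\<theta> - \<alpha>) / 2 - pi * k)\<bar>"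
        using that pi_less_4 by (intro abs_sin_ge) linarith
      hence "\<bar>(\<theta> - \<alpha>) / 2 - pi * k\<bar> \<le> 3 * \<rho>" using sn that by simp
      thus ?thesis by (simp add: abs_le_iff field_simps)
    qed
    have sh: "\<bar>sin (x - pi * 1)\<bar> = \<bar>sin x\<bar>" "\<bar>sin (x - pi * (-1))\<bar> = \<bar>sin x\<bar>" for x :: real by (simp_all add: sin_diff)
    have "(\<theta> - \<alpha>) / 2 < pi" "- pi < (\<theta> - \<alpha>) / 2" using \<theta> \<alpha> by auto
    then consider "\<bar>(\<theta> - \<alpha>) / 2 - pi * 0\<bar> \<le> pi / 2" | "\<bar>(\<theta> - \<alpha>) / 2 - pi * 1\<bar> \<le> pi / 2" | "\<bar>(\<theta> - \<alpha>) / 2 - pi * (-1)\<bar> \<le> pi / 2"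
      by linarith
    thus "\<theta> \<in> W 0 \<union> W 1 \<union> W (-1)"
    proof cases
      case 1
      have "\<bar>\<theta> - \<alpha> - 2 * pi * 0\<bar> \<le> 6 * \<rho>" by (rule near[OF 1]) simp
      hence "\<theta> \<in> W 0" unfolding W_def atLeastAtMost_iff by linarith
      thus ?thesis by blast
    next
      case 2
      have "\<bar>\<theta> - \<alpha> - 2 * pi * 1\<bar> \<le> 6 * \<rho>" by (rule near[OF 2 sh(1)])
      hence "\<theta> \<in> W 1" unfolding W_def atLeastAtMost_iff by linarith
      thus ?thesis by blast
    next
      case 3
      have "\<bar>\<theta> - \<alpha> - 2 * pi * (-1)\<bar> \<le> 6 * \<rho>" by (rule near[OF 3 sh(2)])
      hence "\<theta> \<in> W (-1)" unfolding W_def atLeastAtMost_iff by linarith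
      thus ?thesis by blast
    qed
  qed
  have W: "W k \<in> fmeasurable lebesgue" "measure lebesgue (W k) = 12 * \<rho>" for k
    using assms by (simp_all add: W_def)
  have "continuous_on UNIV (\<lambda>\<theta>. norm (1 - cnj a * (circ r \<theta>)))" by (intro continuous_intros)
  hence "angles r (\<lambda>w. norm (1 - cnj a * w) < \<rho>) \<in> sets lebesgue"
    by (rule fmeasurableD[OF measurable_continuous_superlevel(4)])
  hence "measure lebesgue (angles r (\<lambda>w. norm (1 - cnj a * w) < \<rho>)) \<le> measure lebesgue (W 0 \<union> W 1 \<union> W (-1))"
    by (rule measure_mono_fmeasurable[OF sub]) (intro fmeasurable.Un W)
  also have "\<dots> \<le> measure lebesgue (W 0 \<union> W 1) + measure lebesgue (W (-1))"
    by (rule measure_Un_le; intro sets.Un fmeasurableD W)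
  finally have "measure lebesgue (angles r (\<lambda>w. norm (1 - cnj a * w) < \<rho>))
      \<le> measure lebesgue (W 0 \<union> W 1) + measure lebesgue (W (-1))" .
  moreover have "measure lebesgue (W 0 \<union> W 1) \<le> measure lebesgue (W 0) + measure lebesgue (W 1)"
    by (rule measure_Un_le; intro fmeasurableD W)
  ultimately show ?thesis unfolding W(2) by linarith
qed

abbreviation zero_term :: "(nat \<Rightarrow> complex) \<Rightarrow> real \<Rightarrow> complex \<Rightarrow> nat \<Rightarrow> real" where
  "zero_term a \<beta> z n \<equiv> sqrt (1 - norm (a n)) / norm (1 - cnj (a n) * z) powr \<beta>"

definition zero_sum :: "(nat \<Rightarrow> complex) \<Rightarrow> real \<Rightarrow> nat set \<Rightarrow> complex \<Rightarrow> real" where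
  "zero_sum a \<beta> F z = (\<Sum>n\<in>F. zero_term a \<beta> z n)"

lemma continuous_zero_sum:
  assumes "0 \<le> r" "r < 1" "\<And>n. n \<in> F \<Longrightarrow> norm (a n) < 1"
  shows "continuous_on UNIV (\<lambda>\<theta>. \<Sum>n\<in>F. zero_term a \<beta> (circ r \<theta>) n)"
proof -
  have nz: "1 - cnj (a n) * (circ r \<theta>) \<noteq> 0" if "n \<in> F" for n \<theta>
    by (rule one_minus_cnj_mult_nz) (use that assms in \<open>auto simp: norm_mult\<close>)
  show ?thesis using nz by (intro continuous_intros) auto
qed

text \<open>
  Zeros with \<open>d\<^sub>n \<ge> \<sigma>\<close> are bounded by \<open>\<bar>1 - cnj a\<^sub>n z\<bar> \<ge> d\<^sub>n\<close>. For the others remove the arcs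
  \<open>\<bar>1 - cnj a\<^sub>n z\<bar> < d\<^sub>n\<^sup>\<gamma> \<sigma>\<^sup>1\<^sup>-\<^sup>\<gamma>\<close>; any \<open>0 < \<gamma> < 1/(2\<beta>)\<close> makes both their lengths and the remaining terms
  geometric. The level \<open>t\<close> determines \<open>\<sigma>\<close>.
\<close>
lemma weak_type_zero_sum:
  assumes ez: "exponential_zeros a I M" and \<beta>: "1 \<le> \<beta>" "\<beta> \<le> 2"
  shows "\<exists>C>0. \<forall>F r t. finite F \<longrightarrow> F \<subseteq> I \<longrightarrow> (\<forall>n\<in>F. norm (a n) < 1) \<longrightarrow> 0 \<le> r \<longrightarrow> r < 1 \<longrightarrow> 0 < t \<longrightarrow>
    measure lebesgue (angles r (\<lambda>w. t < (\<Sum>n\<in>F. zero_term a \<beta> w n)))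
      \<le> C * t powr (- (1 / (\<beta> - 1/2)))"
proof -
  \<comment> \<open>Three geometric series occur below, with exponents 1/4,
    \<open>\<beta> - 1/2\<close> and \<open>\<gamma>\<close>. All are at least 1/8, so
    \<open>\<kappa>\<close> serves for each of them.\<close>
  define \<kappa> where "\<kappa> = 1 / (1 - 2 powr - (1/8 :: real))"
  \<comment> \<open>The added 1 keeps \<open>C\<close> and \<open>\<sigma>\<close> positive when
    \<open>M = 0\<close>.\<close>
  define m where "m = real M + 1"
  have m: "m > 0" "real M \<le> m" by (simp_all add: m_def)
  have \<kappa>: "\<kappa> > 0" unfolding \<kappa>_def by (simp add: powr_less_one)
  have \<kappa>le: "c / (1 - 2 powr - s) \<le> c * \<kappa>" if "1/8 \<le> s" "0 \<le> c" for c s :: real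
  proof -
    have "2 powr - s \<le> 2 powr - (1/8 :: real)" using that by (intro powr_mono) auto
    moreover have "2 powr - (1/8 :: real) < 1" by (simp add: powr_less_one)
    ultimately have "c / (1 - 2 powr - s) \<le> c / (1 - 2 powr - (1/8))"
      using that by (intro divide_left_mono mult_pos_pos) linarith+
    thus ?thesis by (simp add: \<kappa>_def)
  qed
  \<comment> \<open>The midpoint of the admissible range. Then
    \<open>\<gamma> * \<beta> = 1/4\<close> for every \<open>\<beta>\<close>, and of the exponent
    1/2 of a small zero one half is left over for summation.\<close>
  define \<gamma> where "\<gamma> = 1 / (4 * \<beta>)"
  have \<gamma>: "0 < \<gamma>" "1/8 \<le> \<gamma>" "\<gamma> * \<beta> = 1/4" using \<beta> by (auto simp: \<gamma>_def field_simps)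
  define C where "C = 36 * \<kappa> * m * (2 * \<kappa> * m) powr (1 / (\<beta> - 1/2))"
  have "measure lebesgue (angles r (\<lambda>w. t < (\<Sum>n\<in>F. zero_term a \<beta> w n)))
      \<le> C * t powr (- (1 / (\<beta> - 1/2)))" (is "measure _ ?L \<le> _")
    if F: "finite F" "F \<subseteq> I" and lt: "\<forall>n\<in>F. norm (a n) < 1" and r: "0 \<le> r" "r < 1" and t: "0 < t" for F r t
  proof -
    \<comment> \<open>The scale at which the bounds for the small and for the large zeros, each
      equal to \<open>m * \<kappa> * \<sigma> powr (1/2 - \<beta>)\<close>, add up to
      \<open>t\<close>.\<close>
    define \<sigma> where "\<sigma> = (t / (2 * \<kappa> * m)) powr (- (1 / (\<beta> - 1/2)))"
    have \<sigma>: "0 < \<sigma>" using t \<kappa> m by (simp add: \<sigma>_def)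
    have \<sigma>t: "2 * \<kappa> * m * \<sigma> powr (1/2 - \<beta>) = t"
    proof -
      have "- (1 / (\<beta> - 1/2)) * (1/2 - \<beta>) = 1" using \<beta> by (simp add: field_simps)
      hence "\<sigma> powr (1/2 - \<beta>) = t / (2 * \<kappa> * m)" unfolding \<sigma>_def powr_powr using t \<kappa> m by simp
      thus ?thesis using \<kappa> m by simp
    qed
    define S where "S = {n \<in> F. 1 - norm (a n) < \<sigma>}"
    define L where "L = {n \<in> F. \<sigma> \<le> 1 - norm (a n)}"
    have SL: "F = S \<union> L" "S \<inter> L = {}" "finite S" "finite L" "S \<subseteq> I" "L \<subseteq> I" using F by (auto simp: S_def L_def)
    define \<rho> where "\<rho> n = (1 - norm (a n)) powr \<gamma> * \<sigma> powr (1 - \<gamma>)" for n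
    have \<rho>: "\<rho> n > 0" if "n \<in> F" for n using bspec[OF lt that] \<sigma> unfolding \<rho>_def by (intro mult_pos_pos) auto
    define E where "E n = angles r (\<lambda>w. norm (1 - cnj (a n) * w) < \<rho> n)" for n
    have E: "E n \<in> fmeasurable lebesgue" for n unfolding E_def
      by (intro measurable_continuous_superlevel continuous_intros)
    have sub: "?L \<subseteq> (\<Union>n\<in>S. E n)"
    proof (rule ccontr)
      assume "\<not> ?L \<subseteq> (\<Union>n\<in>S. E n)"
      then obtain \<theta> where \<theta>: "\<theta> \<in> {0..<2*pi}" "\<And>n. n \<in> S \<Longrightarrow> \<theta> \<notin> E n"
        and tt: "t < (\<Sum>n\<in>F. zero_term a \<beta> (circ r \<theta>) n)" by blast
      have "(\<Sum>n\<in>S. zero_term a \<beta> (circ r \<theta>) n)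
         \<le> (\<Sum>n\<in>S. (1 - norm (a n)) powr (1/4) * \<sigma> powr (1/4 - \<beta>))"
      proof (rule sum_mono)
        fix n assume n: "n \<in> S"
        define d where "d = 1 - norm (a n)"
        have d: "d > 0" using n lt by (auto simp: d_def S_def)
        have nF: "n \<in> F" using n by (simp add: S_def)
        have "\<rho> n \<le> norm (1 - cnj (a n) * (circ r \<theta>))" using \<theta>(2)[OF n] \<theta>(1) by (simp add: E_def not_less)
        hence "\<rho> n powr \<beta> \<le> norm (1 - cnj (a n) * (circ r \<theta>)) powr \<beta>"
          using \<rho>[OF nF] \<beta> by (intro powr_mono2) auto
        hence "sqrt d / norm (1 - cnj (a n) * (circ r \<theta>)) powr \<beta> \<le> sqrt d / \<rho> n powr \<beta>"
          using \<rho>[OF nF] d by (intro divide_left_mono mult_pos_pos) auto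
        also have "\<rho> n powr \<beta> = d powr (1/4) * \<sigma> powr (\<beta> - 1/4)"
        proof -
          have "\<rho> n powr \<beta> = d powr (\<gamma> * \<beta>) * \<sigma> powr ((1 - \<gamma>) * \<beta>)"
            unfolding \<rho>_def d_def by (simp add: powr_mult powr_powr)
          moreover have "(1 - \<gamma>) * \<beta> = \<beta> - 1/4" using \<gamma>(3) by (simp add: left_diff_distrib)
          ultimately show ?thesis using \<gamma>(3) by simp
        qed
        also have "sqrt d / (d powr (1/4) * \<sigma> powr (\<beta> - 1/4)) = d powr (1/4) * \<sigma> powr (1/4 - \<beta>)"
        proof -
          have "sqrt d = d powr (1/4) * d powr (1/4)" using d by (simp add: powr_half_sqrt[symmetric] powr_add[symmetric])
          moreover have "\<sigma> powr (1/4 - \<beta>) = 1 / \<sigma> powr (\<beta> - 1/4)" using powr_minus_divide[of \<sigma> "\<beta> - 1/4"] by simp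
          ultimately show ?thesis using d by simp
        qed
        finally show "zero_term a \<beta> (circ r \<theta>) n \<le> (1 - norm (a n)) powr (1/4) * \<sigma> powr (1/4 - \<beta>)"
          unfolding d_def .
      qed
      also have "\<dots> = (\<Sum>n\<in>S. (1 - norm (a n)) powr (1/4)) * \<sigma> powr (1/4 - \<beta>)" by (simp add: sum_distrib_right)
      also have "\<dots> \<le> (M * \<sigma> powr (1/4) / (1 - 2 powr - (1/4))) * \<sigma> powr (1/4 - \<beta>)"
        by (intro mult_right_mono sum_small_zeros[OF ez SL(3,5) \<sigma>]) (use lt in \<open>auto simp: S_def\<close>)
      also have "\<dots> \<le> (M * \<sigma> powr (1/4) * \<kappa>) * \<sigma> powr (1/4 - \<beta>)"
        by (intro mult_right_mono \<kappa>le) auto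
      also have "\<dots> = M * \<kappa> * (\<sigma> powr (1/4) * \<sigma> powr (1/4 - \<beta>))" by simp
      also have "\<sigma> powr (1/4) * \<sigma> powr (1/4 - \<beta>) = \<sigma> powr (1/2 - \<beta>)" by (simp add: powr_add[symmetric])
      also have "M * \<kappa> * \<sigma> powr (1/2 - \<beta>) \<le> m * \<kappa> * \<sigma> powr (1/2 - \<beta>)" using m \<kappa> by (intro mult_right_mono) auto
      finally have 1: "(\<Sum>n\<in>S. zero_term a \<beta> (circ r \<theta>) n) \<le> m * \<kappa> * \<sigma> powr (1/2 - \<beta>)" .
      have "(\<Sum>n\<in>L. zero_term a \<beta> (circ r \<theta>) n)
         \<le> (\<Sum>n\<in>L. (1 - norm (a n)) powr - (\<beta> - 1/2))"
      proof (rule sum_mono)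
        fix n assume n: "n \<in> L"
        define d where "d = 1 - norm (a n)"
        have d: "d > 0" using n lt by (auto simp: d_def L_def)
        have "d \<le> norm (1 - cnj (a n) * (circ r \<theta>))" unfolding d_def
          by (rule norm_one_minus_cnj_mult_ge) (use r in \<open>simp add: norm_mult\<close>)
        hence le: "d powr \<beta> \<le> norm (1 - cnj (a n) * (circ r \<theta>)) powr \<beta>"
          using d \<beta> by (intro powr_mono2) auto
        moreover have "0 < d powr \<beta>" using d by simp
        ultimately have "sqrt d / norm (1 - cnj (a n) * (circ r \<theta>)) powr \<beta> \<le> sqrt d / d powr \<beta>"
          using d by (intro divide_left_mono mult_pos_pos) auto
        also have "sqrt d / d powr \<beta> = d powr - (\<beta> - 1/2)" using d by (simp add: powr_half_sqrt[symmetric] powr_diff)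
        finally show "zero_term a \<beta> (circ r \<theta>) n \<le> (1 - norm (a n)) powr - (\<beta> - 1/2)"
          unfolding d_def .
      qed
      also have "\<dots> \<le> M * \<sigma> powr - (\<beta> - 1/2) / (1 - 2 powr - (\<beta> - 1/2))"
        by (rule sum_large_zeros[OF ez SL(4,6) \<sigma>]) (use \<beta> in \<open>auto simp: L_def\<close>)
      also have "\<dots> \<le> M * \<sigma> powr - (\<beta> - 1/2) * \<kappa>" using \<beta> by (intro \<kappa>le) auto
      also have "\<dots> = M * \<kappa> * \<sigma> powr (1/2 - \<beta>)" by simp
      also have "\<dots> \<le> m * \<kappa> * \<sigma> powr (1/2 - \<beta>)" using m \<kappa> by (intro mult_right_mono) auto
      finally have 2: "(\<Sum>n\<in>L. zero_term a \<beta> (circ r \<theta>) n) \<le> m * \<kappa> * \<sigma> powr (1/2 - \<beta>)" .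
      have "m * \<kappa> * \<sigma> powr (1/2 - \<beta>) + m * \<kappa> * \<sigma> powr (1/2 - \<beta>) = t" using \<sigma>t by (simp add: mult_ac)
      hence "(\<Sum>n\<in>F. zero_term a \<beta> (circ r \<theta>) n) \<le> t"
        using 1 2 unfolding SL(1) sum.union_disjoint[OF SL(3,4,2)] by linarith
      thus False using tt by simp
    qed
    have cont: "continuous_on UNIV (\<lambda>\<theta>. \<Sum>n\<in>F. zero_term a \<beta> (circ r \<theta>) n)"
      by (rule continuous_zero_sum) (use r lt in auto)
    have "measure lebesgue ?L \<le> measure lebesgue (\<Union>n\<in>S. E n)"
      by (rule measure_mono_fmeasurable[OF sub fmeasurableD[OF measurable_continuous_superlevel(3)[OF cont]]
            fmeasurable.finite_UN[OF SL(3) E]])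
    also have "\<dots> \<le> (\<Sum>n\<in>S. measure lebesgue (E n))"
      using E by (intro measure_UNION_le SL) auto
    also have "\<dots> \<le> (\<Sum>n\<in>S. 36 * \<rho> n)"
      unfolding E_def using lt r \<rho> by (intro sum_mono measure_near_zero_le) (auto simp: S_def less_imp_le)
    also have "\<dots> = 36 * (\<Sum>n\<in>S. (1 - norm (a n)) powr \<gamma>) * \<sigma> powr (1 - \<gamma>)"
      by (simp add: \<rho>_def sum_distrib_left sum_distrib_right mult_ac)
    also have "\<dots> \<le> 36 * (M * \<sigma> powr \<gamma> / (1 - 2 powr - \<gamma>)) * \<sigma> powr (1 - \<gamma>)"
      by (intro mult_right_mono mult_left_mono sum_small_zeros[OF ez SL(3,5) \<sigma>]) (use lt \<gamma> in \<open>auto simp: S_def\<close>)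
    also have "\<dots> \<le> 36 * (m * \<sigma> powr \<gamma> * \<kappa>) * \<sigma> powr (1 - \<gamma>)"
    proof (intro mult_right_mono mult_left_mono)
      have "M * \<sigma> powr \<gamma> / (1 - 2 powr - \<gamma>) \<le> M * \<sigma> powr \<gamma> * \<kappa>" using \<gamma> by (intro \<kappa>le) auto
      also have "\<dots> \<le> m * \<sigma> powr \<gamma> * \<kappa>" using m \<kappa> by (intro mult_right_mono) auto
      finally show "M * \<sigma> powr \<gamma> / (1 - 2 powr - \<gamma>) \<le> m * \<sigma> powr \<gamma> * \<kappa>" .
    qed auto
    also have "\<dots> = 36 * m * \<kappa> * (\<sigma> powr \<gamma> * \<sigma> powr (1 - \<gamma>))" by simp
    also have "\<sigma> powr \<gamma> * \<sigma> powr (1 - \<gamma>) = \<sigma>" using \<sigma> by (simp add: powr_add[symmetric])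
    also have "36 * m * \<kappa> * \<sigma> = C * t powr (- (1 / (\<beta> - 1/2)))"
    proof -
      have "\<sigma> = (2 * \<kappa> * m) powr (1 / (\<beta> - 1/2)) * t powr (- (1 / (\<beta> - 1/2)))"
        unfolding \<sigma>_def using t \<kappa> m by (subst powr_divide) (auto simp: powr_minus_divide)
      thus ?thesis by (simp add: C_def mult_ac)
    qed
    finally show ?thesis .
  qed
  moreover have "C > 0" using \<kappa> m by (simp add: C_def)
  ultimately show ?thesis by blast
qed

section \<open>Pointwise bounds for derivatives by sums over the zeros\<close>

lemma circle_length_Collect:
  "circle_length {\<zeta> \<in> sphere 0 1. Q \<zeta>} = measure lebesgue {\<theta> \<in> {0..<2*pi}. Q (cis \<theta>)}"
  by (simp add: circle_length_def)

lemma sum_power2_le: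
  fixes u :: "'a \<Rightarrow> real" assumes "finite F" "\<And>n. n \<in> F \<Longrightarrow> 0 \<le> u n"
  shows "(\<Sum>n\<in>F. (u n)\<^sup>2) \<le> (\<Sum>n\<in>F. u n)\<^sup>2"
proof -
  have "(\<Sum>n\<in>F. (u n)\<^sup>2) \<le> (\<Sum>n\<in>F. u n * (\<Sum>m\<in>F. u m))"
    unfolding power2_eq_square using assms by (intro sum_mono mult_left_mono member_le_sum) auto
  thus ?thesis by (simp add: sum_distrib_right power2_eq_square)
qed

text \<open>The product rule, with the other factors bounded by 1, leaves a sum of squares of the
  terms of \<open>zero_sum a 1\<close>. Replacing it by the square of the sum means that no separate
  weak-type estimate is needed for it.\<close>

lemma norm_deriv_bprod_le:
  assumes F: "finite F" and lt: "\<And>n. n \<in> F \<Longrightarrow> norm (a n) < 1" and z: "norm z \<le> 1"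
  shows "norm (deriv (bprod a F) z) \<le> 2 * (zero_sum a 1 F z)\<^sup>2"
proof -
  have "norm (deriv (bprod a F) z) \<le> (\<Sum>n\<in>F. (1 - (norm (a n))\<^sup>2) / (norm (1 - cnj (a n) * z))\<^sup>2)"
    using F lt
  proof (induction F rule: finite_induct)
    case empty
    then show ?case by (simp add: bprod_empty[abs_def])
  next
    case (insert m F)
    have am: "(norm (a m))\<^sup>2 \<le> 1" using insert.prems[of m] by (simp add: power_le_one)
    define b' where "b' = - sgn_cnj (a m) * of_real (1 - (norm (a m))\<^sup>2) / (1 - cnj (a m) * z)\<^sup>2"
    have b': "(blaschke_factor (a m) has_field_derivative b') (at z)"
      unfolding b'_def by (rule has_field_derivative_blaschke_factor) (use insert z in auto)
    have nb': "norm b' = (1 - (norm (a m))\<^sup>2) / (norm (1 - cnj (a m) * z))\<^sup>2"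
      unfolding b'_def norm_mult norm_divide norm_power norm_minus_cancel norm_sgn_cnj norm_of_real using am by simp
    have P': "(bprod a F has_field_derivative deriv (bprod a F) z) (at z)"
      unfolding DERIV_deriv_iff_field_differentiable
      by (intro bprod_field_differentiable) (use insert z in auto)
    have "bprod a (insert m F) = (\<lambda>z. blaschke_factor (a m) z * bprod a F z)"
      using insert by (simp add: bprod_insert fun_eq_iff)
    hence "(bprod a (insert m F) has_field_derivative (b' * bprod a F z + deriv (bprod a F) z * blaschke_factor (a m) z)) (at z)"
      using DERIV_mult[OF b' P'] by simp
    hence "deriv (bprod a (insert m F)) z = b' * bprod a F z + deriv (bprod a F) z * blaschke_factor (a m) z"
      by (rule DERIV_imp_deriv)
    also have "norm \<dots> \<le> norm b' * norm (bprod a F z) + norm (deriv (bprod a F) z) * norm (blaschke_factor (a m) z)"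
      using norm_triangle_ineq by (metis norm_mult)
    also have "\<dots> \<le> norm b' + norm (deriv (bprod a F) z)"
    proof (intro add_mono mult_left_le)
      show "norm (bprod a F z) \<le> 1" by (rule norm_bprod_le_1) (use insert z in auto)
      show "norm (blaschke_factor (a m) z) \<le> 1" by (rule norm_blaschke_factor_le_1) (use insert z in auto)
    qed auto
    also have "norm (deriv (bprod a F) z) \<le> (\<Sum>n\<in>F. (1 - (norm (a n))\<^sup>2) / (norm (1 - cnj (a n) * z))\<^sup>2)"
      using insert by simp
    finally show ?case using insert nb' by simp
  qed
  also have "\<dots> \<le> (\<Sum>n\<in>F. 2 * (zero_term a 1 z n)\<^sup>2)"
  proof (rule sum_mono)
    fix n assume n: "n \<in> F"
    have "1 - (norm (a n))\<^sup>2 = (1 - norm (a n)) * (1 + norm (a n))" by (simp add: power2_eq_square algebra_simps)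
    also have "\<dots> \<le> (1 - norm (a n)) * 2" using lt[OF n] by (intro mult_left_mono) auto
    finally have "1 - (norm (a n))\<^sup>2 \<le> 2 * (1 - norm (a n))" by simp
    from divide_right_mono[OF this, of "(norm (1 - cnj (a n) * z))\<^sup>2"]
    show "(1 - (norm (a n))\<^sup>2) / (norm (1 - cnj (a n) * z))\<^sup>2 \<le> 2 * (zero_term a 1 z n)\<^sup>2"
      using lt[OF n] by (simp add: power_divide)
  qed
  also have "\<dots> = 2 * (\<Sum>n\<in>F. (zero_term a 1 z n)\<^sup>2)" by (simp add: sum_distrib_left)
  also have "\<dots> \<le> 2 * (zero_sum a 1 F z)\<^sup>2" unfolding zero_sum_def
    using lt by (intro mult_left_mono sum_power2_le F) (auto simp: less_imp_le)
  finally show ?thesis .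
qed

context blaschke_sequence
begin

lemma zero_sum_nonneg: "F \<subseteq> I \<Longrightarrow> 0 \<le> zero_sum a \<beta> F z"
  unfolding zero_sum_def using norm_zero_lt_1 by (intro sum_nonneg) (auto intro!: divide_nonneg_nonneg simp: less_imp_le subset_iff)

lemma zero_sum_mono: "finite G \<Longrightarrow> G \<subseteq> I \<Longrightarrow> F \<subseteq> G \<Longrightarrow> zero_sum a \<beta> F z \<le> zero_sum a \<beta> G z"
  unfolding zero_sum_def using norm_zero_lt_1 by (intro sum_mono2) (auto intro!: divide_nonneg_nonneg simp: less_imp_le subset_iff)

lemma has_field_derivative_malmquist:
  assumes n: "n \<in> I" and z: "norm z \<le> 1"
  shows "(malmquist a I n has_field_derivative
     deriv (bprod a {j \<in> I. j < n}) z * szego (a n) z +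
     szego (a n) z * (cnj (a n) / (1 - cnj (a n) * z)) * bprod a {j \<in> I. j < n} z) (at z)"
proof -
  have "bprod a {j \<in> I. j < n} field_differentiable at z"
    by (rule bprod_field_differentiable) (use norm_zero_lt_1 z in auto)
  hence "(bprod a {j \<in> I. j < n} has_field_derivative deriv (bprod a {j \<in> I. j < n}) z) (at z)"
    by (simp add: DERIV_deriv_iff_field_differentiable)
  from DERIV_mult[OF this has_field_derivative_szego[OF norm_zero_lt_1[OF n] z]]
  show ?thesis unfolding malmquist_def[abs_def] .
qed

text \<open>By the product rule, differentiating the partial product costs a factor of order
  \<open>(zero_sum a 1 F z)^2\<close>, and summing the Szego factors makes it a cube.
  Differentiating the Szego factor instead raises the power of its denominator from 1 to 2.\<close>

lemma sum_norm_deriv_malmquist_le: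
  assumes z: "norm z \<le> 1"
  shows "(\<Sum>n\<in>I \<inter> {..<N}. norm (deriv (malmquist a I n) z)) \<le>
    2 * sqrt 2 * (zero_sum a 1 (I \<inter> {..<N}) z) ^ 3 + sqrt 2 * zero_sum a 2 (I \<inter> {..<N}) z"
proof -
  define F where "F = I \<inter> {..<N}"
  have "(\<Sum>n\<in>F. norm (deriv (malmquist a I n) z)) \<le>
     (\<Sum>n\<in>F. 2 * sqrt 2 * (zero_sum a 1 F z)\<^sup>2 * (zero_term a 1 z n)
        + sqrt 2 * (zero_term a 2 z n))"
  proof (rule sum_mono)
    fix n assume "n \<in> F"
    hence n: "n \<in> I" "n < N" by (auto simp: F_def)
    define G where "G = {j \<in> I. j < n}"
    have G: "finite G" "\<And>j. j \<in> G \<Longrightarrow> norm (a j) < 1" "G \<subseteq> F" using n norm_zero_lt_1 by (auto simp: G_def F_def)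
    define p where "p = norm (1 - cnj (a n) * z)"
    have p: "p > 0" using one_minus_cnj_mult_nz[OF norm_zero_lt_1[OF n(1)] z] by (simp add: p_def)
    have k: "norm (szego (a n) z) \<le> sqrt 2 * (sqrt (1 - norm (a n)) / p)"
      unfolding p_def by (rule norm_szego_le[OF norm_zero_lt_1[OF n(1)] z])
    have d: "norm (deriv (bprod a G) z) \<le> 2 * (zero_sum a 1 F z)\<^sup>2"
    proof -
      have "norm (deriv (bprod a G) z) \<le> 2 * (zero_sum a 1 G z)\<^sup>2" by (rule norm_deriv_bprod_le[OF G(1,2) z])
      also have "\<dots> \<le> 2 * (zero_sum a 1 F z)\<^sup>2"
        using G(3) by (intro mult_left_mono power_mono zero_sum_mono zero_sum_nonneg) (auto simp: F_def)
      finally show ?thesis .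
    qed
    have "deriv (malmquist a I n) z = deriv (bprod a G) z * szego (a n) z +
        szego (a n) z * (cnj (a n) / (1 - cnj (a n) * z)) * bprod a G z"
      unfolding G_def by (rule DERIV_imp_deriv[OF has_field_derivative_malmquist[OF n(1) z]])
    also have "norm \<dots> \<le> norm (deriv (bprod a G) z) * norm (szego (a n) z) + norm (szego (a n) z) * (norm (a n) / p) * norm (bprod a G z)"
      by (rule order_trans[OF norm_triangle_ineq]) (simp add: norm_mult norm_divide p_def)
    also have "\<dots> \<le> 2 * (zero_sum a 1 F z)\<^sup>2 * (sqrt 2 * (sqrt (1 - norm (a n)) / p)) + sqrt 2 * (sqrt (1 - norm (a n)) / p) * (1 / p) * 1"
    proof (intro add_mono mult_mono d k)
      show "norm (bprod a G z) \<le> 1" by (rule norm_bprod_le_1[OF G(1,2) z])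
      show "norm (a n) / p \<le> 1 / p" using norm_zero_lt_1[OF n(1)] p by (intro divide_right_mono) auto
    qed (use p norm_zero_lt_1[OF n(1)] in auto)
    finally show "norm (deriv (malmquist a I n) z) \<le> 2 * sqrt 2 * (zero_sum a 1 F z)\<^sup>2 * (zero_term a 1 z n)
        + sqrt 2 * (zero_term a 2 z n)"
      using p unfolding p_def[symmetric] by (simp add: power2_eq_square mult_ac)
  qed
  also have "\<dots> = 2 * sqrt 2 * (zero_sum a 1 F z)\<^sup>2 * zero_sum a 1 F z + sqrt 2 * zero_sum a 2 F z"
    unfolding zero_sum_def sum.distrib sum_distrib_left by simp
  finally show ?thesis by (simp add: F_def power2_eq_square power3_eq_cube mult_ac)
qed

text \<open>Passes to infinitely many zeros by continuity of the measure from below: the superlevel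
  sets increase with \<open>N\<close>, and the constant in \<open>weak_type_zero_sum\<close> is the
  same for all finite sets. Asking for some \<open>N\<close> avoids speaking of a possibly divergent
  sum.\<close>

lemma weak_type_zero_sum_all:
  assumes ez: "exponential_zeros a I M" and \<beta>: "1 \<le> \<beta>" "\<beta> \<le> 2"
  obtains C where "0 < C"
    "\<And>r t. 0 \<le> r \<Longrightarrow> r < 1 \<Longrightarrow> 0 < t \<Longrightarrow>
       angles r (\<lambda>w. \<exists>N. t < zero_sum a \<beta> (I \<inter> {..<N}) w) \<in> fmeasurable lebesgue"
    "\<And>r t. 0 \<le> r \<Longrightarrow> r < 1 \<Longrightarrow> 0 < t \<Longrightarrow>
       measure lebesgue (angles r (\<lambda>w. \<exists>N. t < zero_sum a \<beta> (I \<inter> {..<N}) w)) \<le> C * t powr (- (1 / (\<beta> - 1/2)))"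
proof -
  from weak_type_zero_sum[OF ez \<beta>] obtain C where C: "C > 0"
    "\<And>F r t. finite F \<Longrightarrow> F \<subseteq> I \<Longrightarrow> (\<forall>n\<in>F. norm (a n) < 1) \<Longrightarrow> 0 \<le> r \<Longrightarrow> r < 1 \<Longrightarrow> 0 < t \<Longrightarrow>
    measure lebesgue (angles r (\<lambda>w. t < (\<Sum>n\<in>F. zero_term a \<beta> w n)))
      \<le> C * t powr (- (1 / (\<beta> - 1/2)))" by blast
  have *: "angles r (\<lambda>w. \<exists>N. t < zero_sum a \<beta> (I \<inter> {..<N}) w) \<in> fmeasurable lebesgue \<and>
       measure lebesgue (angles r (\<lambda>w. \<exists>N. t < zero_sum a \<beta> (I \<inter> {..<N}) w)) \<le> C * t powr (- (1 / (\<beta> - 1/2)))"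
    if r: "0 \<le> r" "r < 1" and t: "0 < t" for r t
  proof -
    define A where "A N = angles r (\<lambda>w. t < zero_sum a \<beta> (I \<inter> {..<N}) w)" for N
    have eq: "angles r (\<lambda>w. \<exists>N. t < zero_sum a \<beta> (I \<inter> {..<N}) w) = (\<Union>N. A N)" by (auto simp: A_def)
    have A: "A N \<in> fmeasurable lebesgue" for N unfolding A_def zero_sum_def
      by (intro measurable_continuous_superlevel continuous_zero_sum r) (use norm_zero_lt_1 in auto)
    have U: "(\<Union>N. A N) \<in> fmeasurable lebesgue"
    proof (rule fmeasurableI2)
      show "{0..2*pi} \<in> fmeasurable lebesgue" by simp
      show "(\<Union>N. A N) \<subseteq> {0..2*pi}" by (auto simp: A_def)
      show "(\<Union>N. A N) \<in> sets lebesgue" using A by (intro sets.countable_UN) (auto intro: fmeasurableD)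
    qed
    have "incseq A"
    proof (rule incseq_SucI)
      fix N show "A N \<subseteq> A (Suc N)" unfolding A_def
        using zero_sum_mono[of "I \<inter> {..<Suc N}" "I \<inter> {..<N}" \<beta>] by (fastforce intro: less_le_trans)
    qed
    hence "(\<lambda>N. measure lebesgue (A N)) \<longlonglongrightarrow> measure lebesgue (\<Union>N. A N)"
      using A U by (intro Lim_measure_incseq) (auto intro: fmeasurableD simp: fmeasurable_def)
    moreover have "measure lebesgue (A N) \<le> C * t powr (- (1 / (\<beta> - 1/2)))" for N
      unfolding A_def zero_sum_def by (intro C(2) r t) (use norm_zero_lt_1 in auto)
    ultimately have "measure lebesgue (\<Union>N. A N) \<le> C * t powr (- (1 / (\<beta> - 1/2)))"
      by (intro LIMSEQ_le_const2) auto
    thus ?thesis using U unfolding eq by simp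
  qed
  show thesis by (rule that[OF C(1)]) (use * in auto)
qed

lemma fmeasurable_deriv_superlevel:
  assumes "f holomorphic_on ball 0 1" "0 \<le> r" "r < 1"
  shows "angles r (\<lambda>w. t < norm (deriv f w)) \<in> fmeasurable lebesgue"
  by (intro measurable_continuous_superlevel continuous_intros continuous_on_circle
      holomorphic_on_imp_continuous_on holomorphic_deriv assms) auto

lemma exponential_zeros_imp_weak_hardy:
  assumes ez: "exponential_zeros a I M"
  shows "\<exists>C>0. \<forall>r\<in>{0<..<1}. \<forall>t>0.
      circle_length {\<zeta> \<in> sphere 0 1. norm (deriv (blaschke_prod a I) (of_real r * \<zeta>)) > t} \<le> C * t powr - 1"
proof -
  have \<beta>: "1 \<le> (1::real)" "(1::real) \<le> 2" by auto
  obtain C where C: "0 < C"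
    "\<And>r t. 0 \<le> r \<Longrightarrow> r < 1 \<Longrightarrow> 0 < t \<Longrightarrow>
       angles r (\<lambda>w. \<exists>N. t < zero_sum a 1 (I \<inter> {..<N}) w) \<in> fmeasurable lebesgue"
    "\<And>r t. 0 \<le> r \<Longrightarrow> r < 1 \<Longrightarrow> 0 < t \<Longrightarrow>
       measure lebesgue (angles r (\<lambda>w. \<exists>N. t < zero_sum a 1 (I \<inter> {..<N}) w)) \<le> C * t powr (- (1 / (1 - 1/2)))"
    using weak_type_zero_sum_all[OF ez \<beta>] by blast
  show ?thesis
  proof (intro exI[of _ "2 * C"] conjI ballI allI impI)
    fix r t :: real assume r: "r \<in> {0<..<1}" and t: "0 < t"
    define s where "s = sqrt (t / 2)"
    have s: "0 < s" "2 * s\<^sup>2 = t" using t by (simp_all add: s_def)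
    have "angles r (\<lambda>w. t < norm (deriv (blaschke_prod a I) w)) \<subseteq>
        angles r (\<lambda>w. \<exists>N. s < zero_sum a 1 (I \<inter> {..<N}) w)"
    proof (rule ccontr)
      assume "\<not> ?thesis"
      then obtain \<theta> where "t < norm (deriv (blaschke_prod a I) (circ r \<theta>))"
         "\<not> (\<exists>N. s < zero_sum a 1 (I \<inter> {..<N}) (circ r \<theta>))" by blast
      hence \<theta>: "t < norm (deriv (blaschke_prod a I) (circ r \<theta>))"
         "\<And>N. zero_sum a 1 (I \<inter> {..<N}) (circ r \<theta>) \<le> s" by (simp_all add: not_less)
      have z: "norm (circ r \<theta>) < 1" using r by (simp add: norm_mult)
      have "norm (deriv (bprod a (I \<inter> {..<N})) (circ r \<theta>)) \<le> t" for N
      proof -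
        have "norm (deriv (bprod a (I \<inter> {..<N})) (circ r \<theta>)) \<le> 2 * (zero_sum a 1 (I \<inter> {..<N}) (circ r \<theta>))\<^sup>2"
          by (rule norm_deriv_bprod_le) (use norm_zero_lt_1 z in auto)
        also have "\<dots> \<le> 2 * s\<^sup>2" by (intro mult_left_mono power_mono \<theta> zero_sum_nonneg) auto
        finally show ?thesis using s by simp
      qed
      hence "norm (deriv (blaschke_prod a I) (circ r \<theta>)) \<le> t"
        by (intro Lim_norm_ubound[OF _ deriv_bprod_tendsto[OF z]]) auto
      with \<theta>(1) show False by simp
    qed
    hence "measure lebesgue (angles r (\<lambda>w. t < norm (deriv (blaschke_prod a I) w))) \<le>
      measure lebesgue (angles r (\<lambda>w. \<exists>N. s < zero_sum a 1 (I \<inter> {..<N}) w))"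
      by (rule measure_mono_fmeasurable[OF _ fmeasurableD[OF fmeasurable_deriv_superlevel[OF blaschke_prod_holomorphic]] C(2)])
         (use r s in auto)
    also have "\<dots> \<le> C * s powr (- (1 / (1 - 1/2)))" using C(3) r s by auto
    also have "s powr (- (1 / (1 - 1/2))) = 2 * t powr - 1"
      using s t by (simp add: powr_minus_divide powr_numeral s_def)
    finally show "circle_length {\<zeta> \<in> sphere 0 1. norm (deriv (blaschke_prod a I) (of_real r * \<zeta>)) > t} \<le> 2 * C * t powr - 1"
      unfolding circle_length_Collect by (simp only: mult_ac)
  qed (use C(1) in simp)
qed

lemma exponential_zeros_imp_model_space:
  assumes ez: "exponential_zeros a I M"
  shows "\<exists>C>0. \<forall>f\<in>model_space (blaschke_prod a I). \<forall>r\<in>{0<..<1}. \<forall>t>0.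
       circle_length {\<zeta> \<in> sphere 0 1. norm (deriv f (of_real r * \<zeta>)) > t * hardy_norm 2 f} \<le> C * t powr (- (2 / 3))"
proof -
  have \<beta>: "1 \<le> (1::real)" "(1::real) \<le> 2" "1 \<le> (2::real)" "(2::real) \<le> 2" by auto
  obtain C1 where C1: "0 < C1"
    "\<And>r t. 0 \<le> r \<Longrightarrow> r < 1 \<Longrightarrow> 0 < t \<Longrightarrow>
       angles r (\<lambda>w. \<exists>N. t < zero_sum a 1 (I \<inter> {..<N}) w) \<in> fmeasurable lebesgue"
    "\<And>r t. 0 \<le> r \<Longrightarrow> r < 1 \<Longrightarrow> 0 < t \<Longrightarrow>
       measure lebesgue (angles r (\<lambda>w. \<exists>N. t < zero_sum a 1 (I \<inter> {..<N}) w)) \<le> C1 * t powr (- (1 / (1 - 1/2)))"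
    using weak_type_zero_sum_all[OF ez \<beta>(1,2)] by blast
  obtain C2 where C2: "0 < C2"
    "\<And>r t. 0 \<le> r \<Longrightarrow> r < 1 \<Longrightarrow> 0 < t \<Longrightarrow>
       angles r (\<lambda>w. \<exists>N. t < zero_sum a 2 (I \<inter> {..<N}) w) \<in> fmeasurable lebesgue"
    "\<And>r t. 0 \<le> r \<Longrightarrow> r < 1 \<Longrightarrow> 0 < t \<Longrightarrow>
       measure lebesgue (angles r (\<lambda>w. \<exists>N. t < zero_sum a 2 (I \<inter> {..<N}) w)) \<le> C2 * t powr (- (1 / (2 - 1/2)))"
    using weak_type_zero_sum_all[OF ez \<beta>(3,4)] by blast
  \<comment> \<open>If the cube of the first sum is at most \<open>k1 * t\<close> and the second sum
    at most \<open>k2 * t\<close>, the bound on the kernel is \<open>2 * sqrt 2 / 3\<close> times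
    \<open>sqrt (2 * pi) * t\<close>; the factor \<open>sqrt (2 * pi)\<close> is the one in
    \<open>norm_deriv_model_space_le\<close>.\<close>
  define k1 where "k1 = sqrt (2 * pi) / 6"
  define k2 where "k2 = sqrt (2 * pi) / 3"
  have k: "0 < k1" "0 < k2" by (simp_all add: k1_def k2_def)
  define C where "C = C1 * k1 powr (- (2/3)) + C2 * k2 powr (- (2/3))"
  show ?thesis
  proof (intro exI[of _ C] conjI ballI allI impI)
    fix f and r t :: real assume f: "f \<in> model_space (blaschke_prod a I)" and r: "r \<in> {0<..<1}" and t: "0 < t"
    have fhol: "f holomorphic_on ball 0 1" using f by (simp add: model_space_def hardy_orthogonal_complement_def hardy_space_def)
    \<comment> \<open>The cube root converts the weak type 2 of the first sum into the exponent 2/3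
      of its cube.\<close>
    define s where "s = (k1 * t) powr (1/3)"
    have s: "0 < s" "s ^ 3 = k1 * t"
      using k t by (simp_all add: s_def powr_realpow[symmetric] powr_powr del: powr_realpow)
    define A1 where "A1 = angles r (\<lambda>w. \<exists>N. s < zero_sum a 1 (I \<inter> {..<N}) w)"
    define A2 where "A2 = angles r (\<lambda>w. \<exists>N. k2 * t < zero_sum a 2 (I \<inter> {..<N}) w)"
    have A: "A1 \<in> fmeasurable lebesgue" "A2 \<in> fmeasurable lebesgue"
      unfolding A1_def A2_def by (rule C1(2) C2(2); use r s k t in simp)+
    have sub: "angles r (\<lambda>w. t * hardy_norm 2 f < norm (deriv f w)) \<subseteq> A1 \<union> A2"
    proof (rule ccontr)
      assume "\<not> ?thesis"
      then obtain \<theta> where "t * hardy_norm 2 f < norm (deriv f (circ r \<theta>))"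
         "\<not> (\<exists>N. s < zero_sum a 1 (I \<inter> {..<N}) (circ r \<theta>))"
         "\<not> (\<exists>N. k2 * t < zero_sum a 2 (I \<inter> {..<N}) (circ r \<theta>))" unfolding A1_def A2_def by blast
      hence \<theta>: "t * hardy_norm 2 f < norm (deriv f (circ r \<theta>))"
         "\<And>N. zero_sum a 1 (I \<inter> {..<N}) (circ r \<theta>) \<le> s" "\<And>N. zero_sum a 2 (I \<inter> {..<N}) (circ r \<theta>) \<le> k2 * t"
        by (simp_all add: not_less)
      have z: "norm (circ r \<theta>) < 1" using r by (simp add: norm_mult)
      have "sqrt (2 * pi) * norm (deriv f (circ r \<theta>)) \<le> hardy_norm 2 f * (sqrt (2 * pi) * t)"
      proof (rule norm_deriv_model_space_le[OF f z])
        fix N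
        have "(\<Sum>n\<in>I \<inter> {..<N}. norm (deriv (malmquist a I n) (circ r \<theta>))) \<le>
          2 * sqrt 2 * (zero_sum a 1 (I \<inter> {..<N}) (circ r \<theta>)) ^ 3 + sqrt 2 * zero_sum a 2 (I \<inter> {..<N}) (circ r \<theta>)"
          by (rule sum_norm_deriv_malmquist_le) (use z in simp)
        also have "\<dots> \<le> 2 * sqrt 2 * s ^ 3 + sqrt 2 * (k2 * t)"
          by (intro add_mono mult_left_mono power_mono \<theta> zero_sum_nonneg) auto
        also have "\<dots> = (2 * sqrt 2 / 3) * (sqrt (2 * pi) * t)" unfolding s by (simp add: k1_def k2_def)
        also have "\<dots> \<le> 1 * (sqrt (2 * pi) * t)"
        proof (rule mult_right_mono)
          have "sqrt 2 \<le> 3 / 2" by (rule real_le_lsqrt) (auto simp: power2_eq_square)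
          thus "2 * sqrt 2 / 3 \<le> 1" by simp
        qed (use t in simp)
        finally show "(\<Sum>n\<in>I \<inter> {..<N}. norm (deriv (malmquist a I n) (circ r \<theta>))) \<le> sqrt (2 * pi) * t" by simp
      qed
      hence "sqrt (2 * pi) * norm (deriv f (circ r \<theta>)) \<le> sqrt (2 * pi) * (t * hardy_norm 2 f)" by (simp only: mult_ac)
      hence "norm (deriv f (circ r \<theta>)) \<le> t * hardy_norm 2 f" by (rule mult_left_le_imp_le) simp
      with \<theta>(1) show False by simp
    qed
    have "measure lebesgue (angles r (\<lambda>w. t * hardy_norm 2 f < norm (deriv f w))) \<le> measure lebesgue (A1 \<union> A2)"
      by (rule measure_mono_fmeasurable[OF sub fmeasurableD[OF fmeasurable_deriv_superlevel[OF fhol]] fmeasurable.Un[OF A]]) (use r in auto)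
    also have "\<dots> \<le> measure lebesgue A1 + measure lebesgue A2" by (rule measure_Un_le; intro fmeasurableD A)
    also have "\<dots> \<le> C1 * s powr (- (1 / (1 - 1/2))) + C2 * (k2 * t) powr (- (1 / (2 - 1/2)))"
      unfolding A1_def A2_def using r s k t by (intro add_mono C1(3) C2(3)) auto
    also have "s powr (- (1 / (1 - 1/2))) = (k1 * t) powr (- (2/3))" by (simp add: s_def powr_powr)
    also have "C1 * (k1 * t) powr (- (2/3)) + C2 * (k2 * t) powr (- (1 / (2 - 1/2))) = C * t powr (- (2/3))"
      using k t by (simp add: C_def powr_mult distrib_right)
    finally show "circle_length {\<zeta> \<in> sphere 0 1. norm (deriv f (of_real r * \<zeta>)) > t * hardy_norm 2 f} \<le> C * t powr (- (2 / 3))"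
      unfolding circle_length_Collect .
  next
    show "0 < C" unfolding C_def by (intro add_pos_pos mult_pos_pos) (use C1(1) C2(1) k in auto)
  qed
qed

end

section \<open>Zeros on a single scale\<close>

text \<open>
  The arc lies to one side of the argument of \<open>a\<close>, so that \<open>Im (cnj a * cis \<theta>)\<close> is bounded away from 0
  on it; the side is chosen such that the arc does not leave \<open>{0..<2 * pi}\<close>.
\<close>
definition zero_arc :: "real \<Rightarrow> complex \<Rightarrow> real set" where
  "zero_arc \<delta> a = (if Arg2pi a < pi then {Arg2pi a + \<delta>..Arg2pi a + 2 * \<delta>} else {Arg2pi a - 2 * \<delta>..Arg2pi a - \<delta>})"

lemma zero_arc_subset: "0 < \<delta> \<Longrightarrow> \<delta> \<le> 1 / 16 \<Longrightarrow> zero_arc \<delta> a \<subseteq> {0..<2*pi}"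
  using Arg2pi[of a] pi_gt3 by (auto simp: zero_arc_def)

lemma zero_arc_sets [measurable]: "zero_arc \<delta> a \<in> sets borel"
  by (auto simp: zero_arc_def)

lemma measure_zero_arc: "0 < \<delta> \<Longrightarrow> measure lborel (zero_arc \<delta> a) = \<delta>" "emeasure lborel (zero_arc \<delta> a) < \<infinity>"
  by (auto simp: zero_arc_def emeasure_lborel_Icc_eq)

lemma zero_arc_bounds:
  assumes "0 < \<delta>" "\<theta> \<in> zero_arc \<delta> a"
  shows "\<delta> \<le> \<bar>\<theta> - Arg2pi a\<bar>" "\<bar>\<theta> - Arg2pi a\<bar> \<le> 2 * \<delta>"
  using assms by (auto simp: zero_arc_def split: if_splits)

text \<open>The bound \<open>4 * \<delta>\<close> adds an angular and a radial distance of at most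
  \<open>2 * \<delta>\<close> each. For the imaginary part,
  \<open>norm a > 1 - 2 * \<delta> \<ge> 7/8\<close> and the sine is at least
  \<open>\<delta> / 3\<close>, which leaves \<open>7 * \<delta> / 24\<close>.\<close>

lemma zero_arc_estimates:
  assumes \<delta>: "0 < \<delta>" "\<delta> \<le> 1 / 16" and a: "\<delta> \<le> 1 - norm a" "1 - norm a < 2 * \<delta>" and \<theta>: "\<theta> \<in> zero_arc \<delta> a"
  shows "norm (1 - cnj a * cis \<theta>) \<le> 4 * \<delta>" "\<delta> / 4 \<le> \<bar>Im (cnj a * cis \<theta>)\<bar>"
proof -
  define x where "x = \<theta> - Arg2pi a"
  have x: "\<delta> \<le> \<bar>x\<bar>" "\<bar>x\<bar> \<le> 2 * \<delta>" using zero_arc_bounds[OF \<delta>(1) \<theta>] by (simp_all add: x_def)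
  have "a = of_real (norm a) * cis (Arg2pi a)" using Arg2pi_eq[of a] by (simp add: cis_conv_exp)
  hence "cnj a * cis \<theta> = cnj (of_real (norm a) * cis (Arg2pi a)) * cis \<theta>" by simp
  hence w: "cnj a * cis \<theta> = of_real (norm a) * cis x" by (simp add: cis_cnj cis_mult x_def mult_ac)
  have "1 - cnj a * cis \<theta> = (cis 0 - cis x) + of_real (1 - norm a) * cis x" unfolding w by (simp add: algebra_simps)
  also have "norm \<dots> \<le> norm (cis 0 - cis x) + norm (of_real (1 - norm a) * cis x)" by (rule norm_triangle_ineq)
  also have "norm (of_real (1 - norm a) * cis x) = 1 - norm a" using \<delta> a by (simp add: norm_mult del: of_real_diff)
  also have "norm (cis 0 - cis x) \<le> \<bar>x\<bar>"
  proof -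
    have "\<bar>sin ((0 - x) / 2)\<bar> \<le> \<bar>(0 - x) / 2\<bar>" by (rule abs_sin_x_le_abs_x)
    thus ?thesis unfolding norm_cis_diff by simp
  qed
  finally show "norm (1 - cnj a * cis \<theta>) \<le> 4 * \<delta>" using x a by simp
  have "\<bar>x\<bar> \<le> 2" using x \<delta> by simp
  hence "\<delta> / 3 \<le> \<bar>sin x\<bar>" using abs_sin_ge[of x] x by simp
  hence "(7 / 8) * (\<delta> / 3) \<le> norm a * \<bar>sin x\<bar>" using a \<delta> by (intro mult_mono) auto
  moreover have "\<bar>Im (cnj a * cis \<theta>)\<bar> = norm a * \<bar>sin x\<bar>" unfolding w by (simp add: abs_mult)
  ultimately show "\<delta> / 4 \<le> \<bar>Im (cnj a * cis \<theta>)\<bar>" using \<delta> by simp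
qed

definition multi_arc :: "(nat \<Rightarrow> complex) \<Rightarrow> nat set \<Rightarrow> real \<Rightarrow> nat \<Rightarrow> real set" where
  "multi_arc a F \<delta> k = {\<theta> \<in> {0..<2*pi}. k \<le> card {n \<in> F. \<theta> \<in> zero_arc \<delta> (a n)}}"

lemma card_eq_sum_indicator:
  assumes "finite F" shows "real (card {n \<in> F. \<theta> \<in> S n}) = (\<Sum>n\<in>F. indicator (S n) \<theta>)"
  using assms by (simp add: indicator_def sum.If_cases Int_def)

lemma multi_arc_sets:
  assumes "finite F" shows "multi_arc a F \<delta> k \<in> sets borel"
proof -
  have "multi_arc a F \<delta> k = {\<theta> \<in> {0..<2*pi}. real k \<le> (\<Sum>n\<in>F. indicator (zero_arc \<delta> (a n)) \<theta>)}"
    unfolding multi_arc_def card_eq_sum_indicator[OF assms, symmetric] by simp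
  also have "\<dots> \<in> sets borel" by measurable
  finally show ?thesis .
qed

lemma bounded_borel_finite:
  assumes "A \<in> sets borel" "A \<subseteq> {0..<2*pi}"
  shows "emeasure lborel A < \<infinity>" "measure lebesgue A = measure lborel A"
proof -
  have "emeasure lborel A \<le> emeasure lborel {0..2*pi}"
    using assms by (intro emeasure_mono) force+
  thus "emeasure lborel A < \<infinity>" by (auto simp: le_less_trans)
  show "measure lebesgue A = measure lborel A" using assms by (simp add: measure_completion)
qed

text \<open>Telescopes: with \<open>x\<close> and \<open>y\<close> the cube roots of consecutive
  integers, \<open>1 = x^3 - y^3 \<le> 3 * (x - y) * x^2\<close>.\<close>

lemma sum_cube_root_le: "(\<Sum>k=1..M. real k powr - (2/3)) \<le> 3 * real M powr (1/3)"
proof (induction M)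
  case (Suc M)
  define x y where "x = real (Suc M) powr (1/3)" and "y = real M powr (1/3)"
  have x: "x > 0" "x ^ 3 = real (Suc M)" by (simp_all add: x_def powr_realpow[symmetric] powr_powr del: powr_realpow)
  have y: "y \<ge> 0" "y ^ 3 = real M"
    by (simp add: y_def) (cases "M = 0"; simp add: y_def powr_realpow[symmetric] powr_powr del: powr_realpow)
  have yx: "y \<le> x" unfolding x_def y_def by (intro powr_mono2) auto
  have "1 = x ^ 3 - y ^ 3" using x y by simp
  also have "\<dots> = (x - y) * (x\<^sup>2 + x * y + y\<^sup>2)" by (simp add: power2_eq_square power3_eq_cube algebra_simps)
  also have "\<dots> \<le> (x - y) * (x\<^sup>2 + x * x + x\<^sup>2)"
    using x y yx by (intro mult_left_mono add_mono mult_left_mono power_mono) auto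
  also have "\<dots> = 3 * (x - y) * x\<^sup>2" by (simp add: power2_eq_square)
  finally have "1 / x\<^sup>2 \<le> 3 * (x - y)" using x by (simp only: pos_divide_le_eq zero_less_power)
  moreover have "real (Suc M) powr - (2/3) = 1 / x\<^sup>2"
    by (simp add: x_def powr_realpow[symmetric] powr_powr powr_minus_divide del: powr_realpow)
  ultimately show ?case using Suc.IH by (simp add: x_def y_def)
qed simp

lemma card_le_of_multi_arc:
  assumes F: "finite F" and \<delta>: "0 < \<delta>" "\<delta> \<le> 1 / 16" and C: "0 \<le> C"
    and A: "\<And>k. 1 \<le> k \<Longrightarrow> k \<le> card F \<Longrightarrow> measure lebesgue (multi_arc a F \<delta> k) \<le> C * \<delta> * card F powr (1/3) * k powr - (2/3)"
  shows "real (card F) \<le> (3 * C) ^ 3"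
proof (cases "F = {}")
  case False
  define M where "M = card F"
  have M: "M > 0" using F False by (simp add: M_def card_gt_0_iff)
  have As: "multi_arc a F \<delta> k \<in> sets borel" "multi_arc a F \<delta> k \<subseteq> {0..<2*pi}" for k
    using multi_arc_sets[OF F] by (auto simp: multi_arc_def)
  \<comment> \<open>Double counting: a point in exactly \<open>c\<close> arcs belongs to
    \<open>multi_arc a F \<delta> k\<close> precisely for \<open>k = 1, ..., c\<close>. This uses
    that no arc leaves \<open>{0..<2*pi}\<close>.\<close>
  have pt: "(\<Sum>n\<in>F. indicat_real (zero_arc \<delta> (a n)) \<theta>) = (\<Sum>k=1..M. indicat_real (multi_arc a F \<delta> k) \<theta>)" for \<theta>
  proof (cases "\<theta> \<in> {0..<2*pi}")
    case True
    define c where "c = card {n \<in> F. \<theta> \<in> zero_arc \<delta> (a n)}"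
    have "c \<le> M" unfolding c_def M_def by (intro card_mono F) auto
    hence "{k \<in> {1..M}. \<theta> \<in> multi_arc a F \<delta> k} = {1..c}" using True by (auto simp: multi_arc_def c_def)
    moreover have "real (card {k \<in> {1..M}. \<theta> \<in> multi_arc a F \<delta> k}) = (\<Sum>k=1..M. indicat_real (multi_arc a F \<delta> k) \<theta>)"
      by (rule card_eq_sum_indicator) simp
    ultimately show ?thesis unfolding card_eq_sum_indicator[OF F, symmetric] by (simp add: c_def)
  next
    case False
    hence "\<theta> \<notin> zero_arc \<delta> (a n)" for n using zero_arc_subset[OF \<delta>] by blast
    thus ?thesis using False by (simp add: multi_arc_def)
  qed
  have "M * \<delta> = (\<Sum>n\<in>F. measure lborel (zero_arc \<delta> (a n)))" using \<delta> by (simp add: measure_zero_arc M_def)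
  also have "\<dots> = (\<Sum>n\<in>F. \<integral>\<theta>. indicat_real (zero_arc \<delta> (a n)) \<theta> \<partial>lborel)" by simp
  also have "\<dots> = (\<integral>\<theta>. (\<Sum>n\<in>F. indicat_real (zero_arc \<delta> (a n)) \<theta>) \<partial>lborel)"
    using measure_zero_arc(2) by (intro Bochner_Integration.integral_sum[symmetric] integrable_real_indicator) auto
  also have "\<dots> = (\<integral>\<theta>. (\<Sum>k=1..M. indicat_real (multi_arc a F \<delta> k) \<theta>) \<partial>lborel)" unfolding pt ..
  also have "\<dots> = (\<Sum>k=1..M. \<integral>\<theta>. indicat_real (multi_arc a F \<delta> k) \<theta> \<partial>lborel)"
    using bounded_borel_finite(1)[OF As] As by (intro Bochner_Integration.integral_sum integrable_real_indicator) auto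
  also have "\<dots> = (\<Sum>k=1..M. measure lebesgue (multi_arc a F \<delta> k))"
    using bounded_borel_finite(2)[OF As] by simp
  also have "\<dots> \<le> (\<Sum>k=1..M. C * \<delta> * M powr (1/3) * real k powr - (2/3))"
    unfolding M_def by (intro sum_mono A) auto
  also have "\<dots> = C * \<delta> * M powr (1/3) * (\<Sum>k=1..M. real k powr - (2/3))" by (simp add: sum_distrib_left)
  also have "\<dots> \<le> C * \<delta> * M powr (1/3) * (3 * M powr (1/3))"
    using C \<delta> by (intro mult_left_mono sum_cube_root_le) auto
  finally have le: "\<delta> * M \<le> \<delta> * (3 * C * (M powr (1/3) * M powr (1/3)))" by (simp add: mult_ac)
  define y where "y = real M powr (1/3)"
  have y: "y > 0" "y ^ 3 = real M" using M by (simp_all add: y_def powr_realpow[symmetric] powr_powr del: powr_realpow)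
  have "y ^ 3 \<le> 3 * C * y\<^sup>2" using mult_left_le_imp_le[OF le \<delta>(1)] y by (simp add: y_def power2_eq_square)
  hence "y\<^sup>2 * y \<le> y\<^sup>2 * (3 * C)" by (simp add: power2_eq_square power3_eq_cube mult_ac)
  hence "y \<le> 3 * C" by (rule mult_left_le_imp_le) (use y in simp)
  hence "y ^ 3 \<le> (3 * C) ^ 3" using y by (intro power_mono) auto
  thus ?thesis using y by (simp add: M_def)
qed (use C in simp)

context blaschke_sequence
begin

text \<open>Only small scales need an argument. At a scale above \<open>\<delta>0\<close> every zero
  has \<open>1 - norm (a n) > \<delta>0\<close>, and summability bounds the number of those.\<close>

lemma exponential_zerosI:
  assumes \<delta>0: "0 < \<delta>0"
    and K: "\<And>F \<delta>. finite F \<Longrightarrow> F \<subseteq> I \<Longrightarrow> 0 < \<delta> \<Longrightarrow> \<delta> \<le> \<delta>0 \<Longrightarrow>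
       (\<And>n. n \<in> F \<Longrightarrow> \<delta> \<le> 1 - norm (a n) \<and> 1 - norm (a n) < 2 * \<delta>) \<Longrightarrow> real (card F) \<le> K"
  shows "\<exists>M. exponential_zeros a I M"
proof -
  define S where "S = (\<Sum>n. if n \<in> I then 1 - norm (a n) else 0)"
  define M where "M = nat \<lceil>max K (S / \<delta>0)\<rceil>"
  have M: "K \<le> M" "S / \<delta>0 \<le> M" unfolding M_def by linarith+
  have "card F \<le> M" if F: "finite F" "F \<subseteq> I" and \<delta>: "0 < \<delta>" and d: "\<forall>n\<in>F. \<delta> \<le> 1 - norm (a n) \<and> 1 - norm (a n) < 2 * \<delta>" for F \<delta>
  proof (cases "\<delta> \<le> \<delta>0")
    case True
    hence "real (card F) \<le> K" using F \<delta> d by (intro K) auto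
    thus ?thesis using M(1) by linarith
  next
    case False
    have "card F * \<delta>0 \<le> (\<Sum>n\<in>F. 1 - norm (a n))"
      using d False by (intro sum_bounded_below) force
    also have "\<dots> = (\<Sum>n\<in>F. if n \<in> I then 1 - norm (a n) else 0)" using F by (intro sum.cong) auto
    also have "\<dots> \<le> S" unfolding S_def
      by (intro sum_le_suminf summable_zeros F) (auto simp: less_imp_le norm_zero_lt_1)
    finally have "card F \<le> S / \<delta>0" using \<delta>0 by (simp add: pos_le_divide_eq)
    thus ?thesis using M(2) by linarith
  qed
  thus ?thesis unfolding exponential_zeros_def by blast
qed

end

section \<open>From the weak Hardy space to exponential zeros\<close>

lemma norm_deriv_le_of_bounded:
  assumes f: "f holomorphic_on ball 0 1" and b: "\<And>z. norm z < 1 \<Longrightarrow> norm (f z) \<le> 1" and z: "norm z < 1"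
  shows "norm (deriv f z) \<le> 2 / (1 - norm z)"
proof -
  define \<rho> where "\<rho> = (1 - norm z) / 2"
  have \<rho>: "0 < \<rho>" "norm z + \<rho> < 1" using z by (simp_all add: \<rho>_def field_simps)
  have in_ball: "norm x < 1" if "dist z x \<le> \<rho>" for x
  proof -
    have "norm x \<le> norm z + dist z x" using norm_triangle_ineq2[of x z] by (simp add: dist_norm norm_minus_commute)
    thus ?thesis using that \<rho> by simp
  qed
  have "norm ((deriv ^^ 1) f z) \<le> fact 1 * 1 / \<rho> ^ 1"
  proof (rule Cauchy_inequality)
    show "f holomorphic_on ball z \<rho>" by (rule holomorphic_on_subset[OF f]) (use in_ball in \<open>auto simp: less_imp_le\<close>)
    show "continuous_on (cball z \<rho>) f"
      by (rule continuous_on_subset[OF holomorphic_on_imp_continuous_on[OF f]]) (use in_ball in auto)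
    show "norm (f x) \<le> 1" if "norm (z - x) = \<rho>" for x
      by (rule b[OF in_ball]) (use that in \<open>simp add: dist_norm\<close>)
  qed (rule \<rho>)
  thus ?thesis by (simp add: \<rho>_def)
qed

text \<open>Along a radius the growth of the modulus is at most the integral of the modulus of the
  derivative; Fubini then allows the bound at each fixed radius to be used. As
  \<open>1 / sqrt (1 - \<rho>)\<close> is integrable up to 1, the result does not depend on
  \<open>s\<close>.\<close>

lemma circle_increment_integral_le:
  fixes B :: "complex \<Rightarrow> complex"
  assumes B: "B holomorphic_on ball 0 1" and r: "0 < r" "r \<le> s" "s < 1"
    and A: "A \<in> sets borel" "A \<subseteq> {0..<2*pi}" and K: "0 \<le> K"
    and bd: "\<And>\<rho>. r \<le> \<rho> \<Longrightarrow> \<rho> \<le> s \<Longrightarrow> (\<integral>\<theta>. indicator A \<theta> * norm (deriv B (circ \<rho> \<theta>)) \<partial>lborel) \<le> K / sqrt (1 - \<rho>)"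
  shows "(\<integral>\<theta>. indicator A \<theta> * (norm (B (circ s \<theta>)) - norm (B (circ r \<theta>))) \<partial>lborel) \<le> 2 * K * sqrt (1 - r)"
proof -
  define g where "g \<theta> \<rho> = norm (deriv B (circ \<rho> \<theta>))" for \<theta> \<rho> :: real
  define f where "f \<theta> \<rho> = indicator A \<theta> * (indicator {r..s} \<rho> * g \<theta> \<rho>)" for \<theta> \<rho> :: real
  have dB: "continuous_on (ball 0 1) (deriv B)" by (intro holomorphic_on_imp_continuous_on holomorphic_deriv B) auto
  have cg: "continuous_on ({0..2*pi} \<times> {r..s}) (\<lambda>p. g (fst p) (snd p))" unfolding g_def
    by (intro continuous_on_norm continuous_on_compose2[OF dB])
       (use r in \<open>auto intro!: continuous_intros simp: norm_mult\<close>)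
  have "integrable lborel (\<lambda>p. indicator ({0..2*pi} \<times> {r..s}) p *\<^sub>R g (fst p) (snd p))"
    by (rule borel_integrable_compact[OF _ cg]) (intro compact_Times compact_Icc)
  hence "integrable (lborel \<Otimes>\<^sub>M lborel) (\<lambda>p. indicator ({0..2*pi} \<times> {r..s}) p *\<^sub>R g (fst p) (snd p))"
    by (simp only: lborel_prod)
  hence "integrable (lborel \<Otimes>\<^sub>M lborel) (\<lambda>p. indicator (A \<times> UNIV) p *\<^sub>R (indicator ({0..2*pi} \<times> {r..s}) p *\<^sub>R g (fst p) (snd p)))"
    by (rule integrable_mult_indicator[rotated]) (use A in \<open>auto intro!: pair_measureI\<close>)
  also have "(\<lambda>p. indicator (A \<times> UNIV) p *\<^sub>R (indicator ({0..2*pi} \<times> {r..s}) p *\<^sub>R g (fst p) (snd p))) = case_prod f"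
    using A(2) by (fastforce simp: f_def fun_eq_iff indicator_def)
  finally have int: "integrable (lborel \<Otimes>\<^sub>M lborel) (case_prod f)" .
  have swap: "(\<integral>\<rho>. (\<integral>\<theta>. f \<theta> \<rho> \<partial>lborel) \<partial>lborel) = (\<integral>\<theta>. (\<integral>\<rho>. f \<theta> \<rho> \<partial>lborel) \<partial>lborel)"
    by (rule lborel_pair.Fubini_integral[OF int])
  have inner: "indicator A \<theta> * (norm (B (circ s \<theta>)) - norm (B (circ r \<theta>))) \<le> (\<integral>\<rho>. f \<theta> \<rho> \<partial>lborel)" for \<theta>
  proof -
    have vd: "((\<lambda>\<rho>. B (circ \<rho> \<theta>)) has_vector_derivative cis \<theta> * deriv B (circ \<rho> \<theta>)) (at \<rho> within {r..s})"
      if "r \<le> \<rho>" "\<rho> \<le> s" for \<rho>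
    proof -
      have "(B has_field_derivative deriv B (circ \<rho> \<theta>)) (at (circ \<rho> \<theta>))"
        by (rule holomorphic_derivI[OF B]) (use that r in \<open>auto simp: norm_mult\<close>)
      moreover have "((\<lambda>\<rho>. circ \<rho> \<theta>) has_vector_derivative cis \<theta>) (at \<rho>)"
        by (auto intro!: derivative_eq_intros)
      ultimately have "(B \<circ> (\<lambda>\<rho>. circ \<rho> \<theta>) has_vector_derivative cis \<theta> * deriv B (circ \<rho> \<theta>)) (at \<rho>)"
        by (intro field_vector_diff_chain_at)
      thus ?thesis unfolding o_def by (rule has_vector_derivative_at_within)
    qed
    have cont: "continuous_on {r..s} (\<lambda>\<rho>. cis \<theta> * deriv B (circ \<rho> \<theta>))"
      by (intro continuous_on_mult continuous_on_const continuous_on_compose2[OF dB])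
         (use r in \<open>auto intro!: continuous_intros simp: norm_mult\<close>)
    have "(\<integral>\<rho>. indicator {r..s} \<rho> *\<^sub>R (cis \<theta> * deriv B (circ \<rho> \<theta>)) \<partial>lborel) = B (circ s \<theta>) - B (circ r \<theta>)"
      using vd cont r by (intro integral_FTC_atLeastAtMost) auto
    moreover have "norm (\<integral>\<rho>. indicator {r..s} \<rho> *\<^sub>R (cis \<theta> * deriv B (circ \<rho> \<theta>)) \<partial>lborel) \<le>
        (\<integral>\<rho>. norm (indicator {r..s} \<rho> *\<^sub>R (cis \<theta> * deriv B (circ \<rho> \<theta>))) \<partial>lborel)"
      by (rule integral_norm_bound)
    moreover have "(\<lambda>\<rho>. norm (indicator {r..s} \<rho> *\<^sub>R (cis \<theta> * deriv B (circ \<rho> \<theta>)))) = (\<lambda>\<rho>. indicator {r..s} \<rho> * g \<theta> \<rho>)"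
      by (auto simp: fun_eq_iff g_def norm_mult indicator_def)
    ultimately have "norm (B (circ s \<theta>) - B (circ r \<theta>)) \<le> (\<integral>\<rho>. indicator {r..s} \<rho> * g \<theta> \<rho> \<partial>lborel)" by simp
    hence "norm (B (circ s \<theta>)) - norm (B (circ r \<theta>)) \<le> (\<integral>\<rho>. indicator {r..s} \<rho> * g \<theta> \<rho> \<partial>lborel)"
      using norm_triangle_ineq2 order_trans by blast
    thus ?thesis unfolding f_def by (auto simp: indicator_def)
  qed
  have Bint: "integrable lborel (\<lambda>\<theta>. indicator A \<theta> * norm (B (circ t \<theta>)))" if "0 \<le> t" "t < 1" for t
  proof -
    have "continuous_on {0..2*pi} (\<lambda>\<theta>. norm (B (circ t \<theta>)))"
      using that by (intro continuous_intros continuous_on_circle holomorphic_on_imp_continuous_on[OF B])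
    from integrable_mult_indicator[OF _ borel_integrable_compact[OF compact_Icc this], of A]
    have "integrable lborel (\<lambda>\<theta>. indicator A \<theta> *\<^sub>R (indicator {0..2*pi} \<theta> *\<^sub>R norm (B (circ t \<theta>))))" using A by simp
    also have "(\<lambda>\<theta>. indicator A \<theta> *\<^sub>R (indicator {0..2*pi} \<theta> *\<^sub>R norm (B (circ t \<theta>)))) = (\<lambda>\<theta>. indicator A \<theta> * norm (B (circ t \<theta>)))"
      using A(2) by (fastforce simp: fun_eq_iff indicator_def)
    finally show ?thesis .
  qed
  have "(\<integral>\<theta>. indicator A \<theta> * (norm (B (circ s \<theta>)) - norm (B (circ r \<theta>))) \<partial>lborel) \<le> (\<integral>\<theta>. (\<integral>\<rho>. f \<theta> \<rho> \<partial>lborel) \<partial>lborel)"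
  proof (rule integral_mono[OF _ _ inner])
    show "integrable lborel (\<lambda>\<theta>. indicator A \<theta> * (norm (B (circ s \<theta>)) - norm (B (circ r \<theta>))))"
      unfolding right_diff_distrib using r by (intro Bochner_Integration.integrable_diff Bint) auto
    show "integrable lborel (\<lambda>\<theta>. \<integral>\<rho>. f \<theta> \<rho> \<partial>lborel)" by (rule lborel_pair.integrable_fst[OF int])
  qed
  also have "\<dots> = (\<integral>\<rho>. (\<integral>\<theta>. f \<theta> \<rho> \<partial>lborel) \<partial>lborel)" using swap ..
  also have "\<dots> \<le> (\<integral>\<rho>. indicator {r..s} \<rho> *\<^sub>R (K / sqrt (1 - \<rho>)) \<partial>lborel)"
  proof (rule integral_mono)
    show "integrable lborel (\<lambda>\<rho>. \<integral>\<theta>. f \<theta> \<rho> \<partial>lborel)" by (rule lborel_pair.integrable_snd[OF int])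
    show "integrable lborel (\<lambda>\<rho>. indicator {r..s} \<rho> *\<^sub>R (K / sqrt (1 - \<rho>)))"
      by (rule borel_integrable_compact) (use r in \<open>auto intro!: continuous_intros\<close>)
    fix \<rho> :: real
    have "(\<integral>\<theta>. f \<theta> \<rho> \<partial>lborel) = indicator {r..s} \<rho> * (\<integral>\<theta>. indicator A \<theta> * g \<theta> \<rho> \<partial>lborel)"
      unfolding f_def by (simp add: mult.left_commute[of "indicator A _"])
    also have "\<dots> \<le> indicator {r..s} \<rho> *\<^sub>R (K / sqrt (1 - \<rho>))"
      using bd[of \<rho>] by (auto simp: indicator_def g_def)
    finally show "(\<integral>\<theta>. f \<theta> \<rho> \<partial>lborel) \<le> indicator {r..s} \<rho> *\<^sub>R (K / sqrt (1 - \<rho>))" .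
  qed
  also have "\<dots> = (- 2 * K * sqrt (1 - s)) - (- 2 * K * sqrt (1 - r))"
  proof (rule integral_FTC_atLeastAtMost)
    fix \<rho> assume \<rho>: "r \<le> \<rho>" "\<rho> \<le> s"
    have "((\<lambda>\<rho>. - 2 * K * sqrt (1 - \<rho>)) has_real_derivative K / sqrt (1 - \<rho>)) (at \<rho> within {r..s})"
    proof -
      have "((\<lambda>\<rho>. 1 - \<rho>) has_real_derivative 0 - 1) (at \<rho> within {r..s})"
        by (intro DERIV_diff DERIV_const DERIV_ident)
      moreover have "(sqrt has_real_derivative inverse (sqrt (1 - \<rho>)) / 2) (at (1 - \<rho>))"
        by (rule DERIV_real_sqrt) (use r \<rho> in simp)
      ultimately have "((\<lambda>\<rho>. sqrt (1 - \<rho>)) has_real_derivative inverse (sqrt (1 - \<rho>)) / 2 * (0 - 1)) (at \<rho> within {r..s})"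
        by (rule DERIV_chain2[rotated])
      hence "((\<lambda>\<rho>. - 2 * K * sqrt (1 - \<rho>)) has_real_derivative - 2 * K * (inverse (sqrt (1 - \<rho>)) / 2 * (0 - 1))) (at \<rho> within {r..s})"
        by (rule DERIV_cmult)
      moreover have "- 2 * K * (inverse u / 2 * (0 - 1)) = K / u" for u :: real by (simp add: inverse_eq_divide)
      ultimately show ?thesis by (simp only:)
    qed
    thus "((\<lambda>\<rho>. - 2 * K * sqrt (1 - \<rho>)) has_vector_derivative K / sqrt (1 - \<rho>)) (at \<rho> within {r..s})"
      by (simp add: has_real_derivative_iff_has_vector_derivative)
  qed (use r in \<open>auto intro!: continuous_intros\<close>)
  also have "\<dots> \<le> 2 * K * sqrt (1 - r)" using K r by simp
  finally show ?thesis .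
qed

context blaschke_sequence
begin

text \<open>Stands in for boundary modulus 1 almost everywhere. A finite partial product is
  uniformly close to modulus 1 near the circle; the remaining product \<open>R\<close> has
  \<open>norm (R 0)\<close> close to 1, because a product of numbers \<open>1 - d n\<close> is at
  least \<open>1 - (\<Sum>n. d n)\<close>, and by the mean value property its mean modulus is at
  least \<open>norm (R 0)\<close>.\<close>

lemma blaschke_prod_circle_defect:
  assumes e: "0 < e"
  shows "\<exists>r0<1. \<forall>r. r0 < r \<longrightarrow> 0 < r \<longrightarrow> r < 1 \<longrightarrow> circle_integral r (\<lambda>w. 1 - norm (blaschke_prod a I w)) \<le> e"
proof -
  define d where "d n = (if n \<in> I then 1 - norm (a n) else 0)" for n
  \<comment> \<open>Two defects of size \<open>e'\<close>, one from \<open>P\<close> and one from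
    \<open>R\<close>, are integrated over length \<open>2 * pi\<close>.\<close>
  define e' where "e' = e / (4 * pi)"
  have e': "0 < e'" "2 * pi * e' + 2 * pi * e' = e" using e by (simp_all add: e'_def)
  have sd: "summable d" unfolding d_def by (rule summable_zeros)
  obtain N where N: "norm (\<Sum>i. d (i + N)) < e'" using suminf_exist_split[OF e'(1) sd] by blast
  define P where "P = bprod a (I \<inter> {..<N})"
  define J where "J = I - I \<inter> {..<N}"
  define R where "R = blaschke_prod a J"
  interpret J: blaschke_sequence a J by (rule blaschke_sequence_subset) (auto simp: J_def)
  have split: "blaschke_prod a I z = P z * R z" if "norm z < 1" for z
    unfolding P_def R_def J_def by (rule blaschke_prod_split) (use that in auto)
  have R0: "1 - e' \<le> norm (R 0)"
  proof (rule tendsto_lowerbound)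
    show "(\<lambda>K. norm (bprod a (J \<inter> {..<K}) 0)) \<longlonglongrightarrow> norm (R 0)"
      unfolding R_def by (intro tendsto_norm J.bprod_tendsto) simp
    have "1 - e' \<le> norm (bprod a (J \<inter> {..<K}) 0)" for K
    proof -
      have "(\<Sum>n\<in>J \<inter> {..<K}. 1 - norm (a n)) = (\<Sum>n\<in>J \<inter> {..<K}. d n)" by (intro sum.cong) (auto simp: J_def d_def)
      also have "\<dots> \<le> (\<Sum>n\<in>{N..<N + K}. d n)"
        by (intro sum_mono2) (auto simp: J_def d_def less_imp_le norm_zero_lt_1)
      also have "\<dots> = (\<Sum>i<K. d (i + N))"
        using sum.shift_bounds_nat_ivl[of d 0 N K] by (simp add: add.commute atLeast0LessThan)
      also have "\<dots> \<le> (\<Sum>i. d (i + N))"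
        by (rule sum_le_suminf[OF summable_ignore_initial_segment[OF sd]]) (auto simp: d_def less_imp_le norm_zero_lt_1)
      finally have "(\<Sum>n\<in>J \<inter> {..<K}. 1 - norm (a n)) \<le> e'" using N by simp
      moreover have "1 - (\<Sum>n\<in>J \<inter> {..<K}. 1 - norm (a n)) \<le> (\<Prod>n\<in>J \<inter> {..<K}. 1 - (1 - norm (a n)))"
        by (rule Weierstrass_prod_ineq) (auto simp: less_imp_le J.norm_zero_lt_1)
      ultimately show ?thesis by (simp add: bprod_def prod_norm[symmetric])
    qed
    thus "\<forall>\<^sub>F K in sequentially. 1 - e' \<le> norm (bprod a (J \<inter> {..<K}) 0)" by simp
  qed simp
  have Pcont: "continuous_on (cball 0 1) P" unfolding P_def
    by (intro holomorphic_on_imp_continuous_on bprod_holomorphic initial_zeros) auto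
  hence "uniformly_continuous_on (cball 0 1) P" by (rule compact_uniformly_continuous) simp
  then obtain \<eta> where \<eta>: "\<eta> > 0" "\<And>x x'. norm x \<le> 1 \<Longrightarrow> norm x' \<le> 1 \<Longrightarrow> dist x' x < \<eta> \<Longrightarrow> dist (P x') (P x) < e'"
    using e'(1) unfolding uniformly_continuous_on_def by (metis mem_cball_0)
  show ?thesis
  proof (intro exI[of _ "1 - \<eta>"] conjI allI impI)
    show "1 - \<eta> < 1" using \<eta> by simp
    fix r :: real assume r: "1 - \<eta> < r" "0 < r" "r < 1"
    have z: "norm (circ r \<theta>) < 1" for \<theta> using r by (simp add: norm_mult)
    have P1: "1 - norm (P (circ r \<theta>)) \<le> e'" for \<theta>
    proof -
      have "dist (P (circ r \<theta>)) (P (cis \<theta>)) < e'" using r z[of \<theta>] dist_circ_cis[of r \<theta>] by (intro \<eta>) auto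
      moreover have "norm (P (cis \<theta>)) = 1" unfolding P_def by (intro norm_bprod_eq_1 initial_zeros) auto
      ultimately show ?thesis
        using norm_triangle_ineq3[of "P (circ r \<theta>)" "P (cis \<theta>)"] by (simp add: dist_norm)
    qed
    have Rcont: "continuous_on S (\<lambda>\<theta>. R (circ r \<theta>))" for S unfolding R_def
      by (intro continuous_on_circle holomorphic_on_imp_continuous_on J.blaschke_prod_holomorphic) (use r in auto)
    have Bcont: "continuous_on S (\<lambda>\<theta>. blaschke_prod a I (circ r \<theta>))" for S
      by (intro continuous_on_circle holomorphic_on_imp_continuous_on blaschke_prod_holomorphic) (use r in auto)
    have "circle_integral r (\<lambda>w. 1 - norm (blaschke_prod a I w)) \<le>
       circle_integral r (\<lambda>w. (1 + e') - norm (R w))"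
    proof (rule integral_le)
      fix \<theta>
      define p q where "p = norm (P (circ r \<theta>))" and "q = norm (R (circ r \<theta>))"
      have "p \<le> 1" unfolding p_def P_def by (intro norm_bprod_le_1 initial_zeros) (use z[of \<theta>] in auto)
      moreover have "q \<le> 1" unfolding q_def R_def by (rule J.norm_blaschke_prod_le_1[OF z])
      ultimately have "0 \<le> (1 - p) * (1 - q)" by (intro mult_nonneg_nonneg) auto
      hence "1 - p * q \<le> (1 - p) + (1 - q)" by (simp add: algebra_simps)
      moreover have "norm (blaschke_prod a I (circ r \<theta>)) = p * q" unfolding split[OF z] norm_mult p_def q_def ..
      ultimately show "1 - norm (blaschke_prod a I (circ r \<theta>)) \<le> (1 + e') - norm (R (circ r \<theta>))"
        using P1[of \<theta>] by (simp add: p_def q_def)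
    qed (intro integrable_continuous_real continuous_intros Rcont Bcont)+
    also have "\<dots> = 2 * pi * (1 + e') - circle_integral r (\<lambda>w. norm (R w))"
      by (subst integral_diff) (auto intro!: integrable_continuous_real continuous_intros Rcont)
    also have "\<dots> \<le> 2 * pi * (1 + e') - 2 * pi * (1 - e')"
    proof -
      have "2 * pi * (1 - e') \<le> 2 * pi * norm (R 0)" by (intro mult_left_mono R0) simp
      also have "\<dots> = norm (circle_integral r (\<lambda>w. R w))"
        unfolding R_def by (subst integral_circle_mean_value[OF J.blaschke_prod_holomorphic r(2,3)]) (simp add: norm_mult)
      also have "\<dots> \<le> circle_integral r (\<lambda>w. norm (R w))"
        by (intro integral_norm_bound_integral integrable_continuous_real continuous_intros Rcont) auto
      finally show ?thesis by simp
    qed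
    also have "\<dots> = e" using e'(2) by (simp add: algebra_simps)
    finally show "circle_integral r (\<lambda>w. 1 - norm (blaschke_prod a I w)) \<le> e" .
  qed
qed

text \<open>
  Since \<open>\<bar>B'\<bar> \<le> 2 / (1 - \<rho>)\<close>, the weak-type bound at level \<open>h\<close> gives
  \<open>\<integral>\<^sub>A \<bar>B'\<bar> \<le> h \<bar>A\<bar> + 2 C / (h (1 - \<rho>))\<close> at radius \<open>\<rho>\<close>; the best \<open>h\<close> makes this integrable in \<open>\<rho>\<close> up to 1.
\<close>
lemma measure_defect_le:
  assumes C: "0 < C"
    and weak: "\<And>r t. 0 < r \<Longrightarrow> r < 1 \<Longrightarrow> 0 < t \<Longrightarrow>
       measure lebesgue (angles r (\<lambda>w. t < norm (deriv (blaschke_prod a I) w))) \<le> C * t powr - 1"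
    and A: "A \<in> sets borel" "A \<subseteq> {0..<2*pi}" and r: "0 < r" "r < 1" and c: "0 < c"
    and defect: "\<And>\<theta>. \<theta> \<in> A \<Longrightarrow> norm (blaschke_prod a I (circ r \<theta>)) \<le> 1 - c"
  shows "measure lebesgue A \<le> 32 * C * (1 - r) / c\<^sup>2"
proof (cases "measure lborel A = 0")
  case True
  thus ?thesis using bounded_borel_finite(2)[OF A] C r by simp
next
  case False
  define B where "B = blaschke_prod a I"
  define m where "m = measure lborel A"
  have m: "m > 0" using False measure_nonneg[of lborel A] by (simp add: m_def less_le)
  have Bhol: "B holomorphic_on ball 0 1" unfolding B_def by (rule blaschke_prod_holomorphic)
  have Ble: "norm (B z) \<le> 1" if "norm z < 1" for z unfolding B_def by (rule norm_blaschke_prod_le_1[OF that])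
  have Aint: "integrable lborel (indicat_real A)" using bounded_borel_finite(1)[OF A] A by (intro integrable_real_indicator) auto
  define K where "K = 2 * sqrt (2 * C * m)"
  have K: "0 \<le> K" using C m by (simp add: K_def)
  have bd: "(\<integral>\<theta>. indicator A \<theta> * norm (deriv B (circ \<rho> \<theta>)) \<partial>lborel) \<le> K / sqrt (1 - \<rho>)" if \<rho>: "0 < \<rho>" "\<rho> < 1" for \<rho>
  proof -
    \<comment> \<open>The minimiser of \<open>h * m + 2 * C / (h * (1 - \<rho>))\<close>: both
      summands become equal, and together they are \<open>K / sqrt (1 - \<rho>)\<close>.\<close>
    define h where "h = sqrt (2 * C / (m * (1 - \<rho>)))"
    have h: "h > 0" using C m \<rho> by (simp add: h_def)
    define g where "g \<theta> = norm (deriv B (circ \<rho> \<theta>))" for \<theta>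
    define E where "E = {\<theta> \<in> {0..<2*pi}. h < g \<theta>}"
    have gc: "continuous_on UNIV g" unfolding g_def
      by (intro continuous_intros continuous_on_circle holomorphic_on_imp_continuous_on holomorphic_deriv Bhol) (use \<rho> in auto)
    have E: "E \<in> sets borel" "E \<subseteq> {0..<2*pi}" using measurable_continuous_superlevel(1)[OF gc] by (auto simp: E_def)
    have Eint: "integrable lborel (indicat_real E)" using bounded_borel_finite(1)[OF E] E by (intro integrable_real_indicator) auto
    have "(\<integral>\<theta>. indicator A \<theta> * g \<theta> \<partial>lborel) \<le> (\<integral>\<theta>. h * indicator A \<theta> + 2 / (1 - \<rho>) * indicator E \<theta> \<partial>lborel)"
    proof (rule integral_mono_AE)
      have gm: "g \<in> borel_measurable borel" by (rule borel_measurable_continuous_onI[OF gc])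
      have gle: "g \<theta> \<le> 2 / (1 - \<rho>)" for \<theta>
        using norm_deriv_le_of_bounded[OF Bhol Ble, of "circ \<rho> \<theta>"] \<rho> by (simp add: g_def norm_mult)
      show "integrable lborel (\<lambda>\<theta>. indicator A \<theta> * g \<theta>)"
      proof (rule Bochner_Integration.integrable_bound)
        show "integrable lborel (\<lambda>\<theta>. 2 / (1 - \<rho>) * indicat_real A \<theta>)" using Aint by simp
        show "(\<lambda>\<theta>. indicat_real A \<theta> * g \<theta>) \<in> borel_measurable lborel" using gm A(1) by simp
        show "AE \<theta> in lborel. norm (indicat_real A \<theta> * g \<theta>) \<le> norm (2 / (1 - \<rho>) * indicat_real A \<theta>)"
          using gle \<rho> by (intro AE_I2) (auto simp: indicator_def g_def)
      qed
      show "integrable lborel (\<lambda>\<theta>. h * indicat_real A \<theta> + 2 / (1 - \<rho>) * indicat_real E \<theta>)" using Aint Eint by simp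
      show "AE \<theta> in lborel. indicat_real A \<theta> * g \<theta> \<le> h * indicat_real A \<theta> + 2 / (1 - \<rho>) * indicat_real E \<theta>"
      proof (rule AE_I2)
        fix \<theta>
        show "indicat_real A \<theta> * g \<theta> \<le> h * indicat_real A \<theta> + 2 / (1 - \<rho>) * indicat_real E \<theta>"
        proof (cases "\<theta> \<in> A")
          case True
          show ?thesis
          proof (cases "\<theta> \<in> E")
            case True
            show ?thesis using gle[of \<theta>] h \<open>\<theta> \<in> A\<close> True by simp
          next
            case False
            hence "g \<theta> \<le> h" using A(2) \<open>\<theta> \<in> A\<close> by (auto simp: E_def not_less)
            thus ?thesis using \<open>\<theta> \<in> A\<close> False by simp
          qed
        next
          case False
          thus ?thesis using \<rho> by (simp add: indicator_def)
        qed
      qed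
    qed
    also have "\<dots> = h * m + 2 / (1 - \<rho>) * measure lborel E"
      using Aint Eint by (simp add: m_def)
    also have "\<dots> \<le> h * m + 2 / (1 - \<rho>) * (C / h)"
    proof -
      have "measure lborel E \<le> C / h"
      proof -
        have "measure lebesgue E \<le> C * h powr - 1" using weak[OF \<rho> h] unfolding E_def g_def B_def .
        also have "h powr - 1 = 1 / h" using h by (simp add: powr_minus_divide)
        finally show ?thesis unfolding bounded_borel_finite(2)[OF E] by simp
      qed
      thus ?thesis using \<rho> by (intro add_left_mono mult_left_mono) auto
    qed
    also have "\<dots> = K / sqrt (1 - \<rho>)"
    proof -
      define x where "x = 1 - \<rho>"
      have x: "x > 0" using \<rho> by (simp add: x_def)
      have hh: "h * h = 2 * C / (m * x)" using C m x by (simp add: h_def x_def)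
      have "2 / x * (C / h) = h * m"
      proof -
        have "h * m * h = (h * h) * m" by (simp only: mult_ac)
        also have "\<dots> = 2 * C / x" unfolding hh using m by simp
        finally have "h * m * h = 2 * C / x" .
        thus ?thesis using h x by (simp add: field_simps)
      qed
      moreover have "K / sqrt x = 2 * (h * m)"
      proof -
        have "h * m = sqrt (2 * C / (m * x)) * sqrt (m * m)" using m by (simp add: h_def x_def)
        also have "\<dots> = sqrt (2 * C / (m * x) * (m * m))" by (rule real_sqrt_mult[symmetric])
        also have "2 * C / (m * x) * (m * m) = 2 * C * m / x" using m by simp
        finally show ?thesis by (simp only: K_def real_sqrt_divide times_divide_eq_right)
      qed
      ultimately show ?thesis by (simp add: x_def)
    qed
    finally show ?thesis by (simp add: g_def)
  qed
  have "c * m \<le> 2 * K * sqrt (1 - r)"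
  proof (rule field_le_epsilon)
    fix e :: real assume e: "0 < e"
    obtain r0 where r0: "r0 < 1" "\<And>r. r0 < r \<Longrightarrow> 0 < r \<Longrightarrow> r < 1 \<Longrightarrow> circle_integral r (\<lambda>w. 1 - norm (B w)) \<le> e"
      using blaschke_prod_circle_defect[OF e] unfolding B_def by blast
    obtain s where s: "max r0 r < s" "s < 1" using dense[of "max r0 r" 1] r0 r by auto
    have s': "r0 < s" "r \<le> s" "0 < s" using s r by auto
    have cs: "continuous_on S (\<lambda>\<theta>. norm (B (circ t \<theta>)))" if "0 < t" "t < 1" for t S
      using that by (intro continuous_intros continuous_on_circle holomorphic_on_imp_continuous_on[OF Bhol]) auto
    have int: "integrable lborel (\<lambda>\<theta>. indicator A \<theta> * norm (B (circ t \<theta>)))" if t: "0 < t" "t < 1" for t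
    proof (rule Bochner_Integration.integrable_bound[OF Aint])
      show "(\<lambda>\<theta>. indicat_real A \<theta> * norm (B (circ t \<theta>))) \<in> borel_measurable lborel"
        using borel_measurable_continuous_onI[OF cs[OF t]] A(1) by simp
      show "AE \<theta> in lborel. norm (indicat_real A \<theta> * norm (B (circ t \<theta>))) \<le> norm (indicat_real A \<theta>)"
        using Ble t by (intro AE_I2) (auto simp: indicator_def norm_mult)
    qed
    have "c * m = (\<integral>\<theta>. c * indicator A \<theta> \<partial>lborel)" using Aint by (simp add: m_def)
    also have "\<dots> \<le> (\<integral>\<theta>. indicator A \<theta> - indicator A \<theta> * norm (B (circ r \<theta>)) \<partial>lborel)"
    proof (rule integral_mono)
      show "integrable lborel (\<lambda>\<theta>. c * indicat_real A \<theta>)" using Aint by simp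
      show "integrable lborel (\<lambda>\<theta>. indicat_real A \<theta> - indicat_real A \<theta> * norm (B (circ r \<theta>)))"
        by (intro Bochner_Integration.integrable_diff Aint int r)
      fix \<theta>
      show "c * indicat_real A \<theta> \<le> indicat_real A \<theta> - indicat_real A \<theta> * norm (B (circ r \<theta>))"
        using defect[of \<theta>] by (cases "\<theta> \<in> A") (auto simp: B_def)
    qed
    \<comment> \<open>The defect at radius \<open>r\<close> is the defect at \<open>s\<close>, which
      is at most \<open>e\<close> because \<open>s\<close> is close to 1, plus the increment of the
      modulus from \<open>r\<close> to \<open>s\<close>.\<close>
    also have "\<dots> = (\<integral>\<theta>. (indicator A \<theta> - indicator A \<theta> * norm (B (circ s \<theta>))) + indicator A \<theta> * (norm (B (circ s \<theta>)) - norm (B (circ r \<theta>))) \<partial>lborel)"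
      by (simp add: algebra_simps)
    also have "\<dots> = (\<integral>\<theta>. (indicator A \<theta> - indicator A \<theta> * norm (B (circ s \<theta>))) \<partial>lborel) + (\<integral>\<theta>. indicator A \<theta> * (norm (B (circ s \<theta>)) - norm (B (circ r \<theta>))) \<partial>lborel)"
      unfolding right_diff_distrib
      by (intro Bochner_Integration.integral_add Bochner_Integration.integrable_diff Aint int) (use s s' r in auto)
    also have "\<dots> \<le> e + 2 * K * sqrt (1 - r)"
    proof (rule add_mono)
      show "(\<integral>\<theta>. indicator A \<theta> * (norm (B (circ s \<theta>)) - norm (B (circ r \<theta>))) \<partial>lborel) \<le> 2 * K * sqrt (1 - r)"
        by (rule circle_increment_integral_le[OF Bhol r(1) s'(2) s(2) A K bd]) (use r s in auto)
      have c1: "continuous_on {0..2*pi} (\<lambda>\<theta>. 1 - norm (B (circ s \<theta>)))"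
        by (intro continuous_intros cs) (use s s' in auto)
      have "(\<integral>\<theta>. indicator A \<theta> - indicator A \<theta> * norm (B (circ s \<theta>)) \<partial>lborel)
         \<le> (\<integral>\<theta>. indicator {0..2*pi} \<theta> *\<^sub>R (1 - norm (B (circ s \<theta>))) \<partial>lborel)"
      proof (rule integral_mono)
        show "integrable lborel (\<lambda>\<theta>. indicator A \<theta> - indicator A \<theta> * norm (B (circ s \<theta>)))"
          by (intro Bochner_Integration.integrable_diff Aint int) (use s s' in auto)
        show "integrable lborel (\<lambda>\<theta>. indicator {0..2*pi} \<theta> *\<^sub>R (1 - norm (B (circ s \<theta>))))"
          by (rule borel_integrable_compact[OF compact_Icc c1])
        fix \<theta>
        have "norm (B (circ s \<theta>)) \<le> 1" by (rule Ble) (use s s' in \<open>simp add: norm_mult\<close>)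
        thus "indicator A \<theta> - indicator A \<theta> * norm (B (circ s \<theta>)) \<le> indicator {0..2*pi} \<theta> *\<^sub>R (1 - norm (B (circ s \<theta>)))"
          using A(2) by (fastforce simp: indicator_def)
      qed
      also have "\<dots> = circle_integral s (\<lambda>w. 1 - norm (B w))"
        using set_borel_integral_eq_integral(2)[OF borel_integrable_atLeastAtMost'[OF c1]] by (simp add: set_lebesgue_integral_def)
      also have "\<dots> \<le> e" by (rule r0(2)) (use s s' in auto)
      finally show "(\<integral>\<theta>. indicator A \<theta> - indicator A \<theta> * norm (B (circ s \<theta>)) \<partial>lborel) \<le> e" .
    qed
    finally show "c * m \<le> 2 * K * sqrt (1 - r) + e" by simp
  qed
  \<comment> \<open>\<open>K\<close> contains \<open>sqrt m\<close>, so the estimate is a bound for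
    \<open>sqrt m\<close>; squaring it leaves one factor \<open>m\<close> to cancel.\<close>
  hence "(c * m)\<^sup>2 \<le> (2 * K * sqrt (1 - r))\<^sup>2" using c m by (intro power_mono) auto
  also have "\<dots> = 32 * C * (1 - r) * m" using r C m by (simp add: K_def power_mult_distrib)
  finally have "m * (c\<^sup>2 * m) \<le> m * (32 * C * (1 - r))" by (simp add: power2_eq_square mult_ac)
  hence "c\<^sup>2 * m \<le> 32 * C * (1 - r)" by (rule mult_left_le_imp_le) (rule m)
  hence "m \<le> 32 * C * (1 - r) / c\<^sup>2" using c by (simp add: pos_le_divide_eq mult.commute)
  thus ?thesis using bounded_borel_finite(2)[OF A] by (simp add: m_def)
qed

lemma weak_hardy_imp_exponential_zeros:
  assumes C: "0 < C"
    and weak: "\<And>r t. 0 < r \<Longrightarrow> r < 1 \<Longrightarrow> 0 < t \<Longrightarrow>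
       measure lebesgue (angles r (\<lambda>w. t < norm (deriv (blaschke_prod a I) w))) \<le> C * t powr - 1"
  shows "\<exists>M. exponential_zeros a I M"
proof -
  \<comment> \<open>At radius \<open>1 - \<delta> / k\<close> each zero whose arc contains the angle
    gives a factor of squared modulus at most \<open>1 - 1 / (25 * k)\<close>. Then \<open>k\<close>
    of them give modulus at most \<open>exp (- (1/50))\<close>, independently of
    \<open>k\<close>.\<close>
  define c where "c = 1 - exp (- (1/50::real))"
  have c: "0 < c" by (simp add: c_def)
  define C' where "C' = 32 * C / c\<^sup>2"
  have C': "0 \<le> C'" using C by (simp add: C'_def)
  show ?thesis
  proof (rule exponential_zerosI)
    show "0 < (1/16 :: real)" by simp
    fix F \<delta> assume F: "finite F" "F \<subseteq> I" and \<delta>: "0 < \<delta>" "\<delta> \<le> (1/16::real)"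
      and d: "\<And>n. n \<in> F \<Longrightarrow> \<delta> \<le> 1 - norm (a n) \<and> 1 - norm (a n) < 2 * \<delta>"
    show "real (card F) \<le> (3 * C') ^ 3"
    proof (rule card_le_of_multi_arc[OF F(1) \<delta> C', of a])
      fix k assume k: "1 \<le> k" "k \<le> card F"
      define r where "r = 1 - \<delta> / k"
      have dk: "0 < \<delta> / k" "\<delta> / k \<le> \<delta>" using \<delta> k by (auto simp: divide_le_eq)
      have r: "0 < r" "r < 1" using dk \<delta> by (auto simp: r_def)
      have A: "multi_arc a F \<delta> k \<in> sets borel" "multi_arc a F \<delta> k \<subseteq> {0..<2*pi}"
        using multi_arc_sets[OF F(1)] by (auto simp: multi_arc_def)
      have "measure lebesgue (multi_arc a F \<delta> k) \<le> 32 * C * (1 - r) / c\<^sup>2"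
      proof (rule measure_defect_le[OF C weak A r c])
        fix \<theta> assume \<theta>: "\<theta> \<in> multi_arc a F \<delta> k"
        define z where "z = circ r \<theta>"
        have z: "norm z = r" using r by (simp add: z_def norm_mult)
        define G where "G = {n \<in> F. \<theta> \<in> zero_arc \<delta> (a n)}"
        have G: "finite G" "G \<subseteq> I" "k \<le> card G" using F \<theta> by (auto simp: G_def multi_arc_def)
        have b: "(norm (blaschke_factor (a n) z))\<^sup>2 \<le> exp (- (1 / (25 * k)))" if n: "n \<in> G" for n
        proof -
          have nF: "n \<in> F" using n by (simp add: G_def)
          have an: "norm (a n) < 1" using norm_zero_lt_1 nF F by auto
          define p where "p = norm (1 - cnj (a n) * z)"
          \<comment> \<open>The radial step of length \<open>\<delta> / k \<le> \<delta>\<close>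
            enlarges the distance \<open>4 * \<delta>\<close> on the circle to at most
            \<open>5 * \<delta>\<close>, the origin of the 25.\<close>
          have "1 - cnj (a n) * z = (1 - cnj (a n) * cis \<theta>) + of_real (1 - r) * (cnj (a n) * cis \<theta>)"
            by (simp add: z_def algebra_simps)
          hence "p \<le> norm (1 - cnj (a n) * cis \<theta>) + norm (of_real (1 - r) * (cnj (a n) * cis \<theta>))"
            unfolding p_def using norm_triangle_ineq by metis
          also have "norm (of_real (1 - r) * (cnj (a n) * cis \<theta>)) = (1 - r) * norm (a n)"
            using r by (simp add: norm_mult del: of_real_diff)
          also have "\<dots> \<le> \<delta> * 1" using an dk by (intro mult_mono) (auto simp: r_def)
          also have "norm (1 - cnj (a n) * cis \<theta>) \<le> 4 * \<delta>"
            using zero_arc_estimates(1)[OF \<delta>, of "a n" \<theta>] d[OF nF] n by (simp add: G_def)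
          finally have p5: "p \<le> 5 * \<delta>" by simp
          have p0: "0 < p" using one_minus_cnj_mult_nz[OF an, of z] z r by (simp add: p_def)
          have "(\<delta> / k) * (\<delta> / (5 * \<delta>)\<^sup>2) \<le> (1 - r\<^sup>2) * ((1 - (norm (a n))\<^sup>2) / p\<^sup>2)"
          proof (intro mult_mono frac_le)
            have "1 - r\<^sup>2 = (1 - r) * (1 + r)" by (simp add: power2_eq_square algebra_simps)
            moreover have "(1 - r) * 1 \<le> (1 - r) * (1 + r)" using r by (intro mult_left_mono) auto
            ultimately show "\<delta> / k \<le> 1 - r\<^sup>2" by (simp add: r_def)
            have "1 - norm (a n) \<le> 1 - (norm (a n))\<^sup>2" using an by (simp add: power2_eq_square mult_left_le)
            thus "\<delta> \<le> 1 - (norm (a n))\<^sup>2" using d[OF nF] by linarith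
            show "p\<^sup>2 \<le> (5 * \<delta>)\<^sup>2" using p5 p0 by (intro power_mono) auto
          qed (use \<delta> p0 dk r an in \<open>auto simp: power_le_one\<close>)
          also have "\<dots> = 1 - (norm (blaschke_factor (a n) z))\<^sup>2"
            using one_minus_norm_blaschke_factor_sq[OF an, of z] z r by (simp add: p_def)
          also have "(\<delta> / k) * (\<delta> / (5 * \<delta>)\<^sup>2) = 1 / (25 * k)" using \<delta> by (simp add: power2_eq_square)
          finally have "(norm (blaschke_factor (a n) z))\<^sup>2 \<le> 1 + - (1 / (25 * k))" by simp
          also have "\<dots> \<le> exp (- (1 / (25 * k)))" by (rule exp_ge_add_one_self)
          finally show ?thesis .
        qed
        have "(norm (bprod a G z))\<^sup>2 = (\<Prod>n\<in>G. (norm (blaschke_factor (a n) z))\<^sup>2)"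
          by (simp add: bprod_def prod_norm[symmetric] prod_power_distrib)
        also have "\<dots> \<le> (\<Prod>n\<in>G. exp (- (1 / (25 * k))))" using b by (intro prod_mono) auto
        also have "\<dots> = exp (- (card G / (25 * k)))" by (simp add: exp_of_nat_mult[symmetric])
        also have "\<dots> \<le> exp (- (1 / 25))"
        proof -
          have "1 / 25 \<le> card G / (25 * k)" using G(3) k by (simp add: field_simps)
          thus ?thesis by simp
        qed
        also have "\<dots> = (exp (- (1/50)))\<^sup>2" by (simp add: exp_double[symmetric])
        finally have bG: "norm (bprod a G z) \<le> exp (- (1/50))" by (rule power2_le_imp_le) simp
        interpret J: blaschke_sequence a "I - G" by (rule blaschke_sequence_subset) auto
        have "norm (blaschke_prod a I z) = norm (bprod a G z) * norm (blaschke_prod a (I - G) z)"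
          using blaschke_prod_split[OF G(1,2), of z] z r by (simp add: norm_mult)
        also have "\<dots> \<le> norm (bprod a G z)" using J.norm_blaschke_prod_le_1[of z] z r by (intro mult_left_le) auto
        finally show "norm (blaschke_prod a I (circ r \<theta>)) \<le> 1 - c" using bG by (simp add: c_def z_def)
      qed auto
      also have "\<dots> = C' * \<delta> * (1 / k)" by (simp add: C'_def r_def)
      \<comment> \<open>Deliberate weakening of \<open>1 / k\<close>, using
        \<open>1 \<le> k \<le> card F\<close>, to the form that \<open>card_le_of_multi_arc\<close>
        expects.\<close>
      also have "\<dots> \<le> C' * \<delta> * (card F powr (1/3) * k powr - (2/3))"
      proof (rule mult_left_mono)
        have "1 / real k = real k powr - 1" using k by (simp add: powr_minus_divide)
        also have "\<dots> \<le> real k powr (1/3 + - (2/3))" using k by (intro powr_mono) auto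
        also have "\<dots> = real k powr (1/3) * real k powr - (2/3)" by (rule powr_add)
        also have "\<dots> \<le> card F powr (1/3) * k powr - (2/3)" using k by (intro mult_right_mono powr_mono2) auto
        finally show "1 / real k \<le> card F powr (1/3) * k powr - (2/3)" .
      qed (use C' \<delta> in simp)
      finally show "measure lebesgue (multi_arc a F \<delta> k) \<le> C' * \<delta> * card F powr (1/3) * k powr - (2/3)" by (simp add: mult_ac)
    qed
  qed
qed

end

section \<open>From the model space to exponential zeros\<close>

lemma one_minus_mult_cnj_circle:
  assumes "norm \<zeta> = 1" shows "1 - a * cnj \<zeta> = cnj \<zeta> * (\<zeta> - a)" "\<zeta> * cnj \<zeta> = 1"
proof -
  show "\<zeta> * cnj \<zeta> = 1" using assms by (simp add: complex_norm_square[symmetric])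
  thus "1 - a * cnj \<zeta> = cnj \<zeta> * (\<zeta> - a)" by (simp add: algebra_simps)
qed

text \<open>On the circle the logarithmic derivative times \<open>\<zeta>\<close> is the Poisson
  kernel of \<open>a\<close>, the speed at which the argument of the factor turns.\<close>

lemma blaschke_factor_deriv_circle:
  assumes a: "norm a < 1" and \<zeta>: "norm \<zeta> = 1"
  shows "\<zeta> * (- sgn_cnj a * of_real (1 - (norm a)\<^sup>2) / (1 - cnj a * \<zeta>)\<^sup>2) =
    blaschke_factor a \<zeta> * of_real ((1 - (norm a)\<^sup>2) / (norm (1 - cnj a * \<zeta>))\<^sup>2)"
proof -
  define p where "p = 1 - cnj a * \<zeta>"
  have p: "p \<noteq> 0" unfolding p_def using one_minus_cnj_mult_nz[OF a] \<zeta> by simp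
  have na: "\<zeta> - a \<noteq> 0" using a \<zeta> by auto
  have cz: "cnj \<zeta> \<noteq> 0" using \<zeta> by auto
  have "of_real ((norm p)\<^sup>2) = p * cnj p" by (rule complex_norm_square)
  also have "cnj p = cnj \<zeta> * (\<zeta> - a)" unfolding p_def using one_minus_mult_cnj_circle(1)[OF \<zeta>, of a] by simp
  finally have np: "of_real ((norm p)\<^sup>2) = p * (cnj \<zeta> * (\<zeta> - a))" .
  have "blaschke_factor a \<zeta> * of_real ((1 - (norm a)\<^sup>2) / (norm p)\<^sup>2) =
     sgn_cnj a * ((a - \<zeta>) / p) * (of_real (1 - (norm a)\<^sup>2) / (p * (cnj \<zeta> * (\<zeta> - a))))"
    unfolding of_real_divide np by (simp add: blaschke_factor_alt p_def)
  also have "\<dots> = - sgn_cnj a * of_real (1 - (norm a)\<^sup>2) / (p\<^sup>2 * cnj \<zeta>) * ((\<zeta> - a) / (\<zeta> - a))"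
    by (simp add: power2_eq_square) (simp add: minus_divide_left[symmetric] divide_simps, simp add: algebra_simps)
  also have "\<dots> = - sgn_cnj a * of_real (1 - (norm a)\<^sup>2) / (p\<^sup>2 * cnj \<zeta>)" using na by simp
  also have "\<dots> = \<zeta> * (- sgn_cnj a * of_real (1 - (norm a)\<^sup>2) / p\<^sup>2)"
  proof -
    have "inverse (cnj \<zeta>) = \<zeta>" using one_minus_mult_cnj_circle(2)[OF \<zeta>] by (metis inverse_unique mult.commute)
    thus ?thesis by (simp add: divide_inverse mult_ac)
  qed
  finally show ?thesis by (simp add: p_def)
qed

text \<open>On the circle \<open>cnj (szego a \<zeta>)\<close> agrees with a function that has a
  simple pole at \<open>a\<close>, which the zero of the factor cancels. What remains is holomorphic
  in the disc and vanishes at 0.\<close>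

lemma cnj_szego_mult_blaschke_factor:
  assumes a: "norm a < 1" and \<zeta>: "norm \<zeta> = 1"
  shows "cnj (szego a \<zeta>) * blaschke_factor a \<zeta> = - sgn_cnj a * \<zeta> * szego a \<zeta>"
proof -
  define p where "p = 1 - cnj a * \<zeta>"
  define s where "s = complex_of_real (sqrt (1 - (norm a)\<^sup>2))"
  have na: "\<zeta> - a \<noteq> 0" using a \<zeta> by auto
  have inv: "inverse (cnj \<zeta>) = \<zeta>" using one_minus_mult_cnj_circle(2)[OF \<zeta>] by (metis inverse_unique mult.commute)
  have "cnj (szego a \<zeta>) = s / (cnj \<zeta> * (\<zeta> - a))"
    using one_minus_mult_cnj_circle(1)[OF \<zeta>, of a] by (simp add: szego_def s_def)
  also have "\<dots> = s * \<zeta> * inverse (\<zeta> - a)" using inv by (simp add: divide_inverse)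
  finally have "cnj (szego a \<zeta>) * blaschke_factor a \<zeta> = sgn_cnj a * s * \<zeta> * inverse p * ((a - \<zeta>) * inverse (\<zeta> - a))"
    by (simp add: blaschke_factor_alt p_def divide_inverse mult_ac)
  also have "(a - \<zeta>) * inverse (\<zeta> - a) = - 1" using na by (metis divide_inverse divide_minus_left divide_self minus_diff_eq)
  finally show ?thesis by (simp add: szego_def s_def p_def divide_inverse mult_ac)
qed

lemma bprod_union: "finite F \<Longrightarrow> finite G \<Longrightarrow> F \<inter> G = {} \<Longrightarrow> bprod a (F \<union> G) z = bprod a F z * bprod a G z"
  by (simp add: bprod_def prod.union_disjoint)

lemma bprod_cnj_self_circle:
  assumes "finite F" "\<And>n. n \<in> F \<Longrightarrow> norm (a n) < 1" "norm \<zeta> = 1"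
  shows "cnj (bprod a F \<zeta>) * bprod a F \<zeta> = 1"
proof -
  have "norm (bprod a F \<zeta>) = 1" by (rule norm_bprod_eq_1) (use assms in auto)
  thus ?thesis using complex_norm_square[of "bprod a F \<zeta>"] by (simp add: mult.commute)
qed

text \<open>Logarithmic derivatives add, and on the circle all contributions are positive multiples
  of the same direction. Hence zeros cannot cancel each other, which gives lower bounds for
  derivatives.\<close>

lemma deriv_bprod_circle:
  assumes "finite F" "\<And>n. n \<in> F \<Longrightarrow> norm (a n) < 1" and \<zeta>: "norm \<zeta> = 1"
  shows "\<zeta> * deriv (bprod a F) \<zeta> = bprod a F \<zeta> * of_real (\<Sum>n\<in>F. (1 - (norm (a n))\<^sup>2) / (norm (1 - cnj (a n) * \<zeta>))\<^sup>2)"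
  using assms(1,2)
proof (induction F rule: finite_induct)
  case empty
  then show ?case by (simp add: bprod_empty[abs_def])
next
  case (insert m F)
  define b' where "b' = - sgn_cnj (a m) * of_real (1 - (norm (a m))\<^sup>2) / (1 - cnj (a m) * \<zeta>)\<^sup>2"
  define S where "S n = (1 - (norm (a n))\<^sup>2) / (norm (1 - cnj (a n) * \<zeta>))\<^sup>2" for n
  have b': "(blaschke_factor (a m) has_field_derivative b') (at \<zeta>)"
    unfolding b'_def by (rule has_field_derivative_blaschke_factor) (use insert \<zeta> in auto)
  have P': "(bprod a F has_field_derivative deriv (bprod a F) \<zeta>) (at \<zeta>)"
    unfolding DERIV_deriv_iff_field_differentiable
    by (intro bprod_field_differentiable) (use insert \<zeta> in auto)
  have "bprod a (insert m F) = (\<lambda>z. blaschke_factor (a m) z * bprod a F z)"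
    using insert by (simp add: bprod_insert fun_eq_iff)
  hence "(bprod a (insert m F) has_field_derivative (b' * bprod a F \<zeta> + deriv (bprod a F) \<zeta> * blaschke_factor (a m) \<zeta>)) (at \<zeta>)"
    using DERIV_mult[OF b' P'] by simp
  hence "deriv (bprod a (insert m F)) \<zeta> = b' * bprod a F \<zeta> + deriv (bprod a F) \<zeta> * blaschke_factor (a m) \<zeta>"
    by (rule DERIV_imp_deriv)
  hence "\<zeta> * deriv (bprod a (insert m F)) \<zeta> = (\<zeta> * b') * bprod a F \<zeta> + (\<zeta> * deriv (bprod a F) \<zeta>) * blaschke_factor (a m) \<zeta>"
    by (simp only: distrib_left mult_ac)
  also have "\<zeta> * b' = blaschke_factor (a m) \<zeta> * of_real (S m)"
    unfolding b'_def S_def by (rule blaschke_factor_deriv_circle) (use insert \<zeta> in auto)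
  also have "\<zeta> * deriv (bprod a F) \<zeta> = bprod a F \<zeta> * of_real (\<Sum>n\<in>F. S n)" unfolding S_def by (rule insert.IH) (use insert in auto)
  also have "blaschke_factor (a m) \<zeta> * of_real (S m) * bprod a F \<zeta> + bprod a F \<zeta> * of_real (\<Sum>n\<in>F. S n) * blaschke_factor (a m) \<zeta>
     = bprod a (insert m F) \<zeta> * of_real (\<Sum>n\<in>insert m F. S n)"
    unfolding sum.insert[OF insert(1,2)] of_real_add bprod_insert[OF insert(1,2)] by (simp only: distrib_left mult_ac)
  finally show ?case unfolding S_def .
qed

context
  fixes a :: "nat \<Rightarrow> complex" and F :: "nat set"
  assumes fin: "finite F" and lt: "\<And>n. n \<in> F \<Longrightarrow> norm (a n) < 1"
begin

text \<open>
  A function holomorphic on the disc and vanishing at 0 that agrees with \<open>cnj e\<^sub>n * P\<^sub>F\<close> on the circle; it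
  shows that \<open>e\<^sub>n\<close> is orthogonal to \<open>P\<^sub>F H\<^sup>2\<close>.
\<close>
definition malmquist_dual :: "nat \<Rightarrow> complex \<Rightarrow> complex" where
  "malmquist_dual n z = - sgn_cnj (a n) * z * szego (a n) z * bprod a {j \<in> F. n < j} z"

lemma cnj_malmquist_mult_bprod:
  assumes n: "n \<in> F" and \<zeta>: "norm \<zeta> = 1"
  shows "cnj (malmquist a F n \<zeta>) * bprod a F \<zeta> = malmquist_dual n \<zeta>"
proof -
  have eq: "{j \<in> F. j < n} \<union> insert n {j \<in> F. n < j} = F" using n by auto
  have "bprod a ({j \<in> F. j < n} \<union> insert n {j \<in> F. n < j}) \<zeta> = bprod a {j \<in> F. j < n} \<zeta> * bprod a (insert n {j \<in> F. n < j}) \<zeta>"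
    by (rule bprod_union) (use fin in auto)
  also have "bprod a (insert n {j \<in> F. n < j}) \<zeta> = blaschke_factor (a n) \<zeta> * bprod a {j \<in> F. n < j} \<zeta>"
    by (rule bprod_insert) (use fin in auto)
  finally have "bprod a F \<zeta> = bprod a {j \<in> F. j < n} \<zeta> * (blaschke_factor (a n) \<zeta> * bprod a {j \<in> F. n < j} \<zeta>)"
    unfolding eq .
  hence "cnj (malmquist a F n \<zeta>) * bprod a F \<zeta> =
     (cnj (bprod a {j \<in> F. j < n} \<zeta>) * bprod a {j \<in> F. j < n} \<zeta>) * (cnj (szego (a n) \<zeta>) * blaschke_factor (a n) \<zeta>) * bprod a {j \<in> F. n < j} \<zeta>"
    by (simp add: malmquist_def)
  also have "cnj (bprod a {j \<in> F. j < n} \<zeta>) * bprod a {j \<in> F. j < n} \<zeta> = 1"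
    by (rule bprod_cnj_self_circle) (use fin lt \<zeta> in auto)
  also have "cnj (szego (a n) \<zeta>) * blaschke_factor (a n) \<zeta> = - sgn_cnj (a n) * \<zeta> * szego (a n) \<zeta>"
    by (rule cnj_szego_mult_blaschke_factor[OF lt[OF n] \<zeta>])
  finally show ?thesis by (simp add: malmquist_dual_def)
qed

lemma malmquist_dual_holomorphic: "n \<in> F \<Longrightarrow> S \<subseteq> cball 0 1 \<Longrightarrow> malmquist_dual n holomorphic_on S"
  unfolding malmquist_dual_def[abs_def]
  by (intro holomorphic_on_mult bprod_holomorphic szego_holomorphic holomorphic_on_const holomorphic_on_ident) (use fin lt in auto)

text \<open>The defect \<open>D\<close> between \<open>cnj e * P\<close> and its holomorphic
  counterpart \<open>T\<close> is continuous on the closed disc and zero on the circle, so it is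
  uniformly small on circles near it, while the quadratic means of \<open>h\<close> stay bounded.
  The remaining integral of \<open>T * h\<close> vanishes by the mean value property, since
  \<open>T 0 = 0\<close>.\<close>

lemma circle_prod_malmquist_tendsto_0:
  assumes n: "n \<in> F" and h: "h \<in> hardy_space 2"
  shows "(circle_prod (malmquist a F n) (\<lambda>z. bprod a F z * h z) \<longlongrightarrow> 0) (at_left 1)"
proof -
  define e where "e = malmquist a F n"
  define P where "P = bprod a F"
  define T where "T = malmquist_dual n"
  define D where "D w = cnj (e w) * P w - T w" for w
  define K where "K = 2 * pi + (hardy_norm 2 h)\<^sup>2"
  have K: "K > 0" unfolding K_def using zero_le_power2[of "hardy_norm 2 h"] pi_gt_zero by linarith
  have hhol: "h holomorphic_on ball 0 1" using h by (simp add: hardy_space_def)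
  have hol: "e holomorphic_on cball 0 1" "P holomorphic_on cball 0 1" "T holomorphic_on cball 0 1"
    unfolding e_def P_def T_def
    by (intro malmquist_holomorphic lt n subset_refl, assumption, intro bprod_holomorphic fin lt subset_refl, assumption, intro malmquist_dual_holomorphic n subset_refl)
  have cD: "continuous_on (cball 0 1) D" unfolding D_def
    by (intro continuous_intros holomorphic_on_imp_continuous_on hol)
  hence uD: "uniformly_continuous_on (cball 0 1) D" by (rule compact_uniformly_continuous) simp
  have D0: "D (cis \<theta>) = 0" for \<theta>
    unfolding D_def e_def P_def T_def using cnj_malmquist_mult_bprod[OF n, of "cis \<theta>"] by simp
  have small: "norm (circle_prod e (\<lambda>z. P z * h z) r) \<le> \<epsilon> * K"
    if r: "0 < r" "r < 1" and De: "\<And>\<theta>. norm (D (circ r \<theta>)) \<le> \<epsilon>" and \<epsilon>: "0 < \<epsilon>" for r \<epsilon>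
  proof -
    have sub: "ball (0::complex) 1 \<subseteq> cball 0 1" by auto
    have c: "continuous_on S (\<lambda>\<theta>. f (circ r \<theta>))" if "f holomorphic_on cball 0 1" for f :: "complex \<Rightarrow> complex" and S
      by (intro continuous_on_circle holomorphic_on_imp_continuous_on holomorphic_on_subset[OF that sub]) (use r in auto)
    have ch: "continuous_on S (\<lambda>\<theta>. h (circ r \<theta>))" for S
      by (intro continuous_on_circle holomorphic_on_imp_continuous_on hhol) (use r in auto)
    note cs = c[OF hol(1)] c[OF hol(2)] c[OF hol(3)] ch
    have cDr: "continuous_on S (\<lambda>\<theta>. D (circ r \<theta>))" for S unfolding D_def by (intro continuous_intros cs)
    have "circle_prod e (\<lambda>z. P z * h z) r = circle_integral r (\<lambda>w. cnj (cnj (e w) * P w * h w))"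
      by (simp add: circle_prod_def mult_ac)
    also have "\<dots> = cnj (circle_integral r (\<lambda>w. cnj (e w) * P w * h w))"
      by (intro integral_cnj_interval continuous_intros cs)
    finally have "norm (circle_prod e (\<lambda>z. P z * h z) r) = norm (circle_integral r (\<lambda>w. cnj (e w) * P w * h w))"
      by simp
    also have "(\<lambda>\<theta>. cnj (e (circ r \<theta>)) * P (circ r \<theta>) * h (circ r \<theta>)) =
       (\<lambda>\<theta>. T (circ r \<theta>) * h (circ r \<theta>) + D (circ r \<theta>) * h (circ r \<theta>))"
      by (simp add: D_def algebra_simps)
    also have "integral {0..2*pi} \<dots> = circle_integral r (\<lambda>w. T w * h w) + circle_integral r (\<lambda>w. D w * h w)"
      by (intro Henstock_Kurzweil_Integration.integral_add integrable_continuous_real continuous_intros cs cDr)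
    also have "circle_integral r (\<lambda>w. T w * h w) = 2 * pi * (T 0 * h 0)"
      by (rule integral_circle_mean_value[where f = "\<lambda>w. T w * h w"])
         (use r in \<open>auto intro!: holomorphic_on_mult hhol holomorphic_on_subset[OF hol(3) sub]\<close>)
    also have "T 0 = 0" by (simp add: T_def malmquist_dual_def)
    also have "norm (2 * pi * (0 * h 0) + circle_integral r (\<lambda>w. D w * h w)) \<le>
       circle_integral r (\<lambda>w. \<epsilon> * (1 + (norm (h w))\<^sup>2))"
      unfolding mult_zero_left mult_zero_right add_0
    proof (rule integral_norm_bound_integral)
      fix \<theta>
      define x where "x = norm (h (circ r \<theta>))"
      have "0 \<le> (x - 1)\<^sup>2" by simp
      hence "2 * x \<le> 1 + x\<^sup>2" by (simp add: power2_eq_square algebra_simps)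
      moreover have "0 \<le> x" by (simp add: x_def)
      ultimately have "x \<le> 1 + x\<^sup>2" by simp
      thus "norm (D (circ r \<theta>) * h (circ r \<theta>)) \<le> \<epsilon> * (1 + (norm (h (circ r \<theta>)))\<^sup>2)"
        unfolding norm_mult x_def using De \<epsilon> by (intro mult_mono) auto
    qed (intro integrable_continuous_real continuous_intros cs cDr)+
    also have "\<dots> = \<epsilon> * (2 * pi + hardy_mean 2 h r)"
      unfolding integral_mult_right hardy_mean_2
      by (subst Henstock_Kurzweil_Integration.integral_add) (auto intro!: integrable_continuous_real continuous_intros cs)
    also have "\<dots> \<le> \<epsilon> * K" unfolding K_def
      using hardy_mean_le_norm[OF h, of r] r \<epsilon> by (intro mult_left_mono add_left_mono) auto
    finally show ?thesis .
  qed
  show ?thesis unfolding e_def[symmetric] P_def[symmetric]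
  proof (rule tendstoI)
    fix \<epsilon> :: real assume \<epsilon>: "\<epsilon> > 0"
    define \<eta> where "\<eta> = \<epsilon> / (2 * K)"
    have \<eta>: "\<eta> > 0" "\<eta> * K < \<epsilon>" using \<epsilon> K by (simp_all add: \<eta>_def)
    obtain d where d: "d > 0" "\<And>x x'. norm x \<le> 1 \<Longrightarrow> norm x' \<le> 1 \<Longrightarrow> dist x' x < d \<Longrightarrow> dist (D x') (D x) < \<eta>"
      using uD \<eta>(1) unfolding uniformly_continuous_on_def by (metis mem_cball_0)
    have "dist (circle_prod e (\<lambda>z. P z * h z) r) 0 < \<epsilon>" if r: "max 0 (1 - d) < r" "r < 1" for r
    proof -
      have "norm (D (circ r \<theta>)) \<le> \<eta>" for \<theta>
      proof -
        have "dist (D (circ r \<theta>)) (D (cis \<theta>)) < \<eta>" using r dist_circ_cis[of r \<theta>] by (intro d) (auto simp: norm_mult)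
        thus ?thesis by (simp add: D0)
      qed
      hence "norm (circle_prod e (\<lambda>z. P z * h z) r) \<le> \<eta> * K" using r \<eta> by (intro small) auto
      thus ?thesis using \<eta> by simp
    qed
    moreover have "max 0 (1 - d) < 1" using d by simp
    ultimately show "\<forall>\<^sub>F r in at_left 1. dist (circle_prod e (\<lambda>z. P z * h z) r) 0 < \<epsilon>"
      unfolding eventually_at_left_field by (intro exI[of _ "max 0 (1 - d)"]) auto
  qed
qed

end

text \<open>For \<open>n < m\<close> the later function is a bounded function times the product over
  the zeros up to \<open>n\<close>, so mutual orthogonality is an instance of orthogonality to the
  multiples of a product.\<close>

lemma circle_prod_malmquist_less_tendsto_0:
  assumes fin: "finite F" and lt: "\<And>n. n \<in> F \<Longrightarrow> norm (a n) < 1" and nm: "n \<in> F" "m \<in> F" "n < m"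
  shows "(circle_prod (malmquist a F n) (malmquist a F m) \<longlongrightarrow> 0) (at_left 1)"
proof -
  define G where "G = {j \<in> F. j \<le> n}"
  define h where "h z = bprod a {j \<in> F. n < j \<and> j < m} z * szego (a m) z" for z
  have G: "finite G" "\<And>j. j \<in> G \<Longrightarrow> norm (a j) < 1" "n \<in> G" using fin lt nm by (auto simp: G_def)
  have "{j \<in> G. j < n} = {j \<in> F. j < n}" by (auto simp: G_def)
  hence 1: "malmquist a F n = malmquist a G n" by (simp add: malmquist_def[abs_def])
  have "{j \<in> F. j < m} = G \<union> {j \<in> F. n < j \<and> j < m}" using nm by (auto simp: G_def)
  hence 2: "malmquist a F m = (\<lambda>z. bprod a G z * h z)"
  proof -
    assume eq: "{j \<in> F. j < m} = G \<union> {j \<in> F. n < j \<and> j < m}"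
    have "bprod a {j \<in> F. j < m} z = bprod a G z * bprod a {j \<in> F. n < j \<and> j < m} z" for z
      unfolding eq by (rule bprod_union) (use fin in \<open>auto simp: G_def\<close>)
    thus ?thesis by (simp add: malmquist_def[abs_def] h_def mult.assoc)
  qed
  have hol: "h holomorphic_on cball 0 1" unfolding h_def
    by (intro holomorphic_on_mult bprod_holomorphic szego_holomorphic) (use fin lt nm in auto)
  have "bounded (h ` cball 0 1)"
    by (intro compact_imp_bounded compact_continuous_image holomorphic_on_imp_continuous_on[OF hol] compact_cball)
  then obtain K where K: "\<And>z. z \<in> cball 0 1 \<Longrightarrow> norm (h z) \<le> K" by (fastforce simp: bounded_iff)
  have "h \<in> hardy_space 2"
    by (rule bounded_in_hardy_space_2[OF holomorphic_on_subset[OF hol], of K]) (use K in auto)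
  from circle_prod_malmquist_tendsto_0[OF G(1) _ G(3) this, of a] G(2)
  show ?thesis unfolding 1 2 by blast
qed

lemma circle_prod_commute:
  assumes "f holomorphic_on ball 0 1" "g holomorphic_on ball 0 1" "0 \<le> r" "r < 1"
  shows "circle_prod g f r = cnj (circle_prod f g r)"
proof -
  have "circle_prod g f r = circle_integral r (\<lambda>w. cnj (f w * cnj (g w)))"
    by (simp add: circle_prod_def mult.commute)
  also have "\<dots> = cnj (circle_prod f g r)" unfolding circle_prod_def
    by (intro integral_cnj_interval continuous_intros continuous_on_circle holomorphic_on_imp_continuous_on assms)
  finally show ?thesis .
qed

lemma circle_prod_malmquist_neq_tendsto_0:
  assumes fin: "finite F" and lt: "\<And>n. n \<in> F \<Longrightarrow> norm (a n) < 1" and nm: "n \<in> F" "m \<in> F" "n \<noteq> m"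
  shows "(circle_prod (malmquist a F n) (malmquist a F m) \<longlongrightarrow> 0) (at_left 1)"
proof (cases "n < m")
  case True
  show ?thesis by (rule circle_prod_malmquist_less_tendsto_0) (use fin lt nm True in auto)
next
  case False
  hence "m < n" using nm by simp
  hence "(circle_prod (malmquist a F m) (malmquist a F n) \<longlongrightarrow> 0) (at_left 1)"
    by (intro circle_prod_malmquist_less_tendsto_0) (use fin lt nm in auto)
  hence "((\<lambda>r. cnj (circle_prod (malmquist a F m) (malmquist a F n) r)) \<longlongrightarrow> cnj 0) (at_left 1)" by (rule tendsto_cnj)
  hence lim: "((\<lambda>r. cnj (circle_prod (malmquist a F m) (malmquist a F n) r)) \<longlongrightarrow> 0) (at_left 1)" by simp
  have hol: "malmquist a F k holomorphic_on ball 0 1" if "k \<in> F" for k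
    by (rule malmquist_holomorphic) (use lt that in auto)
  show ?thesis
  proof (rule Lim_transform_eventually[OF lim])
    have "cnj (circle_prod (malmquist a F m) (malmquist a F n) r) = circle_prod (malmquist a F n) (malmquist a F m) r" if "0 < r" "r < 1" for r
      by (rule circle_prod_commute[symmetric]) (use hol nm that in auto)
    thus "\<forall>\<^sub>F r in at_left 1. cnj (circle_prod (malmquist a F m) (malmquist a F n) r) = circle_prod (malmquist a F n) (malmquist a F m) r"
      unfolding eventually_at_left_field by (intro exI[of _ 0]) auto
  qed
qed

text \<open>\<open>X\<close> encodes the sign pattern, so that averaging over all patterns is a
  finite sum over \<open>Pow F\<close>.\<close>

definition malmquist_sum :: "(nat \<Rightarrow> complex) \<Rightarrow> nat set \<Rightarrow> nat set \<Rightarrow> complex \<Rightarrow> complex" where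
  "malmquist_sum a F X z = (\<Sum>n\<in>F. (if n \<in> X then 1 else -1) * malmquist a F n z)"

context
  fixes a :: "nat \<Rightarrow> complex" and F :: "nat set"
  assumes fin: "finite F" and lt: "\<And>n. n \<in> F \<Longrightarrow> norm (a n) < 1"
begin

lemma malmquist_sum_holomorphic: "S \<subseteq> cball 0 1 \<Longrightarrow> malmquist_sum a F X holomorphic_on S"
  unfolding malmquist_sum_def[abs_def]
  by (intro holomorphic_on_sum holomorphic_on_mult holomorphic_on_const malmquist_holomorphic lt)

lemma circle_prod_malmquist_sum:
  assumes g: "g holomorphic_on ball 0 1" and r: "0 \<le> r" "r < 1"
  shows "circle_prod (malmquist_sum a F X) g r = (\<Sum>n\<in>F. (if n \<in> X then 1 else -1) * circle_prod (malmquist a F n) g r)"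
proof -
  have c: "continuous_on S (\<lambda>\<theta>. malmquist a F n (circ r \<theta>))" if "n \<in> F" for n S
    by (intro continuous_on_circle holomorphic_on_imp_continuous_on malmquist_holomorphic lt that r) auto
  have cg: "continuous_on S (\<lambda>\<theta>. g (circ r \<theta>))" for S
    by (intro continuous_on_circle holomorphic_on_imp_continuous_on g r)
  have "circle_prod (malmquist_sum a F X) g r = circle_integral r (\<lambda>w. \<Sum>n\<in>F. (if n \<in> X then 1 else -1) * (malmquist a F n w * cnj (g w)))"
    by (simp add: circle_prod_def malmquist_sum_def sum_distrib_right mult.assoc)
  also have "\<dots> = (\<Sum>n\<in>F. circle_integral r (\<lambda>w. (if n \<in> X then 1 else -1) * (malmquist a F n w * cnj (g w))))"
    by (intro Henstock_Kurzweil_Integration.integral_sum fin integrable_continuous_real continuous_intros c cg)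
  finally show ?thesis by (simp only: integral_mult_right circle_prod_def)
qed

text \<open>The off-diagonal products vanish only in the limit. As quadratic means increase with the
  radius, the mean at \<open>r\<close> is bounded by the mean at \<open>s\<close>, and letting
  \<open>s\<close> tend to 1 removes them.\<close>

lemma hardy_norm_malmquist_sum_le: "malmquist_sum a F X \<in> hardy_space 2" "hardy_norm 2 (malmquist_sum a F X) \<le> sqrt (2 * pi * card F)"
proof -
  define f where "f = malmquist_sum a F X"
  define e where "e = malmquist a F"
  define \<sigma> where "\<sigma> n = (if n \<in> X then 1 else -1 :: complex)" for n
  have fhol: "f holomorphic_on ball 0 1" unfolding f_def by (rule malmquist_sum_holomorphic) auto
  have ehol: "e n holomorphic_on ball 0 1" if "n \<in> F" for n
    unfolding e_def by (rule malmquist_holomorphic) (use lt that in auto)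
  define off where "off s = (\<Sum>n\<in>F. \<sigma> n * cnj (\<Sum>m\<in>F - {n}. \<sigma> m * circle_prod (e m) (e n) s))" for s
  have off: "(off \<longlongrightarrow> (\<Sum>n\<in>F. \<sigma> n * cnj (\<Sum>m\<in>F - {n}. \<sigma> m * 0))) (at_left 1)"
    unfolding off_def e_def
    by (intro tendsto_intros circle_prod_malmquist_neq_tendsto_0 fin lt) auto
  have eq: "circle_prod f f s = of_real (\<Sum>n\<in>F. hardy_mean 2 (e n) s) + off s" if s: "0 < s" "s < 1" for s
  proof -
    have "circle_prod f f s = (\<Sum>n\<in>F. \<sigma> n * circle_prod (e n) f s)"
      unfolding f_def e_def \<sigma>_def by (rule circle_prod_malmquist_sum) (use fhol s in \<open>auto simp: f_def\<close>)
    also have "\<dots> = (\<Sum>n\<in>F. of_real (hardy_mean 2 (e n) s) + \<sigma> n * cnj (\<Sum>m\<in>F - {n}. \<sigma> m * circle_prod (e m) (e n) s))"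
    proof (rule sum.cong[OF refl])
      fix n assume n: "n \<in> F"
      have "circle_prod f (e n) s = (\<Sum>m\<in>F. \<sigma> m * circle_prod (e m) (e n) s)"
        unfolding f_def e_def \<sigma>_def by (rule circle_prod_malmquist_sum) (use ehol[OF n] s in \<open>auto simp: e_def\<close>)
      also have "\<dots> = \<sigma> n * of_real (hardy_mean 2 (e n) s) + (\<Sum>m\<in>F - {n}. \<sigma> m * circle_prod (e m) (e n) s)"
        using circle_prod_self[OF ehol[OF n], of s] s by (simp add: sum.remove[OF fin n])
      finally have "\<sigma> n * circle_prod (e n) f s = \<sigma> n * cnj (\<sigma> n * of_real (hardy_mean 2 (e n) s) + (\<Sum>m\<in>F - {n}. \<sigma> m * circle_prod (e m) (e n) s))"
        using circle_prod_commute[OF fhol ehol[OF n], of s] s by simp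
      also have "\<dots> = \<sigma> n * cnj (\<sigma> n) * of_real (hardy_mean 2 (e n) s) + \<sigma> n * cnj (\<Sum>m\<in>F - {n}. \<sigma> m * circle_prod (e m) (e n) s)"
        by (simp only: complex_cnj_add complex_cnj_mult complex_cnj_complex_of_real distrib_left mult.assoc)
      also have "\<sigma> n * cnj (\<sigma> n) = 1" by (simp add: \<sigma>_def)
      finally show "\<sigma> n * circle_prod (e n) f s = of_real (hardy_mean 2 (e n) s) + \<sigma> n * cnj (\<Sum>m\<in>F - {n}. \<sigma> m * circle_prod (e m) (e n) s)"
        by simp
    qed
    also have "\<dots> = of_real (\<Sum>n\<in>F. hardy_mean 2 (e n) s) + off s" by (simp add: sum.distrib off_def)
    finally show ?thesis .
  qed
  have bd: "hardy_mean 2 f r \<le> (sqrt (2 * pi * card F))\<^sup>2" if r: "0 < r" "r < 1" for r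
  proof -
    have "hardy_mean 2 f r \<le> 2 * pi * card F + norm (off s)" if s: "r < s" "s < 1" for s
    proof -
      have "hardy_mean 2 f r \<le> hardy_mean 2 f s" by (rule hardy_mean_mono[OF fhol]) (use r s in auto)
      also have "of_real (hardy_mean 2 f s) = of_real (\<Sum>n\<in>F. hardy_mean 2 (e n) s) + off s"
        using eq[of s] circle_prod_self[OF fhol, of s] r s by simp
      hence "hardy_mean 2 f s = (\<Sum>n\<in>F. hardy_mean 2 (e n) s) + Re (off s)"
        by (metis Re_complex_of_real plus_complex.simps(1))
      also have "\<dots> \<le> (\<Sum>n\<in>F. 2 * pi) + norm (off s)"
        unfolding e_def by (intro add_mono sum_mono hardy_mean_malmquist_le lt complex_Re_le_cmod) (use r s in auto)
      finally show ?thesis by (simp add: mult_ac)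
    qed
    hence ev: "\<forall>\<^sub>F s in at_left 1. hardy_mean 2 f r \<le> 2 * pi * card F + norm (off s)"
      unfolding eventually_at_left_field using r by blast
    have "((\<lambda>s. 2 * pi * card F + norm (off s)) \<longlongrightarrow> 2 * pi * card F + norm (\<Sum>n\<in>F. \<sigma> n * cnj (\<Sum>m\<in>F - {n}. \<sigma> m * 0))) (at_left 1)"
      by (intro tendsto_intros off)
    from tendsto_lowerbound[OF this ev] show ?thesis by simp
  qed
  show "malmquist_sum a F X \<in> hardy_space 2" "hardy_norm 2 (malmquist_sum a F X) \<le> sqrt (2 * pi * card F)"
    using hardy_space_2I[OF fhol bd] unfolding f_def by auto
qed

lemma deriv_malmquist_sum:
  assumes "norm z \<le> 1"
  shows "deriv (malmquist_sum a F X) z = (\<Sum>n\<in>F. (if n \<in> X then 1 else -1) * deriv (malmquist a F n) z)"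
proof -
  interpret S: blaschke_sequence a F by standard (use fin lt in auto)
  have "(malmquist a F n has_field_derivative deriv (malmquist a F n) z) (at z)" if "n \<in> F" for n
    unfolding DERIV_deriv_iff_field_differentiable field_differentiable_def
    using S.has_field_derivative_malmquist[OF that assms] by blast
  hence "(malmquist_sum a F X has_field_derivative (\<Sum>n\<in>F. (if n \<in> X then 1 else -1) * deriv (malmquist a F n) z)) (at z)"
    unfolding malmquist_sum_def[abs_def] by (intro DERIV_sum DERIV_cmult)
  thus ?thesis by (rule DERIV_imp_deriv)
qed

text \<open>Links the lower bounds for derivatives, valid on the unit circle, to the weak-type
  hypothesis inside the disc. \<open>U\<close> omits only the finitely many poles and is an open set
  containing the closed disc.\<close>

lemma deriv_malmquist_sum_continuous: "continuous_on (cball 0 1) (deriv (malmquist_sum a F X))"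
proof -
  define U where "U = (\<Inter>n\<in>F. {z. 1 - cnj (a n) * z \<noteq> 0})"
  have "open U" unfolding U_def
    by (intro open_INT fin ballI open_Collect_neq continuous_intros)
  moreover have "malmquist_sum a F X holomorphic_on U"
    unfolding malmquist_sum_def[abs_def] malmquist_def[abs_def] bprod_def blaschke_factor_alt szego_def
    by (intro holomorphic_intros) (auto simp: U_def)
  ultimately have "continuous_on U (deriv (malmquist_sum a F X))"
    by (intro holomorphic_on_imp_continuous_on holomorphic_deriv)
  thus ?thesis by (rule continuous_on_subset) (use one_minus_cnj_mult_nz lt in \<open>auto simp: U_def\<close>)
qed

text \<open>Flipping the sign of \<open>e\<^sub>n\<close> changes the derivative by \<open>2 e\<^sub>n'\<close>, so one of the two patterns is large.\<close>
lemma half_sign_patterns: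
  assumes z: "norm z \<le> 1" and n: "n \<in> F" and L: "L \<le> norm (deriv (malmquist a F n) z)"
  shows "2 ^ card F \<le> 2 * (\<Sum>X\<in>Pow F. of_bool (L \<le> norm (deriv (malmquist_sum a F X) z)) :: real)"
proof -
  define I where "I X = (of_bool (L \<le> norm (deriv (malmquist_sum a F X) z)) :: real)" for X
  \<comment> \<open>An involution of the sign patterns, so summing over \<open>flip X\<close> is the
    same as summing over \<open>X\<close>.\<close>
  define flip where "flip X = (if n \<in> X then X - {n} else insert n X)" for X
  have bij: "bij_betw flip (Pow F) (Pow F)"
    by (rule bij_betwI[where g = flip]) (use n in \<open>auto simp: flip_def split: if_splits\<close>)
  have "1 \<le> I X + I (flip X)" if X: "X \<subseteq> F" for X
  proof (rule ccontr)
    assume "\<not> ?thesis"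
    hence less: "norm (deriv (malmquist_sum a F X) z) < L" "norm (deriv (malmquist_sum a F (flip X)) z) < L"
      by (auto simp: I_def of_bool_def not_le split: if_splits)
    define s where "s = (if n \<in> X then 2 else -2 :: complex)"
    have "deriv (malmquist_sum a F X) z - deriv (malmquist_sum a F (flip X)) z =
       (\<Sum>m\<in>F. ((if m \<in> X then 1 else -1) - (if m \<in> flip X then 1 else -1)) * deriv (malmquist a F m) z)"
      unfolding deriv_malmquist_sum[OF z] sum_subtractf[symmetric] left_diff_distrib ..
    also have "\<dots> = (\<Sum>m\<in>F. if m = n then s * deriv (malmquist a F n) z else 0)"
    proof (rule sum.cong[OF refl])
      fix m
      have "(if m \<in> X then 1 else -1) - (if m \<in> flip X then 1 else -1) = (if m = n then s else 0 :: complex)"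
      proof (cases "m = n")
        case True
        thus ?thesis by (cases "n \<in> X") (simp_all only: flip_def s_def if_True if_False refl Diff_iff insert_iff empty_iff simp_thms diff_minus_eq_add one_add_one, simp)
      next
        case False
        have "m \<in> flip X \<longleftrightarrow> m \<in> X" using False by (simp add: flip_def)
        thus ?thesis using False by (simp only: diff_self if_False)
      qed
      thus "((if m \<in> X then 1 else -1) - (if m \<in> flip X then 1 else -1)) * deriv (malmquist a F m) z = (if m = n then s * deriv (malmquist a F n) z else 0)"
        by (cases "m = n") simp_all
    qed
    also have "\<dots> = s * deriv (malmquist a F n) z" using n fin by simp
    finally have "norm (s * deriv (malmquist a F n) z) < L + L"
      using norm_triangle_ineq4[of "deriv (malmquist_sum a F X) z" "deriv (malmquist_sum a F (flip X)) z"] less by simp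
    moreover have "norm s = 2" by (simp add: s_def)
    ultimately show False using L by (simp add: norm_mult)
  qed
  hence "(\<Sum>X\<in>Pow F. 1) \<le> (\<Sum>X\<in>Pow F. I X + I (flip X))" by (intro sum_mono) auto
  also have "\<dots> = (\<Sum>X\<in>Pow F. I X) + (\<Sum>X\<in>Pow F. I (flip X))" by (rule sum.distrib)
  also have "(\<Sum>X\<in>Pow F. I (flip X)) = (\<Sum>X\<in>Pow F. I X)" by (rule sum.reindex_bij_betw[OF bij])
  finally show ?thesis using fin by (simp add: card_Pow I_def)
qed

text \<open>
  Take the last zero \<open>n\<close> whose arc contains \<open>\<theta>\<close>. On the circle \<open>\<zeta> e\<^sub>n' / e\<^sub>n = X + w / (1 - w)\<close> with
  \<open>w = cnj a\<^sub>n \<zeta>\<close> and a real \<open>X \<ge> (k - 1) / (16\<delta>)\<close>: the real part is large if \<open>k \<ge> 2\<close>, the imaginary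
  part if \<open>k = 1\<close>.
\<close>
lemma norm_deriv_malmquist_multi_arc:
  assumes \<delta>: "0 < \<delta>" "\<delta> \<le> 1 / 16" and d: "\<And>n. n \<in> F \<Longrightarrow> \<delta> \<le> 1 - norm (a n) \<and> 1 - norm (a n) < 2 * \<delta>"
    and k: "1 \<le> k" and \<theta>: "\<theta> \<in> multi_arc a F \<delta> k"
  shows "\<exists>n\<in>F. k / (256 * (\<delta> * sqrt \<delta>)) \<le> norm (deriv (malmquist a F n) (cis \<theta>))"
proof -
  interpret S: blaschke_sequence a F by standard (use fin lt in auto)
  define \<zeta> where "\<zeta> = cis \<theta>"
  have \<zeta>: "norm \<zeta> = 1" "norm \<zeta> \<le> 1" by (simp_all add: \<zeta>_def)
  define S where "S n = (1 - (norm (a n))\<^sup>2) / (norm (1 - cnj (a n) * \<zeta>))\<^sup>2" for n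
  define G where "G = {n \<in> F. \<theta> \<in> zero_arc \<delta> (a n)}"
  have G: "finite G" "G \<subseteq> F" "k \<le> card G" using fin \<theta> by (auto simp: G_def multi_arc_def)
  hence "G \<noteq> {}" using k by auto
  \<comment> \<open>With the largest index, every other member of \<open>G\<close> precedes
    \<open>n\<close>, and its Poisson kernel is a summand of \<open>X\<close>.\<close>
  define n where "n = Max G"
  have nG: "n \<in> G" unfolding n_def using G(1) \<open>G \<noteq> {}\<close> by (rule Max_in)
  have nF: "n \<in> F" using nG G by auto
  have Spos: "0 \<le> S j" if "j \<in> F" for j
    using lt[OF that] by (auto simp: S_def power_le_one intro!: divide_nonneg_nonneg)
  have SG: "1 / (16 * \<delta>) \<le> S j" if j: "j \<in> G" for j
  proof -
    have jF: "j \<in> F" using j G by auto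
    have "norm (1 - cnj (a j) * \<zeta>) \<le> 4 * \<delta>"
      unfolding \<zeta>_def using zero_arc_estimates(1)[OF \<delta>, of "a j" \<theta>] d[OF jF] j by (simp add: G_def)
    moreover have "0 < norm (1 - cnj (a j) * \<zeta>)" using one_minus_cnj_mult_nz[OF lt[OF jF] \<zeta>(2)] by simp
    moreover have "\<delta> \<le> 1 - (norm (a j))\<^sup>2"
    proof -
      have "1 - norm (a j) \<le> 1 - (norm (a j))\<^sup>2" using lt[OF jF] by (simp add: power2_eq_square mult_left_le)
      thus ?thesis using d[OF jF] by linarith
    qed
    ultimately have "\<delta> / (4 * \<delta>)\<^sup>2 \<le> S j" unfolding S_def
      using \<delta> by (intro frac_le power_mono) auto
    thus ?thesis using \<delta> by (simp add: power2_eq_square)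
  qed
  define X where "X = (\<Sum>j\<in>{j \<in> F. j < n}. S j)"
  have X: "(real k - 1) / (16 * \<delta>) \<le> X" "0 \<le> X"
  proof -
    have "(real k - 1) * (1 / (16 * \<delta>)) \<le> real (card (G - {n})) * (1 / (16 * \<delta>))"
      using G nG \<delta> by (intro mult_right_mono) (auto simp: of_nat_diff card_Diff_singleton)
    also have "\<dots> \<le> (\<Sum>j\<in>G - {n}. S j)" using SG by (intro sum_bounded_below) auto
    also have "\<dots> \<le> X" unfolding X_def
    proof (rule sum_mono2)
      show "G - {n} \<subseteq> {j \<in> F. j < n}"
      proof
        fix j assume j: "j \<in> G - {n}"
        hence "j \<le> n" unfolding n_def using G(1) by auto
        thus "j \<in> {j \<in> F. j < n}" using j G by auto
      qed
    qed (use fin Spos in auto)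
    finally show "(real k - 1) / (16 * \<delta>) \<le> X" by simp
    show "0 \<le> X" unfolding X_def using Spos by (intro sum_nonneg) auto
  qed
  define w where "w = cnj (a n) * \<zeta>"
  define P where "P = bprod a {j \<in> F. j < n}"
  have w: "norm w < 1" using lt[OF nF] \<zeta> by (simp add: w_def norm_mult)
  have w1: "1 - w \<noteq> 0" using w by auto
  have "deriv (malmquist a F n) \<zeta> = deriv P \<zeta> * szego (a n) \<zeta> + szego (a n) \<zeta> * (cnj (a n) / (1 - w)) * P \<zeta>"
    unfolding P_def w_def by (rule DERIV_imp_deriv[OF S.has_field_derivative_malmquist[OF nF \<zeta>(2)]])
  hence "\<zeta> * deriv (malmquist a F n) \<zeta> = (\<zeta> * deriv P \<zeta>) * szego (a n) \<zeta> + szego (a n) \<zeta> * (w / (1 - w)) * P \<zeta>"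
    by (simp add: w_def algebra_simps)
  also have "\<zeta> * deriv P \<zeta> = P \<zeta> * of_real X" unfolding P_def X_def S_def
    by (rule deriv_bprod_circle) (use fin lt \<zeta> in auto)
  finally have "\<zeta> * deriv (malmquist a F n) \<zeta> = P \<zeta> * szego (a n) \<zeta> * (of_real X + w / (1 - w))" by (simp add: algebra_simps)
  hence "norm (\<zeta> * deriv (malmquist a F n) \<zeta>) = norm (P \<zeta>) * norm (szego (a n) \<zeta>) * norm (of_real X + w / (1 - w))"
    by (simp only: norm_mult)
  moreover have "norm (P \<zeta>) = 1" unfolding P_def by (rule norm_bprod_eq_1) (use fin lt \<zeta> in auto)
  ultimately have nd: "norm (deriv (malmquist a F n) \<zeta>) = norm (szego (a n) \<zeta>) * norm (of_real X + w / (1 - w))"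
    using \<zeta> by (simp add: norm_mult)
  have sz: "1 / (4 * sqrt \<delta>) \<le> norm (szego (a n) \<zeta>)"
  proof (rule power2_le_imp_le)
    have "(1 / (4 * sqrt \<delta>))\<^sup>2 = 1 / (16 * \<delta>)" using \<delta> by (simp add: power_divide power_mult_distrib)
    also have "\<dots> \<le> S n" by (rule SG[OF nG])
    also have "\<dots> = (norm (szego (a n) \<zeta>))\<^sup>2" unfolding S_def by (rule norm_szego_sq[symmetric, OF lt[OF nF]])
    finally show "(1 / (4 * sqrt \<delta>))\<^sup>2 \<le> (norm (szego (a n) \<zeta>))\<^sup>2" .
  qed simp
  have wdiv: "w / (1 - w) = inverse (1 - w) - 1" using w1 by (simp add: field_simps)
  \<comment> \<open>The 64 comes from the case \<open>k = 1\<close>, where the imaginary part is at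
    least \<open>(\<delta> / 4) / (4 * \<delta>)^2\<close>. In the other case the real part of
    \<open>w / (1 - w)\<close> is at least -1/2, and the comparison is sharp at
    \<open>k = 2\<close>, \<open>\<delta> = 1/16\<close>. The factor
    \<open>1 / (4 * sqrt \<delta>)\<close> turns 64 into 256.\<close>
  have k64: "k / (64 * \<delta>) \<le> norm (of_real X + w / (1 - w))"
  proof (cases "k = 1")
    case True
    have "norm (1 - w) \<le> 4 * \<delta>" "\<delta> / 4 \<le> \<bar>Im w\<bar>"
      using zero_arc_estimates[OF \<delta>, of "a n" \<theta>] d[OF nF] nG by (simp_all add: G_def w_def \<zeta>_def)
    moreover have "0 < norm (1 - w)" using w1 by simp
    ultimately have "(\<delta> / 4) / (4 * \<delta>)\<^sup>2 \<le> \<bar>Im w\<bar> / (norm (1 - w))\<^sup>2"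
      using \<delta> by (intro frac_le power_mono) auto
    also have "\<dots> = \<bar>Im (of_real X + w / (1 - w))\<bar>" unfolding wdiv
      by (simp add: cmod_power2)
    also have "\<dots> \<le> norm (of_real X + w / (1 - w))" by (rule abs_Im_le_cmod)
    finally show ?thesis using True \<delta> by (simp add: power2_eq_square)
  next
    case False
    hence k2: "2 \<le> real k" using k by simp
    have "1 / 2 \<le> Re (inverse (1 - w))"
    proof -
      have "(norm w)\<^sup>2 \<le> 1" using w by (simp add: power_le_one)
      hence "(norm (1 - w))\<^sup>2 \<le> 2 * (1 - Re w)"
        by (simp add: cmod_power2) (simp add: power2_eq_square algebra_simps)
      moreover have "0 < (norm (1 - w))\<^sup>2" using w1 by simp
      ultimately have "1 / 2 \<le> (1 - Re w) / (norm (1 - w))\<^sup>2" by (simp add: field_simps)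
      moreover have "Re (inverse (1 - w)) = (1 - Re w) / (norm (1 - w))\<^sup>2" by (simp add: cmod_power2)
      ultimately show ?thesis by (simp only:)
    qed
    moreover have "Re (of_real X + w / (1 - w)) = X + (Re (inverse (1 - w)) - 1)"
      unfolding wdiv by (simp only: plus_complex.sel minus_complex.sel Re_complex_of_real one_complex.sel)
    ultimately have "X - 1 / 2 \<le> Re (of_real X + w / (1 - w))" by linarith
    also have "\<dots> \<le> norm (of_real X + w / (1 - w))" by (rule complex_Re_le_cmod)
    finally have "(real k - 1) / (16 * \<delta>) - 1 / 2 \<le> norm (of_real X + w / (1 - w))" using X by linarith
    moreover have "k / (64 * \<delta>) \<le> (real k - 1) / (16 * \<delta>) - 1 / 2"
    proof -
      have "k / 64 \<le> (real k - 1) / 16 - \<delta> / 2"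
      proof -
        have "\<delta> / 2 \<le> 1 / 32" using \<delta>(2) by simp
        moreover have "real k / 64 \<le> (real k - 1) / 16 - 1 / 32" using k2 by (simp add: field_simps)
        ultimately show ?thesis by linarith
      qed
      from divide_right_mono[OF this, of \<delta>] \<delta> show ?thesis by (simp add: diff_divide_distrib)
    qed
    ultimately show ?thesis by linarith
  qed
  have "(1 / (4 * sqrt \<delta>)) * (k / (64 * \<delta>)) \<le> norm (deriv (malmquist a F n) \<zeta>)"
    unfolding nd using \<delta> by (intro mult_mono sz k64) auto
  thus ?thesis using nF by (intro bexI[of _ n]) (auto simp: \<zeta>_def mult_ac)
qed

end

context blaschke_sequence
begin

text \<open>Splitting off the finite product leaves a factor \<open>R\<close> of modulus at most 1,
  and \<open>R * g\<close> is again in the Hardy space. So multiples of the whole product are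
  multiples of \<open>bprod a F\<close>, to which the sum is orthogonal.\<close>

lemma malmquist_sum_in_model_space:
  assumes F: "finite F" "F \<subseteq> I"
  shows "malmquist_sum a F X \<in> model_space (blaschke_prod a I)"
proof -
  have lt: "norm (a n) < 1" if "n \<in> F" for n using norm_zero_lt_1 F that by auto
  interpret J: blaschke_sequence a "I - F" by (rule blaschke_sequence_subset) auto
  define R where "R = blaschke_prod a (I - F)"
  have fH: "malmquist_sum a F X \<in> hardy_space 2" by (rule hardy_norm_malmquist_sum_le(1)[OF F(1) lt])
  have "hardy_inner (malmquist_sum a F X) (\<lambda>z. blaschke_prod a I z * g z) = 0" if g: "g \<in> hardy_space 2" for g
  proof -
    have ghol: "g holomorphic_on ball 0 1" using g by (simp add: hardy_space_def)
    have Rhol: "R holomorphic_on ball 0 1" unfolding R_def by (rule J.blaschke_prod_holomorphic)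
    have Rghol: "(\<lambda>z. R z * g z) holomorphic_on ball 0 1" by (intro holomorphic_on_mult Rhol ghol)
    have Rg: "(\<lambda>z. R z * g z) \<in> hardy_space 2"
    proof (rule hardy_space_2I(1)[OF Rghol])
      fix r :: real assume r: "0 < r" "r < 1"
      have "hardy_mean 2 (\<lambda>z. R z * g z) r \<le> hardy_mean 2 g r"
      proof (rule hardy_mean_2_le)
        fix z :: complex assume "norm z < 1"
        thus "norm (R z * g z) \<le> norm (g z)"
          unfolding R_def norm_mult by (intro mult_left_le_one_le J.norm_blaschke_prod_le_1) auto
      qed (use r Rghol ghol in \<open>auto intro: holomorphic_on_imp_continuous_on\<close>)
      also have "\<dots> \<le> (hardy_norm 2 g)\<^sup>2" by (rule hardy_mean_le_norm[OF g]) (use r in auto)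
      finally show "hardy_mean 2 (\<lambda>z. R z * g z) r \<le> (hardy_norm 2 g)\<^sup>2" .
    qed (rule hardy_norm_nonneg)
    have Phol: "(\<lambda>z. bprod a F z * (R z * g z)) holomorphic_on ball 0 1"
      by (intro holomorphic_on_mult[OF _ Rghol] bprod_holomorphic F lt) auto
    define c where "c = (\<lambda>r. \<Sum>n\<in>F. (if n \<in> X then 1 else -1) * circle_prod (malmquist a F n) (\<lambda>z. bprod a F z * (R z * g z)) r)"
    have "(c \<longlongrightarrow> (\<Sum>n\<in>F. (if n \<in> X then 1 else -1) * 0)) (at_left 1)" unfolding c_def
      by (intro tendsto_sum tendsto_mult tendsto_const circle_prod_malmquist_tendsto_0[OF F(1) lt _ Rg])
    hence lim: "(c \<longlongrightarrow> 0) (at_left 1)" by simp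
    have "circle_prod (malmquist_sum a F X) (\<lambda>z. blaschke_prod a I z * g z) r = c r" if r: "0 < r" "r < 1" for r
    proof -
      have "circle_prod (malmquist_sum a F X) (\<lambda>z. blaschke_prod a I z * g z) r = circle_prod (malmquist_sum a F X) (\<lambda>z. bprod a F z * (R z * g z)) r"
      proof -
        have "blaschke_prod a I (circ r \<theta>) = bprod a F (circ r \<theta>) * R (circ r \<theta>)" for \<theta>
          unfolding R_def by (rule blaschke_prod_split[OF F]) (use r in \<open>simp add: norm_mult\<close>)
        thus ?thesis unfolding circle_prod_def by (simp only: mult.assoc)
      qed
      also have "\<dots> = c r" unfolding c_def by (rule circle_prod_malmquist_sum[OF F(1) lt Phol]) (use r in auto)
      finally show ?thesis .
    qed
    hence ev: "\<forall>\<^sub>F r in at_left 1. c r = circle_prod (malmquist_sum a F X) (\<lambda>z. blaschke_prod a I z * g z) r"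
      unfolding eventually_at_left_field by (intro exI[of _ 0]) auto
    have "(circle_prod (malmquist_sum a F X) (\<lambda>z. blaschke_prod a I z * g z) \<longlongrightarrow> 0) (at_left 1)"
      by (rule Lim_transform_eventually[OF lim ev])
    from tendsto_Lim[OF trivial_limit_at_left_real this] show ?thesis
      unfolding hardy_inner_def circle_prod_def[abs_def] .
  qed
  thus ?thesis using fH by (auto simp: model_space_def hardy_orthogonal_complement_def)
qed

lemma model_space_imp_exponential_zeros:
  assumes C: "0 < C"
    and weak: "\<And>f r t. f \<in> model_space (blaschke_prod a I) \<Longrightarrow> 0 < r \<Longrightarrow> r < 1 \<Longrightarrow> 0 < t \<Longrightarrow>
       measure lebesgue (angles r (\<lambda>w. t * hardy_norm 2 f < norm (deriv f w))) \<le> C * t powr (- (2/3))"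
  shows "\<exists>M. exponential_zeros a I M"
proof -
  \<comment> \<open>Collects the numerical constants of \<open>t\<close> below, so that
    \<open>t = k / (q * (M powr (1/2) * \<delta> powr (3/2)))\<close>.\<close>
  define q where "q = 512 * sqrt (2 * pi)"
  have q: "q > 0" by (simp add: q_def)
  define C' where "C' = 2 * C * q powr (2/3)"
  have C': "0 \<le> C'" using C by (simp add: C'_def)
  show ?thesis
  proof (rule exponential_zerosI)
    show "0 < (1/16 :: real)" by simp
    fix F \<delta> assume F: "finite F" "F \<subseteq> I" and \<delta>: "0 < \<delta>" "\<delta> \<le> (1/16::real)"
      and d: "\<And>n. n \<in> F \<Longrightarrow> \<delta> \<le> 1 - norm (a n) \<and> 1 - norm (a n) < 2 * \<delta>"
    have lt: "norm (a n) < 1" if "n \<in> F" for n using norm_zero_lt_1 F that by auto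
    show "real (card F) \<le> (3 * C') ^ 3"
    proof (rule card_le_of_multi_arc[OF F(1) \<delta> C', of a])
      fix k assume k: "1 \<le> k" "k \<le> card F"
      define M where "M = real (card F)"
      have M: "M \<ge> 1" using k by (simp add: M_def)
      define L where "L = k / (256 * (\<delta> * sqrt \<delta>))"
      define H where "H = sqrt (2 * pi * M)"
      \<comment> \<open>Half of the level \<open>L\<close> is spent on moving from the unit circle
        to a radius below 1; the other half is \<open>t\<close> times the norm bound
        \<open>H\<close>.\<close>
      define t where "t = L / (2 * H)"
      have L: "L > 0" using k \<delta> by (simp add: L_def)
      have H: "H > 0" using M by (simp add: H_def)
      have t: "t > 0" "t * H = L / 2" using L H by (simp_all add: t_def)
      define A where "A = multi_arc a F \<delta> k"
      have A: "A \<in> sets borel" "A \<subseteq> {0..<2*pi}"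
        using multi_arc_sets[OF F(1)] by (auto simp: A_def multi_arc_def)
      define g where "g X \<theta> = norm (deriv (malmquist_sum a F X) (cis \<theta>))" for X \<theta>
      define E where "E X = {\<theta> \<in> {0..<2*pi}. L \<le> g X \<theta>}" for X
      have dc: "continuous_on (cball 0 1) (deriv (malmquist_sum a F X))" for X
        by (rule deriv_malmquist_sum_continuous[OF F(1) lt])
      have gc: "continuous_on UNIV (g X)" for X unfolding g_def
        by (intro continuous_on_norm continuous_on_compose2[OF dc]) (auto intro!: continuous_intros)
      have E: "E X \<in> sets borel" "E X \<subseteq> {0..<2*pi}" for X
      proof -
        have [measurable]: "g X \<in> borel_measurable borel" by (rule borel_measurable_continuous_onI[OF gc])
        show "E X \<in> sets borel" unfolding E_def by measurable
      qed (auto simp: E_def)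
      have mE: "measure lborel (E X) \<le> C * t powr (- (2/3))" for X
      proof -
        define f where "f = malmquist_sum a F X"
        have fm: "f \<in> model_space (blaschke_prod a I)" unfolding f_def by (rule malmquist_sum_in_model_space[OF F])
        have fn: "hardy_norm 2 f \<le> H" unfolding f_def H_def M_def by (rule hardy_norm_malmquist_sum_le(2)[OF F(1) lt])
        have "uniformly_continuous_on (cball 0 1) (deriv f)" unfolding f_def
          by (rule compact_uniformly_continuous[OF dc]) simp
        then obtain \<eta> where \<eta>: "\<eta> > 0" "\<And>x x'. norm x \<le> 1 \<Longrightarrow> norm x' \<le> 1 \<Longrightarrow> dist x' x < \<eta> \<Longrightarrow> dist (deriv f x') (deriv f x) < L / 2"
          using L unfolding uniformly_continuous_on_def by (metis mem_cball_0 half_gt_zero)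
        obtain r where r: "max 0 (1 - \<eta>) < r" "r < 1" using dense[of "max 0 (1 - \<eta>)" 1] \<eta> by auto
        have sub: "E X \<subseteq> angles r (\<lambda>w. t * hardy_norm 2 f < norm (deriv f w))"
        proof
          fix \<theta> assume \<theta>: "\<theta> \<in> E X"
          have "dist (deriv f (circ r \<theta>)) (deriv f (cis \<theta>)) < L / 2" using r dist_circ_cis[of r \<theta>] by (intro \<eta>) (auto simp: norm_mult)
          hence "norm (deriv f (cis \<theta>)) - norm (deriv f (circ r \<theta>)) < L / 2"
            using norm_triangle_ineq2[of "deriv f (cis \<theta>)" "deriv f (circ r \<theta>)"] by (simp add: dist_norm norm_minus_commute)
          moreover have "L \<le> norm (deriv f (cis \<theta>))" using \<theta> by (simp add: E_def g_def f_def)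
          moreover have "t * hardy_norm 2 f \<le> L / 2" using mult_left_mono[OF fn, of t] t by simp
          ultimately have "t * hardy_norm 2 f < norm (deriv f (circ r \<theta>))" by linarith
          thus "\<theta> \<in> angles r (\<lambda>w. t * hardy_norm 2 f < norm (deriv f w))" using \<theta> by (simp add: E_def)
        qed
        have fhol: "f holomorphic_on ball 0 1" unfolding f_def by (rule malmquist_sum_holomorphic[OF F(1) lt]) auto
        have "measure lborel (E X) = measure lebesgue (E X)" using bounded_borel_finite(2)[OF E] by simp
        also have "\<dots> \<le> measure lebesgue (angles r (\<lambda>w. t * hardy_norm 2 f < norm (deriv f w)))"
          by (rule measure_mono_fmeasurable[OF sub _ fmeasurable_deriv_superlevel[OF fhol]]) (use E r in auto)
        also have "\<dots> \<le> C * t powr (- (2/3))" by (rule weak[OF fm]) (use r t in auto)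
        finally show ?thesis .
      qed
      have Aint: "integrable lborel (indicat_real A)" using bounded_borel_finite(1)[OF A] A by (intro integrable_real_indicator) auto
      have Eint: "integrable lborel (indicat_real (E X))" for X using bounded_borel_finite(1)[OF E] E by (intro integrable_real_indicator) auto
      \<comment> \<open>Counts pairs of an angle in \<open>A\<close> and a sign pattern that is
        large there. The index \<open>n\<close> supplied below depends on the angle, but at least
        half of the patterns are large at each angle of \<open>A\<close>, whereas each pattern is
        large only on a set of controlled length.\<close>
      have "2 ^ card F * measure lborel A = (\<integral>\<theta>. 2 ^ card F * indicat_real A \<theta> \<partial>lborel)" using Aint by simp
      also have "\<dots> \<le> (\<integral>\<theta>. 2 * (\<Sum>X\<in>Pow F. indicat_real (E X) \<theta>) \<partial>lborel)"
      proof (rule integral_mono)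
        show "integrable lborel (\<lambda>\<theta>. 2 ^ card F * indicat_real A \<theta>)" using Aint by simp
        show "integrable lborel (\<lambda>\<theta>. 2 * (\<Sum>X\<in>Pow F. indicat_real (E X) \<theta>))"
          by (intro integrable_mult_right Bochner_Integration.integrable_sum Eint)
        fix \<theta>
        show "2 ^ card F * indicat_real A \<theta> \<le> 2 * (\<Sum>X\<in>Pow F. indicat_real (E X) \<theta>)"
        proof (cases "\<theta> \<in> A")
          case True
          have "\<exists>n\<in>F. k / (256 * (\<delta> * sqrt \<delta>)) \<le> norm (deriv (malmquist a F n) (cis \<theta>))"
            by (rule norm_deriv_malmquist_multi_arc) (use F lt \<delta> d k True in \<open>auto simp: A_def\<close>)
          then obtain n where n: "n \<in> F" "L \<le> norm (deriv (malmquist a F n) (cis \<theta>))"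
            unfolding L_def by blast
          have "2 ^ card F \<le> 2 * (\<Sum>X\<in>Pow F. of_bool (L \<le> norm (deriv (malmquist_sum a F X) (cis \<theta>))) :: real)"
            by (rule half_sign_patterns[OF F(1) lt _ n]) auto
          also have "\<dots> = 2 * (\<Sum>X\<in>Pow F. indicat_real (E X) \<theta>)"
          proof -
            have "\<theta> \<in> {0..<2*pi}" using True A by auto
            thus ?thesis by (simp add: E_def g_def indicator_def)
          qed
          finally show ?thesis using True by simp
        next
          case False
          thus ?thesis by (simp add: sum_nonneg)
        qed
      qed
      also have "\<dots> = 2 * (\<Sum>X\<in>Pow F. measure lborel (E X))"
        using Eint by (simp add: Bochner_Integration.integral_sum)
      also have "\<dots> \<le> 2 * (\<Sum>X\<in>Pow F. C * t powr (- (2/3)))" by (intro mult_left_mono sum_mono mE) auto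
      also have "\<dots> = 2 ^ card F * (2 * C * t powr (- (2/3)))" using F by (simp add: card_Pow)
      finally have "measure lborel A \<le> 2 * C * t powr (- (2/3))" by (rule mult_left_le_imp_le) simp
      also have "t powr (- (2/3)) = q powr (2/3) * \<delta> * M powr (1/3) * k powr - (2/3)"
      proof -
        have "sqrt (2 * pi * M) = sqrt (2 * pi) * sqrt M" by (rule real_sqrt_mult)
        hence "t = k / (q * (M powr (1/2) * \<delta> powr (3/2)))"
        proof -
          have "\<delta> * sqrt \<delta> = \<delta> powr (3/2)"
            using \<delta> powr_add[of \<delta> 1 "1/2"] by (simp add: powr_half_sqrt)
          thus ?thesis using \<open>sqrt (2 * pi * M) = _\<close> M by (simp add: t_def L_def H_def q_def powr_half_sqrt mult_ac)
        qed
        also have "\<dots> powr (- (2/3)) = k powr - (2/3) / (q powr - (2/3) * (M powr (- (1/3)) * \<delta> powr (- 1)))"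
          using k q M \<delta> by (simp add: powr_divide powr_mult powr_powr)
        also have "\<dots> = q powr (2/3) * \<delta> * M powr (1/3) * k powr - (2/3)"
          using q \<delta> M k by (simp add: powr_minus_divide)
        finally show ?thesis .
      qed
      finally show "measure lebesgue (multi_arc a F \<delta> k) \<le> C' * \<delta> * card F powr (1/3) * k powr - (2/3)"
        using bounded_borel_finite(2)[OF A] by (simp add: A_def[symmetric] C'_def M_def mult_ac)
    qed
  qed
qed

end

theorem theorem3:
  fixes B :: "complex \<Rightarrow> complex"
  assumes "is_blaschke_product B"
  shows "deriv B \<in> weak_hardy_space 1 \<longleftrightarrow>
    (\<exists>C>0. \<forall>f\<in>model_space B. \<forall>r\<in>{0<..<1}. \<forall>t>0.
       circle_length {\<zeta> \<in> sphere 0 1. norm (deriv f (of_real r * \<zeta>)) > t * hardy_norm 2 f}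
         \<le> C * t powr (- (2 / 3)))"
    (is "_ \<longleftrightarrow> ?rhs B")
proof -
  obtain a I where aI: "\<And>n. n \<in> I \<Longrightarrow> norm (a n) < 1" "(\<lambda>n. 1 - norm (a n)) summable_on I"
    and B: "\<And>z. z \<in> ball 0 1 \<Longrightarrow> B z = blaschke_prod a I z"
    using assms unfolding is_blaschke_product_def blaschke_prod_def by blast
  interpret blaschke_sequence a I by standard (use aI in auto)
  define b where "b = blaschke_prod a I"
  \<comment> \<open>\<open>B\<close> is prescribed only on the disc; since the disc is open, its
    values elsewhere do not affect the derivative there.\<close>
  have dB: "deriv B z = deriv b z" if "z \<in> ball 0 1" for z
  proof (rule deriv_cong_ev[OF _ refl])
    show "\<forall>\<^sub>F x in nhds z. B x = b x"
      by (rule eventually_mono[OF eventually_nhds_in_open[OF open_ball that]]) (use B in \<open>simp add: b_def\<close>)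
  qed
  have circ: "of_real r * \<zeta> \<in> ball 0 1" if "r \<in> {0<..<1}" "\<zeta> \<in> sphere 0 1" for r :: real and \<zeta> :: complex
    using that by (simp add: norm_mult)
  have hol: "deriv B holomorphic_on ball 0 1"
    by (rule holomorphic_transform[of "deriv b"])
       (use dB blaschke_prod_holomorphic in \<open>auto simp: b_def intro!: holomorphic_deriv\<close>)
  have weak: "deriv B \<in> weak_hardy_space 1 \<longleftrightarrow>
    (\<exists>C>0. \<forall>r\<in>{0<..<1}. \<forall>t>0. circle_length {\<zeta> \<in> sphere 0 1. norm (deriv b (of_real r * \<zeta>)) > t} \<le> C * t powr - 1)"
  proof -
    have "{\<zeta> \<in> sphere 0 1. norm (deriv B (of_real r * \<zeta>)) > t} = {\<zeta> \<in> sphere 0 1. norm (deriv b (of_real r * \<zeta>)) > t}"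
      if "r \<in> {0<..<1}" for r t using dB[OF circ[OF that]] by auto
    thus ?thesis using hol by (simp add: weak_hardy_space_def)
  qed
  have model: "model_space B = model_space b"
  proof -
    have "hardy_inner f (\<lambda>z. B z * g z) = hardy_inner f (\<lambda>z. b z * g z)" for f g
    proof -
      \<comment> \<open>\<open>Lim\<close> depends only on the values near 1, so the two inner
        products agree even for functions for which the limit fails to exist.\<close>
      have ev: "\<forall>\<^sub>F r in at_left 1. circle_integral r (\<lambda>w. f w * cnj (B w * g w))
          = circle_integral r (\<lambda>w. f w * cnj (b w * g w))"
        unfolding eventually_at_left_field using B[OF circ] by (intro exI[of _ 0]) (auto simp: b_def)
      show ?thesis unfolding hardy_inner_def t2_space_class.Lim_def tendsto_cong[OF ev] ..
    qed
    thus ?thesis by (simp add: model_space_def hardy_orthogonal_complement_def)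
  qed
  show ?thesis
  proof
    assume "deriv B \<in> weak_hardy_space 1"
    then obtain C where C: "0 < C" "\<And>r t. r \<in> {0<..<1} \<Longrightarrow> 0 < t \<Longrightarrow>
        circle_length {\<zeta> \<in> sphere 0 1. norm (deriv b (of_real r * \<zeta>)) > t} \<le> C * t powr - 1"
      unfolding weak by blast
    have "\<exists>M. exponential_zeros a I M"
    proof (rule weak_hardy_imp_exponential_zeros[OF C(1)])
      fix r t :: real assume "0 < r" "r < 1" "0 < t"
      thus "measure lebesgue (angles r (\<lambda>w. t < norm (deriv (blaschke_prod a I) w))) \<le> C * t powr - 1"
        using C(2)[of r t, unfolded circle_length_Collect b_def] by (metis greaterThanLessThan_iff)
    qed
    then obtain M where "exponential_zeros a I M" ..
    thus "?rhs B" unfolding model b_def by (rule exponential_zeros_imp_model_space)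
  next
    assume "?rhs B"
    then obtain C where C: "0 < C" "\<And>f r t. f \<in> model_space b \<Longrightarrow> r \<in> {0<..<1} \<Longrightarrow> 0 < t \<Longrightarrow>
        circle_length {\<zeta> \<in> sphere 0 1. norm (deriv f (of_real r * \<zeta>)) > t * hardy_norm 2 f} \<le> C * t powr (- (2/3))"
      unfolding model by blast
    have "\<exists>M. exponential_zeros a I M"
    proof (rule model_space_imp_exponential_zeros[OF C(1)])
      fix f and r t :: real assume "f \<in> model_space (blaschke_prod a I)" "0 < r" "r < 1" "0 < t"
      thus "measure lebesgue (angles r (\<lambda>w. t * hardy_norm 2 f < norm (deriv f w))) \<le> C * t powr (- (2/3))"
        using C(2)[of f r t, unfolded circle_length_Collect b_def] by (metis greaterThanLessThan_iff)
    qed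
    then obtain M where "exponential_zeros a I M" ..
    thus "deriv B \<in> weak_hardy_space 1" unfolding weak b_def by (rule exponential_zeros_imp_weak_hardy)
  qed
qed

end
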